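(* Let $n\ge2$, let $\{\Psi_a\}_{a\in\mathbb R_+}$ be a spherical wavelet on $\mathcal S^n$, let $\mathcal U=\mathcal W_\Psi(\mathcal L^2(\mathcal S^n))\subset\mathcal L^2(\mathbb R_+\times\mathcal S^n,\frac{da}{a}\,d\sigma)$ be the image of its wavelet transform, and let $\Pi$ be the reproducing kernel of $\mathcal U$. Let $\mathcal B=\{b_j\}_{j\in\mathbb N_0}\subset\mathbb R_+$ be a set of scales with $$\widetilde\delta\leq b_j/b_{j+1}\leq\delta\quad\text{for all } j,\ \text{for some }\widetilde\delta>1,$$ and let $\nu(b_j)=\nu_j=\log(b_j/b_{j+1})$. Suppose that $\{\Pi(a,x;\cdot,\cdot):\ (a,x)\in\mathcal B\times\mathcal S^n\}$ is a frame for $\mathcal U$ with respect to the weights $\{C\nu_j\delta_{b_j}\}$ with a constant $C$, i.e., for some $0\le\Delta<1$ and all $s\in\mathcal U$, $$(1-\Delta)\|s\|^2\leq C\sum_j\int_{\mathcal S^n}\left|\int_{\mathbb R_+\times\mathcal S^n}\Pi(b_j,x;b,y)\,s(b,y)\,d\sigma(y)\frac{db}{b}\right|^2d\sigma(x)\,\nu_j\leq(1+\Delta)\|s\|^2 .$$ Suppose in addition that there are positive constants $\mathfrak d,\omega,\epsilon$ and $\tilde\epsilon<1/2$ such that for all $a,b\leq b_0$ and $x,y\in\mathcal S^n$ each of the two quantities $$|\Pi(a,x;b,y)|\qquad\text{and}\qquad\bigl|(a+b)\,\nabla_{\!\ast}\Pi(a,x;b,y)\bigr|$$ is bounded by $$(ab)^{n+\epsilon}\cdot\begin{cases}\dfrac{\mathfrak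 d}{(a+b)^{3n+2\epsilon}}, & \angle(x,y)\leq\omega[a+(2-\tilde\epsilon)b],\\[2ex]\dfrac{\mathfrak d}{\angle(x,y)^{3n+2\epsilon}}, & \angle(x,y)>\omega(a+\tilde\epsilon b),\end{cases}$$ (both bounds being required where the two ranges overlap), where $\nabla_{\!\ast}$ is the surface gradient with respect to any of the variables $x$ or $y$. Then there exists a constant $\rho>0$ such that for any grid $\Lambda\subset\mathcal B\times\mathcal S^n$ of type $(\delta,\Xi)$ (with scale sequence $\mathcal B$) with $\Xi\leq\rho$, the family $\{\Pi(b,y;\cdot,\cdot):\ (b,y)\in\Lambda\}$ is a frame for $\mathcal U$ with weight $C\sum_{(b,y)\in\Lambda}\mu(b,y)\,\delta_b\,\delta_y$, where $\mu(b,y)=\sigma(\mathcal O_k^{(b)})\,\nu(b)$ for the partition set $\mathcal O_k^{(b)}\ni y$; i.e., there is $0\le\epsilon'<1$ such that for all $s\in\mathcal U$ $$(1-\epsilon')\|s\|^2\leq C\sum_{(b,y)\in\Lambda}\mu(b,y)\left|\int_{\mathbb R_+\times\mathcal S^n}\Pi(b,y;b',y')\,s(b',y')\,d\sigma(y')\frac{db'}{b'}\right|^2\leq(1+\epsilon')\|s\|^2 .$$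
   Context: $\mathcal S^n\subset\mathbb R^{n+1}$ is the unit sphere with rotation-invariant surface measure $\sigma$ of total mass $\Sigma_n=\frac{2\pi^{\lambda+1}}{\Gamma(\lambda+1)}$, $\lambda=\frac{n-1}2$; $\angle(x,y)=\arccos(x\cdot y)$ is the geodesic distance. The scalar product on $\mathcal L^2(\mathcal S^n)$ is $\langle f,g\rangle=\frac1{\Sigma_n}\int_{\mathcal S^n}\overline f\,g\,d\sigma$. A zonal function depends only on $\hat e\cdot x$, $\hat e=(1,0,\dots,0)$, and is identified with a function on $[-1,1]$. The Gegenbauer polynomials are defined by $\sum_{l\ge0}C_l^\lambda(t)r^l=(1-2tr+r^2)^{-\lambda}$; $\widehat f(l)$ denotes the coefficients in $f(t)=\sum_l\widehat f(l)C_l^\lambda(t)$ for zonal $f$. Convolution with zonal $g$: $(f\ast g)(x)=\frac1{\Sigma_n}\int f(y)g(x\cdot y)d\sigma(y)$. A family $\{\Psi_a\}_{a\in\mathbb R_+}$ of zonal integrable functions is a spherical wavelet if (1) $\int_0^\infty|\widehat{\Psi_a}(l)|^2\frac{da}{a}=\left(\frac{l+\lambda}{\lambda}\right)^2$ for every $l\in\mathbb N_0$, and (2) there is $M$ such that for all $R>0$, $\int_{-1}^1\bigl|\int_R^\infty(\overline{\Psi_a}\ast\Psi_a)(t)\frac{da}{a}\bigr|(1-t^2)^{\lambda-1/2}dt\le M$. The wavelet transform is $\mathcal W_\Psi f(a,x)=\langle\Psi_{a,x},f\rangle$ with $\Psi_{a,x}(y)=\Psi_a(x\cdot y)$. $\Pi$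 is the reproducing kernel of $\mathcal U$: $s(a,x)=\int_{\mathbb R_+\times\mathcal S^n}\Pi(a,x;b,y)\,s(b,y)\,d\sigma(y)\frac{db}{b}$ for $s\in\mathcal U$, with $\Pi(a,x;\cdot,\cdot)\in\mathcal L^2(\mathbb R_+\times\mathcal S^n,\frac{db}{b}d\sigma)$; $\|s\|$ is the norm of that space. A grid $\Lambda\subset\mathbb R_+\times\mathcal S^n$ is of type $(\delta,\Xi)$ if: there is a sequence of scales $\mathcal B=(b_j)_{j\in\mathbb N_0}$ with $\widetilde\delta\le b_j/b_{j+1}\le\delta$ for all $j$, for some $\widetilde\delta>1$; at each scale $b=b_j$ there is a measurable partition $\mathcal P_b=\{\mathcal O_k^{(b)}:k=1,\dots,K_b\}$ of $\mathcal S^n$ into simply connected sets, each of geodesic diameter at most $\Xi\,b$; and each of these sets contains exactly one point of the grid (i.e. exactly one $y\in\mathcal O_k^{(b)}$ with $(b,y)\in\Lambda$). *)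

theory Defs
  imports "HOL-Analysis.Analysis"
begin

section \<open>The sphere\<close>

text \<open>
  The ambient space is \<open>real^'d\<close> with \<open>CARD('d) = n + 1\<close>. The sort \<open>{finite,wellorder}\<close> orders the
  coordinates, so that there is a first one; every cardinality is attained by such a type.
\<close>

abbreviation usphere :: "(real^'d) set" where
  "usphere \<equiv> sphere 0 1"

definition sph_lambda :: "'d itself \<Rightarrow> real" where
  "sph_lambda _ = (real CARD('d) - 2) / 2"

definition sphere_area :: "'d itself \<Rightarrow> real" where
  "sphere_area d = 2 * pi powr (sph_lambda d + 1) / Gamma (sph_lambda d + 1)"

text \<open>
  The surface measure, as \<open>n + 1\<close> times the volume of the cone over a set; the two lemmas below
  characterise it as the rotation-invariant measure with the right total mass.
\<close>

definition sphere_measure :: "(real^'d) measure" where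
  "sphere_measure =
     scale_measure (of_nat CARD('d))
       (distr (restrict_space lborel (ball 0 1 - {0})) (restrict_space borel usphere) sgn)"

lemma space_sphere_measure [simp]: "space sphere_measure = usphere"
  by (simp add: sphere_measure_def space_scale_measure space_restrict_space)

lemma sets_sphere_measure [simp]: "sets sphere_measure = sets (restrict_space borel usphere)"
  by (simp add: sphere_measure_def)

lemma sgn_measurable_cone:
  "sgn \<in> measurable (restrict_space lborel (ball 0 1 - {0})) (restrict_space borel (usphere :: (real^'d) set))"
proof (rule measurable_restrict_space2)
  show "sgn \<in> space (restrict_space lborel (ball 0 1 - {0 :: real^'d})) \<rightarrow> usphere"
    by (auto simp: space_restrict_space norm_sgn)
  have "continuous_on (ball 0 1 - {0 :: real^'d}) sgn"
    unfolding sgn_div_norm by (intro continuous_intros) auto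
  then have "sgn \<in> borel_measurable (restrict_space borel (ball 0 1 - {0 :: real^'d}))"
    by (rule borel_measurable_continuous_on_restrict)
  then show "sgn \<in> borel_measurable (restrict_space lborel (ball 0 1 - {0 :: real^'d}))"
    by (simp add: measurable_def space_restrict_space sets_restrict_space)
qed

lemma emeasure_sphere_measure:
  fixes A :: "(real^'d) set"
  assumes "A \<in> sets (restrict_space borel usphere)"
  shows "emeasure sphere_measure A
       = of_nat CARD('d) * emeasure lborel {x \<in> ball 0 1 - {0}. sgn x \<in> A}"
proof -
  have "sgn -` A \<inter> space (restrict_space lborel (ball 0 1 - {0})) = {x \<in> ball 0 1 - {0}. sgn x \<in> A}"
    by (auto simp: space_restrict_space)
  moreover have "emeasure (restrict_space lborel (ball 0 1 - {0})) {x \<in> ball 0 1 - {0}. sgn x \<in> A}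
      = emeasure lborel {x \<in> ball 0 1 - {0}. sgn x \<in> A}"
    by (rule emeasure_restrict_space) auto
  ultimately show ?thesis
    unfolding sphere_measure_def
    by (simp only: emeasure_scale_measure emeasure_distr[OF sgn_measurable_cone assms])
qed

lemma emeasure_sphere_measure_space:
  "emeasure (sphere_measure :: (real^'d) measure) usphere = ennreal (sphere_area TYPE('d))"
proof -
  have "{x \<in> ball 0 1 - {0}. sgn x \<in> usphere} = ball 0 1 - {0 :: real^'d}"
    by (auto simp: norm_sgn)
  moreover have "emeasure lborel (ball 0 1 - {0 :: real^'d}) = emeasure lborel (ball 0 1 :: (real^'d) set)"
    by (subst emeasure_Diff) auto
  moreover have "usphere \<in> sets (restrict_space borel (usphere :: (real^'d) set))"
    by (metis sets.top space_restrict_space2 space_sphere_measure sets_sphere_measure)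
  ultimately have *: "emeasure (sphere_measure :: (real^'d) measure) usphere
      = of_nat CARD('d) * ennreal (unit_ball_vol (real CARD('d)))"
    by (subst emeasure_sphere_measure) (auto simp: emeasure_ball)
  have d: "real CARD('d) > 0"
    by simp
  have "real CARD('d) * unit_ball_vol (real CARD('d)) = sphere_area TYPE('d)"
  proof -
    have "Gamma (real CARD('d) / 2 + 1) = real CARD('d) / 2 * Gamma (real CARD('d) / 2)"
      using d nonpos_Ints_nonpos[of "real CARD('d) / 2"] by (intro Gamma_plus1) force
    then have "real CARD('d) * (pi powr (real CARD('d) / 2) / Gamma (real CARD('d) / 2 + 1))
        = 2 * pi powr (real CARD('d) / 2) / Gamma (real CARD('d) / 2)"
      using d by (simp only:) (simp add: field_simps)
    then show ?thesis
      by (simp add: unit_ball_vol_def sphere_area_def sph_lambda_def diff_divide_distrib)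
  qed
  then show ?thesis
    unfolding * ennreal_of_nat_eq_real_of_nat by (subst ennreal_mult[symmetric]) auto
qed

lemma distr_sphere_measure_rotation:
  fixes f :: "real^'d::{finite,wellorder} \<Rightarrow> real^'d::_"
  assumes f: "orthogonal_transformation f"
  shows "distr sphere_measure sphere_measure f = sphere_measure"
proof (rule measure_eqI)
  have nf: "norm (f x) = norm x" for x
    using f by (simp add: orthogonal_transformation_norm)
  have lin: "linear f"
    using f by (rule orthogonal_transformation_linear)
  have fm: "f \<in> borel_measurable borel"
    using lin by (intro borel_measurable_continuous_onI linear_continuous_on) (simp add: linear_linear)
  have meas: "f \<in> measurable sphere_measure sphere_measure"
  proof -
    have "f \<in> measurable (restrict_space borel usphere) (restrict_space borel usphere)"
      using fm by (intro measurable_restrict_space3) (auto simp: nf)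
    then show ?thesis
      by (subst measurable_cong_sets[OF sets_sphere_measure sets_sphere_measure])
  qed
  fix A assume "A \<in> sets (distr sphere_measure sphere_measure f)"
  then have A: "A \<in> sets (restrict_space borel usphere)"
    by simp
  let ?A' = "f -` A \<inter> usphere"
  let ?c = "\<lambda>B. {x \<in> ball 0 1 - {0}. sgn x \<in> B}"
  have A': "?A' \<in> sets (restrict_space borel usphere)"
    using measurable_sets[OF meas, of A] A by simp
  have cm: "?c B \<in> sets lborel" if "B \<in> sets (restrict_space borel usphere)" for B :: "(real^'d::_) set"
  proof -
    have "sgn -` B \<inter> space (restrict_space lborel (ball 0 1 - {0})) \<in> sets (restrict_space lborel (ball 0 1 - {0}))"
      by (rule measurable_sets[OF sgn_measurable_cone that])
    moreover have "sgn -` B \<inter> space (restrict_space lborel (ball 0 1 - {0})) = ?c B"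
      by (auto simp: space_restrict_space)
    ultimately have "?c B \<in> sets (restrict_space lborel (ball 0 1 - {0}))"
      by simp
    then show ?thesis
      by (rule sets_restrict_space_iff[THEN iffD1, THEN conjunct2, rotated]) simp
  qed
  have lm: "?c B \<in> lmeasurable" if "B \<in> sets (restrict_space borel usphere)" for B :: "(real^'d::_) set"
  proof (rule bounded_set_imp_lmeasurable)
    show "bounded (?c B)"
      by (rule bounded_subset[OF bounded_ball[of 0 1]]) auto
    show "?c B \<in> sets lebesgue"
      using cm[OF that] by auto
  qed
  have em: "emeasure lborel (?c B) = ennreal (measure lebesgue (?c B))"
    if "B \<in> sets (restrict_space borel usphere)" for B :: "(real^'d::_) set"
  proof -
    have "emeasure lebesgue (?c B) = emeasure lborel (?c B)"
      using cm[OF that] fmeasurableD[OF lm[OF that]] by (simp only: emeasure_completion main_part)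
    then show ?thesis
      using emeasure_eq_measure2[OF lm[OF that]] by simp
  qed
  have sgnf: "sgn (f x) = f (sgn x)" for x
    using lin by (simp add: sgn_div_norm nf linear_cmul)
  have img: "f ` ?c ?A' = ?c A"
  proof (intro equalityI subsetI)
    fix y assume "y \<in> f ` ?c ?A'"
    then obtain x where x: "x \<in> ?c ?A'" "y = f x" by blast
    then have "norm y = norm x" "sgn y \<in> A" using nf sgnf by auto
    moreover have "norm x < 1" "norm x \<noteq> 0" using x by auto
    ultimately show "y \<in> ?c A" by auto
  next
    fix y assume y: "y \<in> ?c A"
    obtain x where x: "y = f x"
      using orthogonal_transformation_surj[OF f] by (blast dest: surjD)
    have "norm y < 1" "norm y \<noteq> 0" using y by auto
    then have "norm x < 1" "norm x \<noteq> 0" using x nf by auto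
    moreover have "f (sgn x) \<in> A" using y x sgnf by auto
    ultimately have "x \<in> ?c ?A'"
      by (auto simp: norm_sgn)
    with x show "y \<in> f ` ?c ?A'" by blast
  qed
  have "emeasure (distr sphere_measure sphere_measure f) A = emeasure sphere_measure ?A'"
    using emeasure_distr[OF meas, of A] A by (simp only: sets_sphere_measure space_sphere_measure)
  also have "\<dots> = of_nat CARD('d) * ennreal (measure lebesgue (?c ?A'))"
    unfolding emeasure_sphere_measure[OF A'] em[OF A'] ..
  also have "measure lebesgue (?c ?A') = measure lebesgue (?c A)"
    using measure_orthogonal_image[OF f lm[OF A']] unfolding img by (rule sym)
  also have "of_nat CARD('d) * ennreal (measure lebesgue (?c A)) = emeasure sphere_measure A"
    unfolding emeasure_sphere_measure[OF A] em[OF A] ..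
  finally show "emeasure (distr sphere_measure sphere_measure f) A = emeasure sphere_measure A" .
qed simp

definition geo_dist :: "real^'d \<Rightarrow> real^'d \<Rightarrow> real" where
  "geo_dist x y = arccos (x \<bullet> y)"

text \<open>
  The surface gradient at a point of the unit sphere is the Euclidean gradient of the extension that
  is constant along rays. Since functions are complex-valued, it is a vector in \<open>complex^'d\<close>.
\<close>

definition has_surface_gradient ::
    "(real^'d \<Rightarrow> complex) \<Rightarrow> complex^'d \<Rightarrow> real^'d \<Rightarrow> bool" where
  "has_surface_gradient F g x \<longleftrightarrow>
     ((\<lambda>z. F (sgn z)) has_derivative (\<lambda>v. \<Sum>i\<in>UNIV. of_real (v $ i) * g $ i)) (at x)"


section \<open>Square-integrable functions\<close>

definition L2_space :: "'b measure \<Rightarrow> ('b \<Rightarrow> complex) set" where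
  "L2_space M = {f. f \<in> borel_measurable M \<and> integrable M (\<lambda>x. (cmod (f x))\<^sup>2)}"

text \<open>The measure \<open>da/a\<close> on the positive reals, and \<open>da/a d\<sigma>\<close> on the product with the sphere.\<close>

definition dilation_measure :: "real measure" where
  "dilation_measure = density (restrict_space lborel {0<..}) (\<lambda>a. ennreal (1 / a))"

definition phase_measure :: "(real \<times> (real^'d)) measure" where
  "phase_measure = dilation_measure \<Otimes>\<^sub>M sphere_measure"

definition phase_norm_sq :: "(real \<times> (real^'d) \<Rightarrow> complex) \<Rightarrow> real" where
  "phase_norm_sq s = (LINT z|phase_measure. (cmod (s z))\<^sup>2)"

definition sph_inner :: "(real^'d \<Rightarrow> complex) \<Rightarrow> (real^'d \<Rightarrow> complex) \<Rightarrow> complex" where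
  "sph_inner f g = (LINT x|sphere_measure. cnj (f x) * g x) / of_real (sphere_area TYPE('d))"


section \<open>Zonal functions and Gegenbauer coefficients\<close>

definition pole :: "real^'d::{finite,wellorder}" where
  "pole = axis (LEAST i. True) 1"

text \<open>
  A zonal function and its profile on \<open>{-1..1}\<close>. The profile of \<open>F\<close> is meaningful when \<open>F x\<close>
  depends only on \<open>pole \<bullet> x\<close>.
\<close>

definition zonal :: "(real \<Rightarrow> complex) \<Rightarrow> real^'d::{finite,wellorder} \<Rightarrow> complex" where
  "zonal g x = g (pole \<bullet> x)"

definition zonal_profile :: "(real^'d::{finite,wellorder} \<Rightarrow> complex) \<Rightarrow> real \<Rightarrow> complex" where
  "zonal_profile F t = F (SOME x. x \<in> usphere \<and> pole \<bullet> x = t)"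

definition sph_conv ::
    "(real^'d \<Rightarrow> complex) \<Rightarrow> (real \<Rightarrow> complex) \<Rightarrow> real^'d \<Rightarrow> complex" where
  "sph_conv f g x =
     (LINT y|sphere_measure. f y * g (x \<bullet> y)) / of_real (sphere_area TYPE('d))"

text \<open>\<open>C\<^sub>l\<^sup>\<lambda>(t)\<close>: the coefficient of \<open>r\<^sup>l\<close> in the formal power series \<open>(1 - 2 t r + r\<^sup>2)\<^bsup>-\<lambda>\<^esup>\<close>.\<close>

definition gegenbauer :: "real \<Rightarrow> nat \<Rightarrow> real \<Rightarrow> real" where
  "gegenbauer lam l t =
     fps_nth (fps_compose (fps_binomial (- lam)) (fps_X\<^sup>2 - fps_const (2 * t) * fps_X)) l"

definition gegenbauer_measure :: "real \<Rightarrow> real measure" where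
  "gegenbauer_measure lam =
     density (restrict_space lborel {-1..1}) (\<lambda>t. ennreal ((1 - t\<^sup>2) powr (lam - 1 / 2)))"

text \<open>
  For a function that is only integrable, the coefficients in the (formal) expansion
  \<open>f \<sim> \<Sum>l. f^(l) C\<^sub>l\<^sup>\<lambda>\<close> are those given by orthogonality of the \<open>C\<^sub>l\<^sup>\<lambda>\<close> for the above weight.
\<close>

definition gegenbauer_coeff :: "real \<Rightarrow> (real \<Rightarrow> complex) \<Rightarrow> nat \<Rightarrow> complex" where
  "gegenbauer_coeff lam f l =
     (LINT t|gegenbauer_measure lam. f t * of_real (gegenbauer lam l t)) /
     of_real (LINT t|gegenbauer_measure lam. (gegenbauer lam l t)\<^sup>2)"


section \<open>Spherical wavelets\<close>

text \<open>
  Zonal functions are given by their profiles, hence the type argument for the sphere. In the second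
  condition, the inner integral is required to exist for almost all \<open>t\<close>, and the outer one to exist.
\<close>

definition spherical_wavelet ::
    "'d::{finite,wellorder} itself \<Rightarrow> (real \<Rightarrow> real \<Rightarrow> complex) \<Rightarrow> bool" where
  "spherical_wavelet d \<Psi> \<longleftrightarrow>
     (let lam = sph_lambda d;
          conv = (\<lambda>a t. zonal_profile
                    (sph_conv (zonal (\<lambda>u. cnj (\<Psi> a u)) :: real^'d::_ \<Rightarrow> complex) (\<Psi> a)) t)
      in (\<forall>a>0. integrable sphere_measure (zonal (\<Psi> a) :: real^'d::_ \<Rightarrow> complex)) \<and>
         (\<forall>l. has_bochner_integral dilation_measure
                (\<lambda>a. (cmod (gegenbauer_coeff lam (\<Psi> a) l))\<^sup>2) (((real l + lam) / lam)\<^sup>2)) \<and>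
         (\<exists>M. \<forall>R>0.
            (AE t in gegenbauer_measure lam.
               set_integrable dilation_measure {R<..} (\<lambda>a. conv a t)) \<and>
            integrable (gegenbauer_measure lam)
              (\<lambda>t. cmod (LINT a:{R<..}|dilation_measure. conv a t)) \<and>
            (LINT t|gegenbauer_measure lam.
               cmod (LINT a:{R<..}|dilation_measure. conv a t)) \<le> M))"

definition wavelet_transform ::
    "(real \<Rightarrow> real \<Rightarrow> complex) \<Rightarrow> (real^'d \<Rightarrow> complex) \<Rightarrow> real \<times> (real^'d) \<Rightarrow> complex" where
  "wavelet_transform \<Psi> f = (\<lambda>(a, x). sph_inner (\<lambda>y. \<Psi> a (x \<bullet> y)) f)"

text \<open>The image of the transform; the values of its members off \<open>{0<..} \<times> usphere\<close> are irrelevant.\<close>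

definition wavelet_image ::
    "(real \<Rightarrow> real \<Rightarrow> complex) \<Rightarrow> (real \<times> (real^'d) \<Rightarrow> complex) set" where
  "wavelet_image \<Psi> =
     {s. \<exists>f\<in>L2_space sphere_measure. \<forall>z\<in>{0<..} \<times> usphere. s z = wavelet_transform \<Psi> f z}"


section \<open>Reproducing kernels, grids and bounds\<close>

definition kernel_int ::
    "(real \<times> (real^'d) \<Rightarrow> real \<times> (real^'d) \<Rightarrow> complex) \<Rightarrow> (real \<times> (real^'d) \<Rightarrow> complex)
       \<Rightarrow> real \<times> (real^'d) \<Rightarrow> complex" where
  "kernel_int K s z = (LINT w|phase_measure. K z w * s w)"

text \<open>
  As the reproducing formula contains no complex conjugate, the point evaluation at \<open>z\<close> is represented
  by the conjugate of \<open>K z\<close>. It is this function that belongs to \<open>U\<close>, which makes \<open>K\<close> unique.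
\<close>

definition reproducing_kernel ::
    "(real \<times> (real^'d) \<Rightarrow> complex) set
       \<Rightarrow> (real \<times> (real^'d) \<Rightarrow> real \<times> (real^'d) \<Rightarrow> complex) \<Rightarrow> bool" where
  "reproducing_kernel U K \<longleftrightarrow>
     (\<forall>z\<in>{0<..} \<times> usphere.
        K z \<in> L2_space phase_measure \<and>
        (\<lambda>w. cnj (K z w)) \<in> U \<and>
        (\<forall>s\<in>U. s z = kernel_int K s z))"

definition scale_sequence :: "real \<Rightarrow> (nat \<Rightarrow> real) \<Rightarrow> bool" where
  "scale_sequence \<delta> b \<longleftrightarrow>
     (\<forall>j. b j > 0) \<and> (\<exists>\<delta>'>1. \<forall>j. \<delta>' \<le> b j / b (Suc j) \<and> b j / b (Suc j) \<le> \<delta>)"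

text \<open>
  The weight \<open>\<nu>\<close> as a function on the set of scales. A scale sequence is strictly decreasing,
  so the index of a scale is unique.
\<close>

definition scale_weight :: "(nat \<Rightarrow> real) \<Rightarrow> real \<Rightarrow> real" where
  "scale_weight b c = (let j = (THE j. b j = c) in ln (b j / b (Suc j)))"

text \<open>
  \<open>P c\<close> is the partition at the scale \<open>c\<close>. Its cells are measurable in the sense of the
  completed surface measure (Lebesgue measurable).
\<close>

definition grid_of_type ::
    "real \<Rightarrow> real \<Rightarrow> (nat \<Rightarrow> real) \<Rightarrow> (real \<Rightarrow> (real^'d) set set)
       \<Rightarrow> (real \<times> (real^'d)) set \<Rightarrow> bool" where
  "grid_of_type \<delta> \<Xi> b P \<Lambda> \<longleftrightarrow>
     scale_sequence \<delta> b \<and>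
     \<Lambda> \<subseteq> range b \<times> usphere \<and>
     (\<forall>c\<in>range b.
        finite (P c) \<and> partition_on usphere (P c) \<and>
        (\<forall>Q\<in>P c.
           Q \<in> sets (completion sphere_measure) \<and>
           simply_connected Q \<and>
           (\<forall>x\<in>Q. \<forall>y\<in>Q. geo_dist x y \<le> \<Xi> * c) \<and>
           (\<exists>!y. y \<in> Q \<and> (c, y) \<in> \<Lambda>)))"

definition grid_weight ::
    "(nat \<Rightarrow> real) \<Rightarrow> (real \<Rightarrow> (real^'d) set set) \<Rightarrow> real \<times> (real^'d) \<Rightarrow> real" where
  "grid_weight b P = (\<lambda>(c, y).
     measure (completion sphere_measure) (THE Q. Q \<in> P c \<and> y \<in> Q) * scale_weight b c)"

text \<open>\<open>q\<close> obeys the two-regime decay estimate at the points \<open>(a, x)\<close>, \<open>(b, y)\<close>;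
  \<open>n\<close> is the dimension of the sphere.\<close>

definition kernel_bound ::
    "nat \<Rightarrow> real \<Rightarrow> real \<Rightarrow> real \<Rightarrow> real \<Rightarrow> real \<times> (real^'d) \<Rightarrow> real \<times> (real^'d) \<Rightarrow> real \<Rightarrow> bool" where
  "kernel_bound n \<dd> \<omega> \<epsilon> \<epsilon>' = (\<lambda>(a, x) (b, y) q.
     (geo_dist x y \<le> \<omega> * (a + (2 - \<epsilon>') * b) \<longrightarrow>
        q \<le> (a * b) powr (n + \<epsilon>) * (\<dd> / (a + b) powr (3 * n + 2 * \<epsilon>))) \<and>
     (geo_dist x y > \<omega> * (a + \<epsilon>' * b) \<longrightarrow>
        q \<le> (a * b) powr (n + \<epsilon>) * (\<dd> / geo_dist x y powr (3 * n + 2 * \<epsilon>))))"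

end

theory Submission
  imports Defs
begin

text \<open>
  By the reproducing property the frame coefficients of \<open>s\<close> are the point values of \<open>s\<close>, so the grid sum
  differs from the semi-continuous sum by the sampling error
  \<open>E = C \<Sum>\<^sub>j \<nu>\<^sub>j \<Sum>\<^sub>Q \<integral>\<^sub>Q |s(b\<^sub>j, x) - s(b\<^sub>j, y\<^sub>Q)|\<^sup>2 d\<sigma>(x)\<close>, and it suffices that \<open>E \<le> \<eta> \<parallel>s\<parallel>\<^sup>2\<close> with \<open>\<eta>\<close> small.
  The kernel is controlled at the scales \<open>\<le> b\<^sub>0\<close> only, so the reproducing integral cannot be estimated
  directly. Instead \<open>E\<close> is written as the pairing of \<open>s\<close> with a combination \<open>h \<in> U\<close> of kernel differences,
  and the lower frame bound reduces \<open>\<parallel>h\<parallel>\<close> to the values of \<open>h\<close> on the scales \<open>b\<^sub>j\<close>. There Schur's test applies: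
  by the gradient estimate a difference of kernels over a cell of diameter \<open>\<Xi> b\<^sub>i\<close> is at most a constant times
  \<open>\<Xi> min(b\<^sub>i/b\<^sub>j, b\<^sub>j/b\<^sub>i) (b\<^sub>i + b\<^sub>j) / (b\<^sub>i + b\<^sub>j + |x - y|)\<^bsup>n+1\<^esup>\<close>, which is summable over the scales and the sphere.
\<close>

section \<open>The surface measure of caps\<close>

text \<open>With integrals over the cells, \<open>h\<close> would be a continuous superposition of
  kernel differences. Only finite combinations are formed instead, because for them membership in
  \<open>U\<close> needs no more than linearity. Even linearity takes an argument, as the transform
  is given pointwise by integrals that may diverge at some points. To get down to finite sums,
  \<open>E\<close> is approached from below by simple functions, and each level set is represented
  by one of its points. For such a sum q one has q = <h, s>, while the frame bound and Schur's test
  give (1 - \<Delta>) |h|^2 \<le> \<kappa>^2 q. As q occurs on both sides, Cauchy-Schwarz closes up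
  to q \<le> \<kappa>^2 / (1 - \<Delta>) |s|^2, with no dependence on the number of points. Here
  \<kappa> is proportional to the mesh size: an arc of length at most \<Xi> b_i meets a gradient
  bound carrying the factor 1 / (b_i + b_j). The price of using the frame bound is the factor 1 / (1
  - \<Delta>), so the admissible mesh size shrinks as \<Delta> approaches 1.\<close>

lemma finite_measure_sphere_measure: "finite_measure (sphere_measure :: (real^'d) measure)"
  by (rule finite_measureI) (simp add: emeasure_sphere_measure_space)

lemma emeasure_completion_sphere_measure:
  "emeasure (completion (sphere_measure :: (real^'d) measure)) A = ennreal (measure (completion sphere_measure) A)"
proof -
  let ?M = "completion (sphere_measure :: (real^'d) measure)"
  have "emeasure ?M A \<le> emeasure ?M (space ?M)" by (rule emeasure_space)
  also have "\<dots> < top"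
    using nn_integral_completion[of "sphere_measure :: (real^'d) measure" "\<lambda>_. 1"]
    by (simp add: emeasure_sphere_measure_space)
  finally show ?thesis by (intro emeasure_eq_ennreal_measure) simp
qed

text \<open>The set is the dilate of \<open>S\<close> by the factor \<open>R\<close>, written as a
  preimage so that its measurability is that of the map.\<close>

lemma emeasure_lborel_scaleR_vimage:
  fixes S :: "'a::euclidean_space set"
  assumes S: "S \<in> sets borel" and R: "R > 0"
  shows "emeasure lborel {z. z /\<^sub>R R \<in> S} = ennreal (R ^ DIM('a)) * emeasure lborel S"
proof -
  have m: "{z. z /\<^sub>R R \<in> S} \<in> sets borel"
    using measurable_sets[of "\<lambda>z. z /\<^sub>R R" borel borel S] S by (simp add: vimage_def)
  have "emeasure lborel {z. z /\<^sub>R R \<in> S}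
      = emeasure (density (distr lborel borel (\<lambda>x. 0 + R *\<^sub>R x)) (\<lambda>_. ennreal (\<bar>R\<bar> ^ DIM('a)))) {z. z /\<^sub>R R \<in> S}"
    using R by (subst lborel_affine[of R 0]) auto
  also have "\<dots> = ennreal (R ^ DIM('a)) * emeasure (distr lborel borel (\<lambda>x. 0 + R *\<^sub>R x)) {z. z /\<^sub>R R \<in> S}"
    using m R by (subst emeasure_density_const) auto
  also have "emeasure (distr lborel borel (\<lambda>x. 0 + R *\<^sub>R x)) {z. z /\<^sub>R R \<in> S} = emeasure lborel S"
    using m R by (subst emeasure_distr) (auto simp: vimage_def)
  finally show ?thesis .
qed

lemma sphere_cap_sets: "usphere \<inter> cball x r \<in> sets (restrict_space borel usphere)"
  by (auto simp: sets_restrict_space_iff borel_closed closed_Int)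

text \<open>The shell of width \<open>r\<close> over a cap of radius \<open>r\<close> lies in a ball of radius \<open>2 r\<close>, while by
  homogeneity its volume is at least \<open>r\<close> times that of the cone over the cap.\<close>

lemma emeasure_sphere_cap_le:
  fixes x :: "real^'d"
  assumes r: "r > 0"
  shows "emeasure sphere_measure (usphere \<inter> cball x r)
     \<le> ennreal (real CARD('d) * unit_ball_vol (real CARD('d)) * 2 ^ CARD('d) * r ^ (CARD('d) - 1))"
proof -
  let ?d = "CARD('d)"
  define B where "B = usphere \<inter> cball x r"
  define V where "V = {z \<in> ball 0 1 - {0 :: real^'d}. sgn z \<in> B}"
  \<comment> \<open>The cone \<open>V\<close> dilated by 1 + r; hence \<open>W - V\<close> is the
    shell with radii in [1, 1 + r) over the cap.\<close>
  define W where "W = {z \<in> ball 0 (1 + r) - {0 :: real^'d}. sgn z \<in> B}"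
  have sgnm: "(sgn :: real^'d \<Rightarrow> real^'d) \<in> borel_measurable borel"
    by measurable
  have Bs: "B \<in> sets borel"
    by (simp add: B_def borel_closed closed_Int)
  have sB: "{z. sgn z \<in> B} \<in> sets borel"
    using measurable_sets[OF sgnm Bs] by (simp add: vimage_def)
  have Vs: "V \<in> sets borel"
  proof -
    have "V = (ball 0 1 - {0}) \<inter> {z. sgn z \<in> B}" by (auto simp: V_def)
    with sB show ?thesis by auto
  qed
  have Ws: "W \<in> sets borel"
  proof -
    have "W = (ball 0 (1 + r) - {0}) \<inter> {z. sgn z \<in> B}" by (auto simp: W_def)
    with sB show ?thesis by auto
  qed
  have WV: "W = {z. z /\<^sub>R (1 + r) \<in> V}"
    using r by (auto simp: W_def V_def sgn_scaleR divide_simps)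
  have Vfin: "emeasure lborel V < \<infinity>"
  proof -
    have "emeasure lborel V \<le> emeasure lborel (ball 0 1 :: (real^'d) set)"
      by (rule emeasure_mono) (auto simp: V_def)
    also have "\<dots> < \<infinity>" by (simp add: emeasure_ball)
    finally show ?thesis .
  qed
  define v where "v = measure lborel V"
  have v: "emeasure lborel V = ennreal v"
    unfolding v_def using Vfin by (intro emeasure_eq_ennreal_measure) auto
  have v0: "v \<ge> 0" by (simp add: v_def)
  have W: "emeasure lborel W = ennreal ((1 + r) ^ ?d * v)"
    unfolding WV using emeasure_lborel_scaleR_vimage[OF Vs, of "1 + r"] r v v0
    by (simp add: ennreal_mult)
  have sub: "V \<subseteq> W" using r by (auto simp: V_def W_def)
  have "W - V \<subseteq> cball x (2 * r)"
  proof
    fix z assume "z \<in> W - V"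
    then have z: "norm z < 1 + r" "z \<noteq> 0" "sgn z \<in> B" "norm z \<ge> 1"
      by (auto simp: V_def W_def)
    have "z - sgn z = (1 - inverse (norm z)) *\<^sub>R z"
      by (simp add: sgn_div_norm algebra_simps)
    then have "norm (z - sgn z) = \<bar>1 - inverse (norm z)\<bar> * norm z"
      by simp
    also have "\<dots> = norm z - 1"
      using z by (simp add: divide_simps)
    finally have 1: "norm (z - sgn z) \<le> r" using z by simp
    have "norm (sgn z - x) \<le> r"
      using z by (auto simp: B_def dist_norm norm_minus_commute)
    with 1 have "norm (z - x) \<le> 2 * r"
      using norm_triangle_ineq[of "z - sgn z" "sgn z - x"] by simp
    then show "z \<in> cball x (2 * r)"
      by (simp add: dist_norm norm_minus_commute)
  qed
  then have "emeasure lborel (W - V) \<le> emeasure lborel (cball x (2 * r))"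
    by (rule emeasure_mono) auto
  also have "\<dots> = ennreal (unit_ball_vol (real ?d) * (2 * r) ^ ?d)"
    using r by (subst emeasure_cball) auto
  finally have "emeasure lborel (W - V) \<le> ennreal (unit_ball_vol (real ?d) * (2 * r) ^ ?d)" .
  moreover have "emeasure lborel (W - V) = ennreal ((1 + r) ^ ?d * v - v)"
    using sub Ws Vs Vfin by (subst emeasure_Diff) (auto simp: W v ennreal_minus v0)
  ultimately have "ennreal ((1 + r) ^ ?d * v - v) \<le> ennreal (unit_ball_vol (real ?d) * (2 * r) ^ ?d)"
    by metis
  then have le: "(1 + r) ^ ?d * v - v \<le> unit_ball_vol (real ?d) * (2 * r) ^ ?d"
    by (rule ennreal_le_iff[THEN iffD1, rotated]) (use r in auto)
  \<comment> \<open>The shell has volume ((1 + r)^d - 1) v, and Bernoulli's inequality makes the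
    factor at least r.\<close>
  have "1 + real ?d * r \<le> (1 + r) ^ ?d"
    using Bernoulli_inequality[of r ?d] r by simp
  moreover have "r \<le> real ?d * r"
    using r by simp
  ultimately have "1 + r \<le> (1 + r) ^ ?d" by linarith
  then have "r * v \<le> (1 + r) ^ ?d * v - v"
    using v0 mult_right_mono[of "1 + r" "(1 + r) ^ ?d" v] by (simp add: algebra_simps)
  with le have "r * v \<le> unit_ball_vol (real ?d) * (2 * r) ^ ?d" by simp
  also have "\<dots> = r * (unit_ball_vol (real ?d) * 2 ^ ?d * r ^ (?d - 1))"
    using power_minus_mult[of ?d r] by (simp add: power_mult_distrib mult_ac)
  finally have vle: "v \<le> unit_ball_vol (real ?d) * 2 ^ ?d * r ^ (?d - 1)"
    using r by simp
  have "emeasure sphere_measure B = of_nat ?d * ennreal v"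
    using emeasure_sphere_measure[of B] sphere_cap_sets[of x r] v by (simp add: B_def V_def)
  also have "\<dots> = ennreal (real ?d * v)"
    by (simp add: ennreal_of_nat_eq_real_of_nat ennreal_mult v0)
  also have "\<dots> \<le> ennreal (real ?d * (unit_ball_vol (real ?d) * 2 ^ ?d * r ^ (?d - 1)))"
    by (intro ennreal_leI mult_left_mono vle) auto
  finally show ?thesis
    unfolding B_def by (simp add: mult.assoc)
qed

lemma borel_measurable_sphere_measureI:
  "f \<in> borel_measurable borel \<Longrightarrow> f \<in> borel_measurable sphere_measure"
  by (subst measurable_cong_sets[OF sets_sphere_measure refl]) (rule measurable_restrict_space1)

text \<open>Summing the cap estimate over the dyadic annuli \<open>2^(k-1) A < A + |x - y| \<le> 2^k A\<close>.\<close>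

lemma nn_integral_sphere_decay_le:
  fixes x :: "real^'d"
  assumes A: "A > 0" and d: "CARD('d) = n + 1"
  shows "(\<integral>\<^sup>+y. ennreal (A / (A + norm (x - y)) ^ (n + 1)) \<partial>sphere_measure)
     \<le> ennreal (real (n + 1) * unit_ball_vol (real (n + 1)) * 2 ^ (n + 1) * 2 ^ (n + 1) * 2)"
proof -
  let ?c = "real (n + 1) * unit_ball_vol (real (n + 1)) * 2 ^ (n + 1)"
  \<comment> \<open>The constant is the largest value that the integrand can have where A + |x - y|
    is at least 2^(k-1) A. The indicator is that of a full ball, so that only caps have to be
    measured.\<close>
  define h where "h k y = ennreal (A / (2 ^ k * A / 2) ^ (n + 1)) * indicator (cball x (2 ^ k * A)) y"
    for k :: nat and y
  have pt: "ennreal (A / (A + norm (x - y)) ^ (n + 1)) \<le> (\<Sum>k. h k y)" for y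
  proof -
    define t where "t = A + norm (x - y)"
    have t: "t \<ge> A" "t > 0" using A by (auto simp: t_def add_pos_nonneg)
    obtain k0 :: nat where "t / A < 2 ^ k0"
      using real_arch_pow[of 2 "t / A"] by auto
    then have ex: "\<exists>k::nat. t \<le> 2 ^ k * A"
      using A by (auto simp: field_simps intro!: exI[of _ k0] less_imp_le)
    define k where "k = (LEAST k. t \<le> 2 ^ k * A)"
    have k1: "t \<le> 2 ^ k * A"
      unfolding k_def by (rule LeastI_ex[OF ex])
    have k2: "2 ^ k * A / 2 \<le> t"
    proof (cases k)
      case 0
      then show ?thesis using A t by simp
    next
      case (Suc l)
      then have "\<not> t \<le> 2 ^ l * A"
        using not_less_Least[of l "\<lambda>k. t \<le> 2 ^ k * A"] by (simp add: k_def)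
      then show ?thesis using Suc by simp
    qed
    have "A / t ^ (n + 1) \<le> A / (2 ^ k * A / 2) ^ (n + 1)"
      using A t k2 by (intro divide_left_mono power_mono mult_pos_pos zero_less_power) auto
    moreover have "y \<in> cball x (2 ^ k * A)"
      using k1 A by (simp add: t_def dist_norm)
    ultimately have "ennreal (A / t ^ (n + 1)) \<le> h k y"
      by (simp add: h_def ennreal_leI)
    also have "\<dots> = (\<Sum>i\<in>{k}. h i y)" by simp
    also have "\<dots> \<le> (\<Sum>i. h i y)" by (rule sum_le_suminf) auto
    finally show ?thesis by (simp add: t_def)
  qed
  have meas: "h k \<in> borel_measurable sphere_measure" for k
    unfolding h_def
    by (rule borel_measurable_sphere_measureI)
      (rule borel_measurable_times_ennreal[OF borel_measurable_const borel_measurable_indicator], simp)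
  have "(\<integral>\<^sup>+y. ennreal (A / (A + norm (x - y)) ^ (n + 1)) \<partial>sphere_measure)
      \<le> (\<integral>\<^sup>+y. (\<Sum>k. h k y) \<partial>sphere_measure)"
    by (intro nn_integral_mono pt)
  also have "\<dots> = (\<Sum>k. \<integral>\<^sup>+y. h k y \<partial>sphere_measure)"
    by (intro nn_integral_suminf meas)
  also have "\<dots> \<le> (\<Sum>k. ennreal (?c * 2 ^ (n + 1) * (1 / 2) ^ k))"
  proof (intro suminf_le summableI)
    fix k :: nat
    have "(\<integral>\<^sup>+y. h k y \<partial>sphere_measure)
        = (\<integral>\<^sup>+y. ennreal (A / (2 ^ k * A / 2) ^ (n + 1)) * indicator (usphere \<inter> cball x (2 ^ k * A)) y \<partial>sphere_measure)"
      by (rule nn_integral_cong) (auto simp: h_def indicator_def)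
    also have "\<dots> = ennreal (A / (2 ^ k * A / 2) ^ (n + 1)) * emeasure sphere_measure (usphere \<inter> cball x (2 ^ k * A))"
      using sphere_cap_sets by (subst nn_integral_cmult_indicator) auto
    also have "\<dots> \<le> ennreal (A / (2 ^ k * A / 2) ^ (n + 1)) * ennreal (?c * (2 ^ k * A) ^ n)"
      using emeasure_sphere_cap_le[of "2 ^ k * A" x] A d by (intro mult_left_mono) auto
    also have "\<dots> = ennreal (A / (2 ^ k * A / 2) ^ (n + 1) * (?c * (2 ^ k * A) ^ n))"
      using A by (intro ennreal_mult[symmetric]) auto
    \<comment> \<open>The cap contributes the power n of 2^k A against the power n + 1 in the
      denominator: A cancels, which makes the bound uniform in A, and 2^(-k) is left for the
      summation.\<close>
    also have "A / (2 ^ k * A / 2) ^ (n + 1) * (?c * (2 ^ k * A) ^ n) = ?c * 2 ^ (n + 1) * (1 / 2) ^ k"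
      using A by (simp add: power_divide divide_simps)
    finally show "(\<integral>\<^sup>+y. h k y \<partial>sphere_measure) \<le> ennreal (?c * 2 ^ (n + 1) * (1 / 2) ^ k)" .
  qed
  also have "\<dots> = ennreal (?c * 2 ^ (n + 1) * (1 / (1 - 1 / 2)))"
    by (intro suminf_ennreal_eq sums_mult geometric_sums) auto
  also have "1 / (1 - 1 / 2) = (2 :: real)" by simp
  finally show ?thesis .
qed

section \<open>Scales, great circles and kernel decay\<close>

lemma scale_sequence_pos: "scale_sequence \<delta> b \<Longrightarrow> b j > 0"
  by (simp add: scale_sequence_def)

lemma scale_sequence_geometric:
  assumes "scale_sequence \<delta> b"
  obtains r where "0 < r" "r < 1" "\<And>j k. b (j + k) \<le> r ^ k * b j"
proof -
  obtain d where d: "d > 1" "\<And>j. d \<le> b j / b (Suc j)" and pos: "\<And>j. b j > 0"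
    using assms by (auto simp: scale_sequence_def)
  have step: "b (Suc j) \<le> inverse d * b j" for j
    using d(1) d(2)[of j] pos[of "Suc j"] by (simp add: field_simps)
  have "b (j + k) \<le> inverse d ^ k * b j" for j k
  proof (induction k)
    case (Suc k)
    have "b (j + Suc k) \<le> inverse d * b (j + k)"
      using step[of "j + k"] by simp
    also have "\<dots> \<le> inverse d * (inverse d ^ k * b j)"
      using Suc d(1) by (intro mult_left_mono) auto
    finally show ?case by simp
  qed simp
  moreover have "0 < inverse d" "inverse d < 1"
    using d(1) by (auto simp: inverse_less_1_iff)
  ultimately show ?thesis using that by blast
qed

lemma scale_sequence_strict_antimono:
  assumes "scale_sequence \<delta> b" "i < j"
  shows "b j < b i"
proof -
  obtain r where r: "0 < r" "r < 1" "\<And>j k. b (j + k) \<le> r ^ k * b j"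
    using scale_sequence_geometric[OF assms(1)] by blast
  have "b j \<le> r ^ (j - i) * b i"
    using r(3)[of i "j - i"] assms(2) by simp
  also have "\<dots> < 1 * b i"
    using r assms by (intro mult_strict_right_mono power_less_one_iff[THEN iffD2])
      (auto simp: scale_sequence_pos power_less_one_iff)
  finally show ?thesis by simp
qed

lemma scale_sequence_inj: "scale_sequence \<delta> b \<Longrightarrow> inj b"
  by (metis injI linorder_neqE_nat order_less_irrefl scale_sequence_strict_antimono)

lemma scale_sequence_le_0: "scale_sequence \<delta> b \<Longrightarrow> b j \<le> b 0"
  by (cases "j = 0") (auto intro: less_imp_le scale_sequence_strict_antimono)

lemma scale_weight_eq:
  assumes "scale_sequence \<delta> b"
  shows "scale_weight b (b j) = ln (b j / b (Suc j))"
proof -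
  have "(THE i. b i = b j) = j"
    using scale_sequence_inj[OF assms] by (auto dest: injD)
  then show ?thesis by (simp add: scale_weight_def Let_def)
qed

lemma scale_weight_nonneg:
  assumes "scale_sequence \<delta> b"
  shows "0 \<le> scale_weight b (b j)"
  unfolding scale_weight_eq[OF assms]
  using scale_sequence_strict_antimono[OF assms, of j "Suc j"] scale_sequence_pos[OF assms, of "Suc j"]
  by (intro ln_ge_zero) (simp add: field_simps)

lemma scale_weight_le:
  assumes "scale_sequence \<delta> b"
  shows "scale_weight b (b j) \<le> ln \<delta>"
  unfolding scale_weight_eq[OF assms]
  using assms by (intro ln_mono) (auto simp: scale_sequence_def)

lemma scale_sequence_delta_gt_1:
  assumes "scale_sequence \<delta> b"
  shows "\<delta> > 1"
  using assms unfolding scale_sequence_def by (meson less_le_trans)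

text \<open>The scales decay geometrically, so one of the two ratios is at most r^|i - j|. Splitting
  the series at j = i leaves two geometric series whose bound does not depend on i.\<close>

lemma scale_sequence_ratio_sum_bounded:
  assumes "scale_sequence \<delta> b"
  obtains S where "S \<ge> 0" "\<And>i. (\<Sum>j. ennreal (min (b i / b j) (b j / b i))) \<le> ennreal S"
proof -
  obtain r where r: "0 < r" "r < 1" "\<And>j k. b (j + k) \<le> r ^ k * b j"
    using scale_sequence_geometric[OF assms] by blast
  have pos: "\<And>j. b j > 0" by (rule scale_sequence_pos[OF assms])
  let ?f = "\<lambda>i j. ennreal (min (b i / b j) (b j / b i))"
  have 1: "b (j + k) / b j \<le> r ^ k" for j k
    using r(3)[of j k] pos[of j] by (simp add: field_simps)
  have geo: "(\<Sum>k. ennreal (r ^ k)) = ennreal (1 / (1 - r))"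
    using r by (intro suminf_ennreal_eq geometric_sums) auto
  have "(\<Sum>j. ?f i j) \<le> ennreal (1 / (1 - r) + 1 / (1 - r))" for i
  proof -
    have "(\<Sum>j. ?f i j) = (\<Sum>k. ?f i (k + i)) + (\<Sum>j<i. ?f i j)"
      by (rule suminf_offset) auto
    also have "(\<Sum>k. ?f i (k + i)) \<le> (\<Sum>k. ennreal (r ^ k))"
    proof (intro suminf_le summableI ennreal_leI)
      fix k show "min (b i / b (k + i)) (b (k + i) / b i) \<le> r ^ k"
        using 1[of i k] by (simp add: add.commute min.coboundedI2)
    qed
    also have "(\<Sum>j<i. ?f i j) \<le> (\<Sum>j<i. ennreal (r ^ (i - j)))"
    proof (intro sum_mono ennreal_leI)
      fix j assume "j \<in> {..<i}"
      then show "min (b i / b j) (b j / b i) \<le> r ^ (i - j)"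
        using 1[of j "i - j"] by (simp add: min.coboundedI1)
    qed
    also have "(\<Sum>j<i. ennreal (r ^ (i - j))) = (\<Sum>j<i. ennreal (r ^ Suc j))"
      by (rule sum.reindex_bij_witness[of _ "\<lambda>j. i - Suc j" "\<lambda>j. i - Suc j"])
        (auto simp: Suc_diff_Suc simp flip: power_Suc)
    also have "\<dots> \<le> (\<Sum>j<i. ennreal (r ^ j))"
      using r by (intro sum_mono ennreal_leI power_decreasing) auto
    also have "\<dots> \<le> (\<Sum>k. ennreal (r ^ k))"
      by (rule sum_le_suminf) auto
    finally show ?thesis
      unfolding geo using r by (simp add: add_mono ennreal_plus[symmetric] del: ennreal_plus)
  qed
  moreover have "1 / (1 - r) + 1 / (1 - r) \<ge> 0" using r by simp
  ultimately show ?thesis using that by blast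
qed

section \<open>Chords, arcs and the mean value inequality on the sphere\<close>

lemma one_minus_cos_le: "2 - 2 * cos t \<le> t\<^sup>2" for t :: real
proof -
  have "2 - 2 * cos t = 4 * (sin (t / 2))\<^sup>2"
    using cos_double_sin[of "t / 2"] by simp
  also have "\<dots> \<le> 4 * (t / 2)\<^sup>2"
    using abs_sin_x_le_abs_x[of "t / 2"] by (intro mult_left_mono abs_le_square_iff[THEN iffD1]) auto
  finally show ?thesis by (simp add: power_divide)
qed

lemma inner_usphere_bounds:
  assumes "x \<in> usphere" "y \<in> usphere"
  shows "-1 \<le> x \<bullet> y" "x \<bullet> y \<le> 1"
  using Cauchy_Schwarz_ineq2[of x y] assms by auto

lemma cos_geo_dist: "x \<in> usphere \<Longrightarrow> y \<in> usphere \<Longrightarrow> cos (geo_dist x y) = x \<bullet> y"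
  by (simp add: geo_dist_def inner_usphere_bounds cos_arccos)

lemma geo_dist_nonneg: "x \<in> usphere \<Longrightarrow> y \<in> usphere \<Longrightarrow> 0 \<le> geo_dist x y"
  by (simp add: geo_dist_def inner_usphere_bounds arccos_lbound)

lemma norm_diff_le_geo_dist:
  assumes "x \<in> usphere" "y \<in> usphere"
  shows "norm (x - y) \<le> geo_dist x y"
proof -
  have "x \<bullet> x = 1" "y \<bullet> y = 1"
    using assms by (auto simp: dot_square_norm)
  then have "(norm (x - y))\<^sup>2 = 2 - 2 * cos (geo_dist x y)"
    unfolding cos_geo_dist[OF assms] by (simp add: power2_norm_eq_inner inner_diff inner_commute)
  then have "(norm (x - y))\<^sup>2 \<le> (geo_dist x y)\<^sup>2"
    using one_minus_cos_le by simp
  then show ?thesis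
    using geo_dist_nonneg[OF assms] by (simp add: power2_le_iff_abs_le)
qed

lemma norm_sum_of_real_mult_le:
  fixes v :: "real^'d" and g :: "complex^'d"
  shows "norm (\<Sum>i\<in>UNIV. of_real (v $ i) * g $ i) \<le> norm v * norm g"
proof -
  have "norm (\<Sum>i\<in>UNIV. of_real (v $ i) * g $ i) \<le> (\<Sum>i\<in>UNIV. \<bar>v $ i\<bar> * \<bar>norm (g $ i)\<bar>)"
    by (rule order_trans[OF norm_sum]) (simp add: norm_mult)
  also have "\<dots> \<le> L2_set (\<lambda>i. v $ i) UNIV * L2_set (\<lambda>i. norm (g $ i)) UNIV"
    by (rule L2_set_mult_ineq)
  finally show ?thesis by (simp add: norm_vec_def L2_set_def)
qed

text \<open>The path is the great circle arc \<open>cos t x + sin t e\<close>, which stays within \<open>geo_dist x y\<close> of \<open>x\<close>.\<close>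

lemma surface_gradient_mean_value:
  fixes F :: "real^'d \<Rightarrow> complex"
  assumes xy: "x \<in> usphere" "y \<in> usphere" "geo_dist x y < pi"
    and grad: "\<And>w. w \<in> usphere \<Longrightarrow> norm (w - x) \<le> geo_dist x y
                 \<Longrightarrow> \<exists>g. has_surface_gradient F g w \<and> norm g \<le> L"
  shows "cmod (F x - F y) \<le> L * geo_dist x y"
proof (cases "geo_dist x y = 0")
  case True
  then have "x = y" using norm_diff_le_geo_dist[OF xy(1,2)] by simp
  then show ?thesis using True by simp
next
  case False
  define \<theta> where "\<theta> = geo_dist x y"
  have \<theta>: "0 < \<theta>" "\<theta> < pi"
    using False geo_dist_nonneg[OF xy(1,2)] xy(3) by (auto simp: \<theta>_def)
  have s: "sin \<theta> > 0" using \<theta> by (simp add: sin_gt_zero)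
  have c: "x \<bullet> y = cos \<theta>" using cos_geo_dist[OF xy(1,2)] by (simp add: \<theta>_def)
  have xx: "x \<bullet> x = 1" "y \<bullet> y = 1" using xy by (auto simp: dot_square_norm)
  \<comment> \<open>The unit tangent vector at \<open>x\<close> pointing towards \<open>y\<close>.
    It is determined because 0 < \<theta> < pi excludes equal and antipodal points, so sin \<theta>
    does not vanish.\<close>
  define e where "e = (y - cos \<theta> *\<^sub>R x) /\<^sub>R sin \<theta>"
  have xe: "x \<bullet> e = 0"
    by (simp add: e_def inner_diff_right c xx)
  then have ex: "e \<bullet> x = 0"
    by (simp add: inner_commute)
  have "(y - cos \<theta> *\<^sub>R x) \<bullet> (y - cos \<theta> *\<^sub>R x) = 1 - (cos \<theta>)\<^sup>2"
    using c by (simp add: inner_diff inner_commute xx power2_eq_square algebra_simps)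
  also have "\<dots> = (sin \<theta>)\<^sup>2" by (simp add: sin_squared_eq)
  finally have ee: "e \<bullet> e = 1"
    using s by (simp add: e_def power2_eq_square divide_simps)
  define \<gamma> where "\<gamma> t = cos t *\<^sub>R x + sin t *\<^sub>R e" for t
  define \<gamma>' where "\<gamma>' t = (- sin t) *\<^sub>R x + cos t *\<^sub>R e" for t
  have n: "norm (u *\<^sub>R x + v *\<^sub>R e) = sqrt (u\<^sup>2 + v\<^sup>2)" for u v
    by (simp add: norm_eq_sqrt_inner inner_add xx ee xe ex power2_eq_square)
  have n\<gamma>: "\<gamma> t \<in> usphere" "norm (\<gamma>' t) = 1" for t
    by (simp_all only: \<gamma>_def \<gamma>'_def n mem_sphere_0) (simp_all add: add.commute)
  have near: "norm (\<gamma> t - x) \<le> \<theta>" if "t \<in> {0..\<theta>}" for t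
  proof -
    have "\<gamma> t - x = (cos t - 1) *\<^sub>R x + sin t *\<^sub>R e"
      by (simp add: \<gamma>_def algebra_simps)
    then have "norm (\<gamma> t - x) = sqrt ((cos t - 1)\<^sup>2 + (sin t)\<^sup>2)"
      by (simp only: n)
    also have "(cos t - 1)\<^sup>2 + (sin t)\<^sup>2 = 2 - 2 * cos t"
      using sin_cos_squared_add[of t] by (simp add: power2_diff)
    also have "sqrt (2 - 2 * cos t) \<le> sqrt (t\<^sup>2)"
      by (rule real_sqrt_le_mono[OF one_minus_cos_le])
    finally show ?thesis using that by simp
  qed
  have der: "\<exists>f'. ((\<lambda>t. F (\<gamma> t)) has_derivative f') (at t) \<and> onorm f' \<le> L" if t: "t \<in> {0..\<theta>}" for t
  proof -
    obtain g where g: "has_surface_gradient F g (\<gamma> t)" "norm g \<le> L"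
      using grad[OF n\<gamma>(1)[of t]] near[OF t] by (auto simp: \<theta>_def)
    have d\<gamma>: "(\<gamma> has_derivative (\<lambda>h. h *\<^sub>R \<gamma>' t)) (at t)"
      unfolding \<gamma>_def[abs_def] \<gamma>'_def
      by (auto intro!: derivative_eq_intros simp: algebra_simps)
    have "((\<lambda>z. F (sgn z)) has_derivative (\<lambda>v. \<Sum>i\<in>UNIV. of_real (v $ i) * g $ i)) (at (\<gamma> t))"
      using g(1) by (simp add: has_surface_gradient_def)
    from has_derivative_compose[OF d\<gamma> this]
    have "((\<lambda>t. F (sgn (\<gamma> t))) has_derivative (\<lambda>h. \<Sum>i\<in>UNIV. of_real ((h *\<^sub>R \<gamma>' t) $ i) * g $ i)) (at t)" .
    \<comment> \<open>On the arc \<open>sgn\<close> is the identity, so the radially constant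
      extension that defines the surface gradient can be replaced by \<open>F\<close>
      itself.\<close>
    moreover have "sgn (\<gamma> u) = \<gamma> u" for u
      using n\<gamma>(1)[of u] by (simp add: sgn_div_norm)
    ultimately have D: "((\<lambda>t. F (\<gamma> t)) has_derivative (\<lambda>h. \<Sum>i\<in>UNIV. of_real ((h *\<^sub>R \<gamma>' t) $ i) * g $ i)) (at t)"
      by simp
    have "onorm (\<lambda>h. \<Sum>i\<in>UNIV. of_real ((h *\<^sub>R \<gamma>' t) $ i) * g $ i) \<le> L"
    proof (rule onorm_bound)
      show "0 \<le> L" using g(2) norm_ge_zero order_trans by blast
      fix h :: real
      have "norm (\<Sum>i\<in>UNIV. of_real ((h *\<^sub>R \<gamma>' t) $ i) * g $ i) \<le> norm (h *\<^sub>R \<gamma>' t) * norm g"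
        by (rule norm_sum_of_real_mult_le)
      also have "\<dots> \<le> norm h * L"
        using g(2) n\<gamma>(2)[of t] by (simp add: mult_left_mono)
      finally show "norm (\<Sum>i\<in>UNIV. of_real ((h *\<^sub>R \<gamma>' t) $ i) * g $ i) \<le> L * norm h"
        by (simp add: mult.commute)
    qed
    with D show ?thesis by blast
  qed
  then obtain f' where f': "\<And>t. t \<in> {0..\<theta>} \<Longrightarrow> ((\<lambda>t. F (\<gamma> t)) has_derivative f' t) (at t) \<and> onorm (f' t) \<le> L"
    by metis
  have "norm (F (\<gamma> 0) - F (\<gamma> \<theta>)) \<le> L * norm (0 - \<theta>)"
    by (rule differentiable_bound[of "{0..\<theta>}" _ f'])
      (use \<theta> f' in \<open>auto intro: has_derivative_at_withinI\<close>)
  moreover have "\<gamma> 0 = x" "\<gamma> \<theta> = y"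
    using s by (auto simp: \<gamma>_def e_def)
  ultimately show ?thesis using \<theta> by (simp add: \<theta>_def)
qed

text \<open>The second factor is comparable to the Poisson kernel of a half space at height a + b:
  its integral over an n-dimensional sphere is bounded uniformly in a + b. The first factor decays
  exponentially in |log a - log b| and makes the sum over geometric scales converge.\<close>

definition decay_majorant :: "nat \<Rightarrow> real \<Rightarrow> real \<Rightarrow> real^'d \<Rightarrow> real^'d \<Rightarrow> real" where
  "decay_majorant n a b x y = min (a / b) (b / a) * ((a + b) / (a + b + norm (x - y)) ^ (n + 1))"

text \<open>The two regimes cover all pairs of points, and in each of them the base of the
  denominator is comparable to T = a + b + |x - y|. Of the exponent 3n + 2\<epsilon> of T, the part
  n + 1 is kept for the decay on the sphere. The rest is 2(n + \<epsilon>) - 1; with T \<ge> a + b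
  it turns (ab)^(n+\<epsilon>) into (a + b) times a power of ab / (a + b)^2, which bounds the ratio
  of the scales.\<close>

lemma kernel_bound_imp_decay_majorant:
  fixes x y :: "real^'d"
  assumes bd: "kernel_bound n \<dd> \<omega> \<epsilon> \<epsilon>t (a, x) (b, y) q"
    and pos: "a > 0" "b > 0" "\<dd> > 0" "\<omega> > 0" "\<epsilon> > 0" "\<epsilon>t > 0" "\<epsilon>t < 1 / 2" "n \<ge> 1"
    and xy: "x \<in> usphere" "y \<in> usphere"
  shows "q \<le> \<dd> * max (1 + 2 * \<omega>) (1 + 1 / \<omega>) powr (3 * n + 2 * \<epsilon>) * decay_majorant n a b x y"
proof -
  define p where "p = 3 * real n + 2 * \<epsilon>"
  define M where "M = max (1 + 2 * \<omega>) (1 + 1 / \<omega>)"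
  define A where "A = a + b"
  define T where "T = A + norm (x - y)"
  define \<theta> where "\<theta> = geo_dist x y"
  have M1: "M \<ge> 1 + 2 * \<omega>" "M \<ge> 1 + 1 / \<omega>" "M > 0"
    using pos by (auto simp: M_def)
  have A: "A > 0" and T: "T > 0" "T \<ge> A" using pos by (auto simp: A_def T_def add_pos_nonneg)
  have \<theta>: "norm (x - y) \<le> \<theta>" "\<theta> \<ge> 0"
    using norm_diff_le_geo_dist[OF xy] geo_dist_nonneg[OF xy] by (auto simp: \<theta>_def)
  have p: "p > 0" using pos by (simp add: p_def)
  have le: "q \<le> (a * b) powr (n + \<epsilon>) * (\<dd> * M powr p / T powr p)"
  proof -
    \<comment> \<open>\<open>s\<close> stands for the base of the denominator: a + b in the near
      regime, the angle in the far one. The two entries of \<open>M\<close> bound T / s in these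
      cases.\<close>
    have key: "q \<le> (a * b) powr (n + \<epsilon>) * (\<dd> * M powr p / T powr p)"
      if "q \<le> (a * b) powr (n + \<epsilon>) * (\<dd> / s powr p)" "s > 0" "T \<le> M * s" for s
    proof -
      have "T powr p \<le> M powr p * s powr p"
        using that T M1 p powr_mono2[of p T "M * s"] by (simp add: powr_mult)
      then have "\<dd> / s powr p \<le> \<dd> * M powr p / T powr p"
        using that(2) T(1) pos(3) by (simp add: field_simps mult_left_mono)
      with that(1) show ?thesis
        by (meson mult_left_mono order_trans powr_ge_zero)
    qed
    show ?thesis
    proof (cases "\<theta> \<le> \<omega> * (a + (2 - \<epsilon>t) * b)")
      case True
      have "T \<le> M * A"
      proof -
        have "(2 - \<epsilon>t) * b \<le> 2 * b" using pos by (intro mult_right_mono) auto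
        then have "a + (2 - \<epsilon>t) * b \<le> 2 * A"
          using pos(1) by (simp add: A_def algebra_simps)
        then have "\<omega> * (a + (2 - \<epsilon>t) * b) \<le> \<omega> * (2 * A)"
          using pos(4) by (intro mult_left_mono) auto
        then have "T \<le> (1 + 2 * \<omega>) * A"
          using True \<theta> by (simp add: T_def algebra_simps)
        also have "\<dots> \<le> M * A" using M1 A by (intro mult_right_mono) auto
        finally show ?thesis .
      qed
      then show ?thesis
        using bd True A by (intro key[of A]) (auto simp: kernel_bound_def \<theta>_def p_def A_def)
    next
      case False
      have "\<epsilon>t * b \<le> (2 - \<epsilon>t) * b" "b \<le> (2 - \<epsilon>t) * b"
        using pos by (auto intro!: mult_right_mono)
      then have "\<omega> * (a + \<epsilon>t * b) \<le> \<omega> * (a + (2 - \<epsilon>t) * b)" "\<omega> * A \<le> \<omega> * (a + (2 - \<epsilon>t) * b)"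
        using pos by (auto intro!: mult_left_mono simp: A_def)
      with False have 1: "\<theta> > \<omega> * (a + \<epsilon>t * b)" and 2: "\<omega> * A < \<theta>" by auto
      have \<theta>0: "\<theta> > 0" using 2 A pos by (meson less_trans mult_pos_pos)
      have "A \<le> 1 / \<omega> * \<theta>" using 2 pos by (simp add: field_simps)
      then have "T \<le> (1 + 1 / \<omega>) * \<theta>" using \<theta> by (simp add: T_def algebra_simps)
      also have "\<dots> \<le> M * \<theta>" using M1 \<theta> by (intro mult_right_mono) auto
      finally have "T \<le> M * \<theta>" .
      then show ?thesis
        using bd 1 \<theta>0 by (intro key[of \<theta>]) (auto simp: kernel_bound_def \<theta>_def p_def)
    qed
  qed
  have "(a * b) powr (n + \<epsilon>) / T powr p \<le> min (a / b) (b / a) * (A / T ^ (n + 1))"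
  proof -
    \<comment> \<open>The integer part n + 1 of the exponent stays with T; the remaining power of T
      is bounded below by that of A = a + b.\<close>
    have Tp: "T powr p = T ^ (n + 1) * T powr (p - (real n + 1))"
      using T(1) by (simp add: powr_realpow[symmetric] powr_add[symmetric] del: power_Suc)
    have "A powr (p - (real n + 1)) \<le> T powr (p - (real n + 1))"
      using T A pos by (intro powr_mono2) (auto simp: p_def)
    moreover have Ap: "A powr (p - (real n + 1)) = (A * A) powr (n + \<epsilon>) / A"
    proof -
      have "(A * A) powr (n + \<epsilon>) / A = A powr (n + \<epsilon>) * A powr (n + \<epsilon>) / A powr 1"
        using A by (simp add: powr_mult)
      also have "\<dots> = A powr ((n + \<epsilon>) + (n + \<epsilon>) - 1)"
        by (simp only: powr_add powr_diff)
      finally show ?thesis by (simp add: p_def add_diff_eq)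
    qed
    ultimately have Tge: "T powr p \<ge> T ^ (n + 1) * ((A * A) powr (n + \<epsilon>) / A)"
      unfolding Tp using T by (intro mult_left_mono) auto
    have "(a * b) powr (n + \<epsilon>) / T powr p \<le> (a * b) powr (n + \<epsilon>) / (T ^ (n + 1) * ((A * A) powr (n + \<epsilon>) / A))"
      using Tge T A by (intro divide_left_mono mult_pos_pos) auto
    also have "\<dots> = ((a * b) / (A * A)) powr (n + \<epsilon>) * (A / T ^ (n + 1))"
      using pos A by (simp add: powr_divide)
    also have "\<dots> \<le> min (a / b) (b / a) * (A / T ^ (n + 1))"
    proof (rule mult_right_mono)
      have "(a * b) / (A * A) \<le> (a * b) / c" if "0 < c" "c \<le> A * A" for c
        using that pos A by (intro divide_left_mono mult_pos_pos) auto
      moreover have "b * b \<le> A * A" "a * a \<le> A * A" "a * b \<le> A * A"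
        using pos by (auto simp: A_def intro!: mult_mono)
      ultimately have "(a * b) / (A * A) \<le> (a * b) / (b * b)" "(a * b) / (A * A) \<le> (a * b) / (a * a)"
          "(a * b) / (A * A) \<le> (a * b) / (a * b)"
        using pos by (blast intro: mult_pos_pos)+
      then have u: "(a * b) / (A * A) \<le> a / b" "(a * b) / (A * A) \<le> b / a" "(a * b) / (A * A) \<le> 1"
        using pos by auto
      \<comment> \<open>The exponent may be lowered to 1 because the base is at most 1 and n +
        \<epsilon> \<ge> 1.\<close>
      have "((a * b) / (A * A)) powr (n + \<epsilon>) \<le> ((a * b) / (A * A)) powr 1"
        using pos A u(3) by (intro powr_mono') auto
      also have "\<dots> = (a * b) / (A * A)" using pos A by simp
      finally show "((a * b) / (A * A)) powr (n + \<epsilon>) \<le> min (a / b) (b / a)" using u by simp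
    qed (use A T in auto)
    finally show ?thesis .
  qed
  then have "\<dd> * M powr p * ((a * b) powr (n + \<epsilon>) / T powr p)
      \<le> \<dd> * M powr p * (min (a / b) (b / a) * (A / T ^ (n + 1)))"
    using pos by (intro mult_left_mono) auto
  with le show ?thesis
    by (simp add: decay_majorant_def M_def p_def A_def T_def mult_ac)
qed

section \<open>The image of the wavelet transform is a linear space\<close>

lemma sigma_finite_sphere_measure: "sigma_finite_measure (sphere_measure :: (real^'d) measure)"
proof -
  interpret finite_measure "sphere_measure :: (real^'d) measure"
    by (rule finite_measure_sphere_measure)
  show ?thesis by unfold_locales
qed

lemma sigma_finite_dilation_measure: "sigma_finite_measure dilation_measure"
proof -
  interpret sigma_finite_measure "restrict_space lborel {0 :: real<..}"
    by (intro sigma_finite_measure_restrict_space sigma_finite_lborel) simp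
  have "(\<lambda>a :: real. ennreal (1 / a)) \<in> borel_measurable (restrict_space lborel {0<..})"
    by (intro measurable_restrict_space1) measurable
  from sigma_finite_iff_density_finite[OF this] show ?thesis
    unfolding dilation_measure_def by simp
qed

lemma space_phase_measure [simp]: "space phase_measure = {0<..} \<times> usphere"
  by (simp add: phase_measure_def space_pair_measure dilation_measure_def space_restrict_space)

text \<open>The profile is the restriction of the zonal function to half a great circle through the
  poles, and a second coordinate direction provides such a circle. Measurability of the profile is
  what makes \<psi>(x \<bullet> y) jointly measurable in x and y.\<close>

lemma zonal_profile_measurable:
  fixes \<psi> :: "real \<Rightarrow> complex"
  assumes d: "CARD('d::{finite,wellorder}) \<ge> 2"
    and z: "(zonal \<psi> :: real^'d::_ \<Rightarrow> complex) \<in> borel_measurable sphere_measure"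
  shows "(\<lambda>t. if \<bar>t\<bar> \<le> 1 then \<psi> t else 0) \<in> borel_measurable borel"
proof -
  let ?i = "LEAST i. True :: 'd"
  obtain j :: 'd where j: "j \<noteq> ?i"
    using d by (metis (full_types) One_nat_def UNIV_I card_1_singleton_iff card_le_Suc0_iff_eq finite_class.finite_UNIV not_less_eq_eq numeral_2_eq_2)
  \<comment> \<open>For |t| \<le> 1 this is the point at height t on the half circle from
    -\<open>pole\<close> to \<open>pole\<close> through the axis j. Outside this range it leaves the
    sphere, hence the case distinction below.\<close>
  define e where "e t = t *\<^sub>R (pole :: real^'d::_) + sqrt (1 - t\<^sup>2) *\<^sub>R axis j 1" for t
  have e: "e \<in> borel_measurable borel"
    unfolding e_def by measurable
  have p: "pole \<bullet> (pole :: real^'d::_) = 1" "pole \<bullet> (axis j 1 :: real^'d::_) = 0"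
      "(axis j 1 :: real^'d::_) \<bullet> pole = 0"
    using j by (auto simp: pole_def inner_axis_axis)
  have 1: "e t \<in> usphere" "pole \<bullet> e t = t" if "\<bar>t\<bar> \<le> 1" for t
  proof -
    have t: "t * t \<le> 1" using that by (simp add: abs_square_le_1 flip: power2_eq_square)
    have "e t \<bullet> e t = 1"
      using t by (simp add: e_def inner_add p inner_axis_axis power2_eq_square)
    then show "e t \<in> usphere" by (simp add: norm_eq_1)
    show "pole \<bullet> e t = t" by (simp add: e_def inner_add p)
  qed
  have "(\<lambda>x. indicator usphere x *\<^sub>R zonal \<psi> (x :: real^'d::_)) \<in> borel_measurable borel"
    using z borel_measurable_restrict_space_iff[of "usphere :: (real^'d::_) set" borel "zonal \<psi>"]
    by (simp add: borel_closed measurable_cong_sets[OF sets_sphere_measure refl])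
  from measurable_compose[OF e this]
  have "(\<lambda>t. indicator usphere (e t) *\<^sub>R zonal \<psi> (e t)) \<in> borel_measurable borel" .
  then have "(\<lambda>t. if \<bar>t\<bar> \<le> 1 then indicator usphere (e t) *\<^sub>R zonal \<psi> (e t) else 0) \<in> borel_measurable borel"
    by measurable
  also have "(\<lambda>t. if \<bar>t\<bar> \<le> 1 then indicator usphere (e t) *\<^sub>R zonal \<psi> (e t) else 0)
      = (\<lambda>t. if \<bar>t\<bar> \<le> 1 then \<psi> t else 0)"
    using 1 by (auto simp: zonal_def fun_eq_iff)
  finally show ?thesis .
qed

lemma L2_space_sphere_integrable:
  assumes "f \<in> L2_space (sphere_measure :: (real^'d) measure)"
  shows "integrable sphere_measure f"
proof -
  interpret finite_measure "sphere_measure :: (real^'d) measure"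
    by (rule finite_measure_sphere_measure)
  have m: "f \<in> borel_measurable sphere_measure" and i: "integrable sphere_measure (\<lambda>x. (cmod (f x))\<^sup>2)"
    using assms by (auto simp: L2_space_def)
  have "integrable sphere_measure (\<lambda>x. cmod (f x))"
    by (rule square_integrable_imp_integrable) (use m i in auto)
  then show ?thesis using m by (simp add: integrable_norm_iff)
qed

lemma nn_integral_sphere_orthogonal:
  fixes T :: "real^'d::{finite,wellorder} \<Rightarrow> real^'d::_"
  assumes T: "orthogonal_transformation T" and h: "h \<in> borel_measurable sphere_measure"
  shows "(\<integral>\<^sup>+x. h (T x) \<partial>sphere_measure) = (\<integral>\<^sup>+x. h x \<partial>sphere_measure)"
proof -
  have lin: "linear T" using T by (rule orthogonal_transformation_linear)
  have nT: "norm (T x) = norm x" for x using T by (simp add: orthogonal_transformation_norm)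
  have "T \<in> borel_measurable borel"
    using lin by (intro borel_measurable_continuous_onI linear_continuous_on) (simp add: linear_linear)
  then have "T \<in> measurable (restrict_space borel usphere) (restrict_space borel usphere)"
    by (intro measurable_restrict_space3) (auto simp: nT)
  then have m: "T \<in> measurable sphere_measure sphere_measure"
    by (subst measurable_cong_sets[OF sets_sphere_measure sets_sphere_measure])
  have "(\<integral>\<^sup>+x. h x \<partial>sphere_measure) = (\<integral>\<^sup>+x. h x \<partial>distr sphere_measure sphere_measure T)"
    by (simp add: distr_sphere_measure_rotation[OF T])
  also have "\<dots> = (\<integral>\<^sup>+x. h (T x) \<partial>sphere_measure)"
    by (rule nn_integral_distr[OF m]) (use h in simp)
  finally show ?thesis by simp
qed

text \<open>By Tonelli, since the \<open>L\<^sup>1\<close>-norm of \<open>\<psi> (\<sqdot> \<bullet> y)\<close> does not depend on \<open>y\<close>.\<close>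

lemma AE_integrable_zonal_mult:
  fixes \<psi> :: "real \<Rightarrow> complex" and f :: "real^'d::{finite,wellorder} \<Rightarrow> complex"
  assumes d: "CARD('d) \<ge> 2"
    and \<psi>: "integrable sphere_measure (zonal \<psi> :: real^'d::_ \<Rightarrow> complex)"
    and f: "integrable sphere_measure f"
  shows "AE x in sphere_measure. integrable sphere_measure (\<lambda>y. cnj (\<psi> (x \<bullet> y)) * f y)"
proof -
  let ?S = "sphere_measure :: (real^'d::_) measure"
  interpret pair_sigma_finite ?S ?S
    by (intro pair_sigma_finite.intro sigma_finite_sphere_measure)
  \<comment> \<open>Nothing is known about \<psi> outside [-1, 1]. The truncation is Borel
    measurable on the whole line and agrees with \<psi> at inner products of unit vectors.\<close>
  define \<phi> where "\<phi> t = (if \<bar>t\<bar> \<le> 1 then \<psi> t else 0)" for t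
  have \<phi>[measurable]: "\<phi> \<in> borel_measurable borel"
    unfolding \<phi>_def[abs_def] using zonal_profile_measurable[OF d] \<psi> by (simp add: borel_measurable_integrable)
  have \<phi>eq: "\<phi> (x \<bullet> y) = \<psi> (x \<bullet> y)" if "x \<in> usphere" "y \<in> usphere" for x y :: "real^'d::_"
    using that Cauchy_Schwarz_ineq2[of x y] by (simp add: \<phi>_def)
  have id: "(\<lambda>x. x) \<in> borel_measurable ?S"
    by (rule borel_measurable_sphere_measureI) simp
  have [measurable]: "f \<in> borel_measurable ?S" using f by auto
  have [measurable]: "fst \<in> borel_measurable (?S \<Otimes>\<^sub>M ?S)" "snd \<in> borel_measurable (?S \<Otimes>\<^sub>M ?S)"
    using measurable_compose[OF measurable_fst id] measurable_compose[OF measurable_snd id] by auto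
  define h where "h p = cnj (\<phi> (fst p \<bullet> snd p)) * f (snd p)" for p
  have [measurable]: "cnj \<in> borel_measurable borel"
    by (intro borel_measurable_continuous_onI continuous_intros)
  have [measurable]: "(\<lambda>p. f (snd p)) \<in> borel_measurable (?S \<Otimes>\<^sub>M ?S)"
    by (rule measurable_compose[OF measurable_snd]) measurable
  have h: "h \<in> borel_measurable (?S \<Otimes>\<^sub>M ?S)"
    unfolding h_def by measurable
  have const: "(\<integral>\<^sup>+x. ennreal (cmod (\<phi> (x \<bullet> y))) \<partial>?S) = (\<integral>\<^sup>+x. ennreal (cmod (\<phi> (x \<bullet> pole))) \<partial>?S)"
    if y: "y \<in> usphere" for y
  proof -
    have "norm y = norm (pole :: real^'d::_)" using y by (simp add: pole_def)
    then obtain T where T: "orthogonal_transformation T" "T y = (pole :: real^'d::_)"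
      by (rule orthogonal_transformation_exists) blast
    have "x \<bullet> y = T x \<bullet> pole" for x
      using T(1) unfolding orthogonal_transformation_def T(2)[symmetric] by simp
    moreover have "(\<lambda>x :: real^'d::_. ennreal (cmod (\<phi> (x \<bullet> pole)))) \<in> borel_measurable ?S"
      by (intro borel_measurable_sphere_measureI) measurable
    ultimately show ?thesis
      using nn_integral_sphere_orthogonal[OF T(1), of "\<lambda>x. ennreal (cmod (\<phi> (x \<bullet> pole)))"] by simp
  qed
  have fin: "(\<integral>\<^sup>+x. ennreal (cmod (\<phi> (x \<bullet> pole))) \<partial>?S) < \<infinity>"
  proof -
    have "(\<integral>\<^sup>+x. ennreal (cmod (\<phi> (x \<bullet> pole))) \<partial>?S) = (\<integral>\<^sup>+x. ennreal (cmod (zonal \<psi> x)) \<partial>?S)"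
    proof (rule nn_integral_cong)
      fix x :: "real^'d::_" assume "x \<in> space ?S"
      then have "\<phi> (x \<bullet> pole) = \<psi> (x \<bullet> pole)" by (intro \<phi>eq) (auto simp: pole_def)
      then show "ennreal (cmod (\<phi> (x \<bullet> pole))) = ennreal (cmod (zonal \<psi> x))"
        by (simp add: zonal_def inner_commute)
    qed
    also have "\<dots> < \<infinity>" using \<psi> by (simp add: integrable_iff_bounded)
    finally show ?thesis .
  qed
  have "(\<integral>\<^sup>+p. ennreal (cmod (h p)) \<partial>(?S \<Otimes>\<^sub>M ?S))
      = (\<integral>\<^sup>+y. (\<integral>\<^sup>+x. ennreal (cmod (h (x, y))) \<partial>?S) \<partial>?S)"
    using h by (intro nn_integral_snd[symmetric]) auto
  also have "\<dots> = (\<integral>\<^sup>+y. (\<integral>\<^sup>+x. ennreal (cmod (\<phi> (x \<bullet> pole))) \<partial>?S) * ennreal (cmod (f y)) \<partial>?S)"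
  proof (rule nn_integral_cong)
    fix y assume "y \<in> space ?S"
    then have y: "y \<in> usphere" by simp
    have "(\<lambda>x. \<phi> (x \<bullet> y)) \<in> borel_measurable ?S"
      by (intro borel_measurable_sphere_measureI) measurable
    then have "(\<integral>\<^sup>+x. ennreal (cmod (h (x, y))) \<partial>?S)
        = (\<integral>\<^sup>+x. ennreal (cmod (\<phi> (x \<bullet> y))) \<partial>?S) * ennreal (cmod (f y))"
      by (simp add: h_def norm_mult ennreal_mult nn_integral_multc)
    then show "(\<integral>\<^sup>+x. ennreal (cmod (h (x, y))) \<partial>?S)
        = (\<integral>\<^sup>+x. ennreal (cmod (\<phi> (x \<bullet> pole))) \<partial>?S) * ennreal (cmod (f y))"
      by (simp only: const[OF y])
  qed
  also have "\<dots> = (\<integral>\<^sup>+x. ennreal (cmod (\<phi> (x \<bullet> pole))) \<partial>?S) * (\<integral>\<^sup>+y. ennreal (cmod (f y)) \<partial>?S)"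
    by (rule nn_integral_cmult) measurable
  also have "\<dots> < \<infinity>"
    using fin f by (simp add: integrable_iff_bounded ennreal_mult_less_top)
  finally have "integrable (?S \<Otimes>\<^sub>M ?S) h"
    using h by (simp add: integrable_iff_bounded)
  from AE_integrable_fst'[OF this]
  have "AE x in ?S. integrable ?S (\<lambda>y. h (x, y))" .
  then show ?thesis
  proof (rule AE_mp, intro AE_I2 impI)
    fix x assume x: "x \<in> space ?S" and i: "integrable ?S (\<lambda>y. h (x, y))"
    have "integrable ?S (\<lambda>y. h (x, y)) \<longleftrightarrow> integrable ?S (\<lambda>y. cnj (\<psi> (x \<bullet> y)) * f y)"
      using x by (intro Bochner_Integration.integrable_cong) (auto simp: h_def \<phi>eq)
    with i show "integrable ?S (\<lambda>y. cnj (\<psi> (x \<bullet> y)) * f y)" by simp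
  qed
qed

section \<open>Square-integrable functions and linear combinations in the image\<close>

lemma L2_space_add:
  assumes "f \<in> L2_space M" "g \<in> L2_space M"
  shows "(\<lambda>x. f x + g x) \<in> L2_space M"
proof -
  have [measurable]: "f \<in> borel_measurable M" "g \<in> borel_measurable M"
    and i: "integrable M (\<lambda>x. (cmod (f x))\<^sup>2)" "integrable M (\<lambda>x. (cmod (g x))\<^sup>2)"
    using assms by (auto simp: L2_space_def)
  have "integrable M (\<lambda>x. (cmod (f x + g x))\<^sup>2)"
  proof (rule Bochner_Integration.integrable_bound)
    show "integrable M (\<lambda>x. 2 * (cmod (f x))\<^sup>2 + 2 * (cmod (g x))\<^sup>2)"
      using i by auto
    show "AE x in M. norm ((cmod (f x + g x))\<^sup>2) \<le> norm (2 * (cmod (f x))\<^sup>2 + 2 * (cmod (g x))\<^sup>2)"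
    proof (intro AE_I2)
      fix x
      have "(cmod (f x + g x))\<^sup>2 \<le> (cmod (f x) + cmod (g x))\<^sup>2"
        by (intro power_mono norm_triangle_ineq) auto
      also have "\<dots> \<le> 2 * (cmod (f x))\<^sup>2 + 2 * (cmod (g x))\<^sup>2"
        using sum_squares_bound[of "cmod (f x)" "cmod (g x)"] by (simp add: power2_sum)
      finally show "norm ((cmod (f x + g x))\<^sup>2) \<le> norm (2 * (cmod (f x))\<^sup>2 + 2 * (cmod (g x))\<^sup>2)"
        by simp
    qed
  qed measurable
  then show ?thesis by (simp add: L2_space_def)
qed

lemma L2_space_cmult:
  "f \<in> L2_space M \<Longrightarrow> (\<lambda>x. c * f x) \<in> L2_space M"
  by (auto simp: L2_space_def norm_mult power_mult_distrib)

lemma L2_space_mult_integrable: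
  assumes "f \<in> L2_space M" "g \<in> L2_space M"
  shows "integrable M (\<lambda>x. f x * g x)"
proof (rule Bochner_Integration.integrable_bound)
  show "integrable M (\<lambda>x. (cmod (f x))\<^sup>2 + (cmod (g x))\<^sup>2)"
    using assms by (auto simp: L2_space_def)
  show "(\<lambda>x. f x * g x) \<in> borel_measurable M"
    using assms by (auto simp: L2_space_def)
  show "AE x in M. norm (f x * g x) \<le> norm ((cmod (f x))\<^sup>2 + (cmod (g x))\<^sup>2)"
  proof (intro AE_I2)
    fix x
    have "2 * (cmod (f x) * cmod (g x)) \<le> (cmod (f x))\<^sup>2 + (cmod (g x))\<^sup>2"
      using sum_squares_bound[of "cmod (f x)" "cmod (g x)"] by simp
    moreover have "0 \<le> cmod (f x) * cmod (g x)" by simp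
    ultimately have "cmod (f x) * cmod (g x) \<le> (cmod (f x))\<^sup>2 + (cmod (g x))\<^sup>2" by linarith
    then show "norm (f x * g x) \<le> norm ((cmod (f x))\<^sup>2 + (cmod (g x))\<^sup>2)"
      by (simp add: norm_mult)
  qed
qed

locale wavelet_rkhs =
  fixes \<Psi> :: "real \<Rightarrow> real \<Rightarrow> complex"
    and U :: "(real \<times> (real^'d::{finite,wellorder}) \<Rightarrow> complex) set"
    and K :: "real \<times> (real^'d::_) \<Rightarrow> real \<times> (real^'d::_) \<Rightarrow> complex"
  assumes card_ge_2: "CARD('d) \<ge> 2"
    and wavelet: "spherical_wavelet TYPE('d) \<Psi>"
    and U_eq: "U = wavelet_image \<Psi>"
    and U_L2: "U \<subseteq> L2_space phase_measure"
    and rk: "reproducing_kernel U K"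
begin

lemma wavelet_integrable:
  "a > 0 \<Longrightarrow> integrable sphere_measure (zonal (\<Psi> a) :: real^'d::_ \<Rightarrow> complex)"
  using wavelet by (simp add: spherical_wavelet_def Let_def)

lemma K_L2: "z \<in> {0<..} \<times> usphere \<Longrightarrow> K z \<in> L2_space phase_measure"
  and cnj_K_in_U: "z \<in> {0<..} \<times> usphere \<Longrightarrow> (\<lambda>w. cnj (K z w)) \<in> U"
  and reproducing: "z \<in> {0<..} \<times> usphere \<Longrightarrow> s \<in> U \<Longrightarrow> kernel_int K s z = s z"
  using rk by (auto simp: reproducing_kernel_def)

text \<open>A wavelet transform is defined pointwise by integrals that need not converge everywhere, so it
  is additive only almost everywhere; the reproducing formula turns this into an identity.\<close>

lemma wavelet_transform_add:
  assumes fg: "f \<in> L2_space sphere_measure" "g \<in> L2_space sphere_measure" and z: "z \<in> {0<..} \<times> usphere"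
  shows "wavelet_transform \<Psi> (\<lambda>x. f x + g x) z = wavelet_transform \<Psi> f z + wavelet_transform \<Psi> (g :: real^'d::_ \<Rightarrow> complex) z"
proof -
  let ?W = "wavelet_transform \<Psi> :: (real^'d::_ \<Rightarrow> complex) \<Rightarrow> _"
  let ?h = "\<lambda>x. f x + g x"
  interpret pair_sigma_finite dilation_measure "sphere_measure :: (real^'d::_) measure"
    by (intro pair_sigma_finite.intro sigma_finite_sphere_measure sigma_finite_dilation_measure)
  have inU: "?W u \<in> U" if "u \<in> L2_space sphere_measure" for u
    using that unfolding U_eq wavelet_image_def by blast
  have h: "?h \<in> L2_space sphere_measure" using fg by (rule L2_space_add)
  have L2: "?W u \<in> L2_space phase_measure" if "u \<in> L2_space sphere_measure" for u
    using inU[OF that] U_L2 by blast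
  have m: "?W u \<in> borel_measurable phase_measure" if "u \<in> L2_space sphere_measure" for u
    using L2[OF that] by (simp add: L2_space_def)
  \<comment> \<open>Transforms lie in \<open>U\<close> and are therefore measurable on the product
    space; so the exceptional set is measurable, and it suffices to find it null at every single
    scale.\<close>
  have "AE w in dilation_measure \<Otimes>\<^sub>M sphere_measure. ?W ?h w = ?W f w + ?W g w"
  proof (rule AE_pair_measure)
    have "{w \<in> space phase_measure. ?W ?h w = ?W f w + ?W g w} \<in> sets phase_measure"
      using m[OF h] m[OF fg(1)] m[OF fg(2)] by measurable
    then show "{w \<in> space (dilation_measure \<Otimes>\<^sub>M sphere_measure). ?W ?h w = ?W f w + ?W g w}
        \<in> sets (dilation_measure \<Otimes>\<^sub>M sphere_measure)"
      unfolding phase_measure_def .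
    show "AE a in dilation_measure. AE x in sphere_measure. ?W ?h (a, x) = ?W f (a, x) + ?W g (a, x)"
    proof (rule AE_I2)
      fix a assume "a \<in> space dilation_measure"
      then have a: "a > 0" by (simp add: dilation_measure_def space_restrict_space)
      show "AE x in sphere_measure. ?W ?h (a, x) = ?W f (a, x) + ?W g (a, x)"
        using AE_integrable_zonal_mult[OF card_ge_2 wavelet_integrable[OF a] L2_space_sphere_integrable[OF fg(1)]]
          AE_integrable_zonal_mult[OF card_ge_2 wavelet_integrable[OF a] L2_space_sphere_integrable[OF fg(2)]]
        by eventually_elim
          (simp add: wavelet_transform_def sph_inner_def distrib_left add_divide_distrib)
    qed
  qed
  then have ae: "AE w in phase_measure. ?W ?h w = ?W f w + ?W g w"
    unfolding phase_measure_def .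
  have "?W ?h z = kernel_int K (?W ?h) z"
    by (rule reproducing[OF z inU[OF h], symmetric])
  also have "\<dots> = (LINT w|phase_measure. K z w * ?W f w + K z w * ?W g w)"
    unfolding kernel_int_def
  proof (rule integral_cong_AE)
    show "AE w in phase_measure. K z w * ?W ?h w = K z w * ?W f w + K z w * ?W g w"
      using ae by eventually_elim (simp add: distrib_left)
  qed (use K_L2[OF z] m[OF h] m[OF fg(1)] m[OF fg(2)] in \<open>auto simp: L2_space_def\<close>)
  also have "\<dots> = kernel_int K (?W f) z + kernel_int K (?W g) z"
    unfolding kernel_int_def
    by (intro Bochner_Integration.integral_add L2_space_mult_integrable K_L2[OF z] L2 fg)
  finally show ?thesis
    by (simp only: reproducing[OF z inU[OF fg(1)]] reproducing[OF z inU[OF fg(2)]])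
qed

lemma U_add: "s \<in> U \<Longrightarrow> t \<in> U \<Longrightarrow> (\<lambda>z. s z + t z) \<in> U"
proof -
  assume "s \<in> U" "t \<in> U"
  then obtain f g where fg: "f \<in> L2_space sphere_measure" "g \<in> L2_space sphere_measure"
      "\<And>z. z \<in> {0<..} \<times> usphere \<Longrightarrow> s z = wavelet_transform \<Psi> f z"
      "\<And>z. z \<in> {0<..} \<times> usphere \<Longrightarrow> t z = wavelet_transform \<Psi> g z"
    unfolding U_eq wavelet_image_def by blast
  have "\<forall>z\<in>{0<..} \<times> usphere. s z + t z = wavelet_transform \<Psi> (\<lambda>x. f x + g x) z"
    by (intro ballI) (simp only: fg(3,4) wavelet_transform_add[OF fg(1,2)])
  then show ?thesis
    using L2_space_add[OF fg(1,2)] unfolding U_eq wavelet_image_def by blast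
qed

text \<open>Unlike additivity, this holds pointwise without the reproducing formula: where the
  defining integral diverges, both sides are 0 by convention.\<close>

lemma U_cmult: "s \<in> U \<Longrightarrow> (\<lambda>z. c * s z) \<in> U"
proof -
  assume "s \<in> U"
  then obtain f where f: "f \<in> L2_space sphere_measure"
      "\<And>z. z \<in> {0<..} \<times> usphere \<Longrightarrow> s z = wavelet_transform \<Psi> f z"
    unfolding U_eq wavelet_image_def by blast
  have "wavelet_transform \<Psi> (\<lambda>x. c * f x) z = c * wavelet_transform \<Psi> f z" for z
    by (simp add: wavelet_transform_def sph_inner_def mult.left_commute[of _ c] split: prod.split)
  then have "\<forall>z\<in>{0<..} \<times> usphere. c * s z = wavelet_transform \<Psi> (\<lambda>x. c * f x) z"
    using f by simp
  then show ?thesis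
    using L2_space_cmult[OF f(1)] unfolding U_eq wavelet_image_def by blast
qed

lemma U_sum:
  assumes "finite F" "\<And>m. m \<in> F \<Longrightarrow> s m \<in> U"
  shows "(\<lambda>z. \<Sum>m\<in>F. s m z) \<in> U"
  using assms
proof (induction F rule: finite_induct)
  case empty
  \<comment> \<open>The empty sum is obtained as 0 times a conjugated kernel at an arbitrarily
    chosen point.\<close>
  have "(\<lambda>w. 0 * cnj (K (1, pole) w)) \<in> U"
    by (intro U_cmult cnj_K_in_U) (simp add: pole_def)
  then show ?case by simp
next
  case (insert m F)
  then have "(\<lambda>z. s m z + (\<Sum>m\<in>F. s m z)) \<in> U" by (intro U_add) auto
  then show ?case using insert by simp
qed

end

section \<open>Duality and Schur's test\<close>

lemma phase_section_measurable:
  assumes "f \<in> measurable phase_measure N" "a > 0"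
  shows "(\<lambda>x. f (a, x)) \<in> measurable sphere_measure N"
proof (rule measurable_compose[OF measurable_Pair1'])
  show "a \<in> space dilation_measure"
    using assms(2) by (simp add: dilation_measure_def space_restrict_space)
  show "f \<in> measurable (dilation_measure \<Otimes>\<^sub>M sphere_measure) N"
    using assms(1) unfolding phase_measure_def .
qed

lemma phase_norm_sq_nonneg: "0 \<le> phase_norm_sq s"
  by (simp add: phase_norm_sq_def)

text \<open>Cauchy-Schwarz with respect to the weights w d. This is the pointwise half of Schur's
  test: the first factor is a pure kernel sum, the second one contains the coefficients
  \<open>a\<close>.\<close>

lemma sum_mult_square_le:
  fixes w a d :: "'i \<Rightarrow> real"
  assumes "\<And>m. m \<in> F \<Longrightarrow> w m \<ge> 0" "\<And>m. m \<in> F \<Longrightarrow> d m \<ge> 0"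
  shows "(\<Sum>m\<in>F. w m * a m * d m)\<^sup>2 \<le> (\<Sum>m\<in>F. w m * d m) * (\<Sum>m\<in>F. w m * (a m)\<^sup>2 * d m)"
proof -
  have nn: "w m * d m \<ge> 0" if "m \<in> F" for m using assms that by simp
  have "(\<Sum>m\<in>F. w m * a m * d m) = (\<Sum>m\<in>F. sqrt (w m * d m) * (sqrt (w m * d m) * a m))"
  proof (rule sum.cong[OF refl])
    fix m assume "m \<in> F"
    then have "sqrt (w m * d m) * sqrt (w m * d m) = w m * d m" using nn by simp
    then show "w m * a m * d m = sqrt (w m * d m) * (sqrt (w m * d m) * a m)"
      by (metis mult.assoc mult.commute)
  qed
  also have "(\<dots>)\<^sup>2 \<le> (\<Sum>m\<in>F. (sqrt (w m * d m))\<^sup>2) * (\<Sum>m\<in>F. (sqrt (w m * d m) * a m)\<^sup>2)"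
    by (rule Cauchy_Schwarz_ineq_sum)
  also have "(\<Sum>m\<in>F. (sqrt (w m * d m))\<^sup>2) = (\<Sum>m\<in>F. w m * d m)"
    by (rule sum.cong) (use nn in auto)
  also have "(\<Sum>m\<in>F. (sqrt (w m * d m) * a m)\<^sup>2) = (\<Sum>m\<in>F. w m * (a m)\<^sup>2 * d m)"
    by (rule sum.cong) (use nn in \<open>auto simp: power_mult_distrib mult_ac\<close>)
  finally show ?thesis .
qed

text \<open>The frame inequalities are put in terms of the point values of \<open>s\<close>, which
  equal the kernel integrals by the reproducing formula. The case C \<le> 0 is degenerate and is
  treated apart.\<close>

locale semicontinuous_frame = wavelet_rkhs \<Psi> U K
  for \<Psi> :: "real \<Rightarrow> real \<Rightarrow> complex"
    and U :: "(real \<times> (real^'d::{finite,wellorder}) \<Rightarrow> complex) set"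
    and K :: "real \<times> (real^'d::_) \<Rightarrow> real \<times> (real^'d::_) \<Rightarrow> complex" +
  fixes b :: "nat \<Rightarrow> real" and \<delta> C \<Delta> :: real
  assumes scales: "scale_sequence \<delta> b"
    and C_pos: "C > 0"
    and \<Delta>: "0 \<le> \<Delta>" "\<Delta> < 1"
    and frame_lower: "s \<in> U \<Longrightarrow> ennreal ((1 - \<Delta>) * phase_norm_sq s)
          \<le> (\<Sum>j. ennreal (C * scale_weight b (b j)) * (\<integral>\<^sup>+x. ennreal ((cmod (s (b j, x)))\<^sup>2) \<partial>sphere_measure))"
    and frame_upper: "s \<in> U \<Longrightarrow>
          (\<Sum>j. ennreal (C * scale_weight b (b j)) * (\<integral>\<^sup>+x. ennreal ((cmod (s (b j, x)))\<^sup>2) \<partial>sphere_measure))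
          \<le> ennreal ((1 + \<Delta>) * phase_norm_sq s)"
begin

text \<open>Unlike in the paper, \<open>\<nu>\<close> includes the constant \<open>C\<close>.\<close>

abbreviation \<nu> :: "nat \<Rightarrow> real" where "\<nu> j \<equiv> C * scale_weight b (b j)"

lemma \<nu>_nonneg: "0 \<le> \<nu> j"
  using C_pos scale_weight_nonneg[OF scales, of j] by simp

lemma b_pos: "b j > 0"
  by (rule scale_sequence_pos[OF scales])

text \<open>Duality and Schur's test for finitely many pairs of points. The left side q is the
  pairing of \<open>s\<close> with a combination \<open>h\<close> of conjugated kernel differences
  whose coefficients are the weighted differences of \<open>s\<close> themselves. At the scales b_l,
  \<open>R2\<close> bounds the sums over the pairs, and \<open>R1\<close> the integrals over the
  sphere summed over l; together they bound the frame sum of \<open>h\<close> by \<kappa>^2 q. Hence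
  |h| is at most a constant times sqrt q, and one factor sqrt q cancels in q \<le> |h| |s|.\<close>

lemma finite_difference_bound:
  fixes w :: "'i \<Rightarrow> real"
  assumes F: "finite F"
    and w: "\<And>m. m \<in> F \<Longrightarrow> w m \<ge> 0"
    and z: "\<And>m. m \<in> F \<Longrightarrow> z m \<in> {0<..} \<times> usphere" "\<And>m. m \<in> F \<Longrightarrow> z' m \<in> {0<..} \<times> usphere"
    and \<kappa>: "\<kappa> > 0"
    and R1: "\<And>m. m \<in> F \<Longrightarrow>
        (\<Sum>l. ennreal (\<nu> l) * (\<integral>\<^sup>+y. ennreal (cmod (K (z m) (b l, y) - K (z' m) (b l, y))) \<partial>sphere_measure)) \<le> ennreal \<kappa>"
    and R2: "\<And>l y. y \<in> usphere \<Longrightarrow> (\<Sum>m\<in>F. w m * cmod (K (z m) (b l, y) - K (z' m) (b l, y))) \<le> \<kappa>"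
    and s: "s \<in> U"
  shows "(\<Sum>m\<in>F. w m * (cmod (s (z m) - s (z' m)))\<^sup>2) \<le> \<kappa>\<^sup>2 / (1 - \<Delta>) * phase_norm_sq s"
proof -
  define g where "g m = s (z m) - s (z' m)" for m
  define D where "D m p = K (z m) p - K (z' m) p" for m p
  define q where "q = (\<Sum>m\<in>F. w m * (cmod (g m))\<^sup>2)"
  \<comment> \<open>The conjugate is essential: the members of \<open>U\<close> are the functions
    cnj (K z), not K z.\<close>
  define h where "h p = (\<Sum>m\<in>F. (of_real (w m) * g m) * cnj (D m p))" for p
  have q0: "q \<ge> 0" unfolding q_def using w by (intro sum_nonneg) auto
  have hU: "h \<in> U"
  proof -
    have "(\<lambda>p. \<Sum>m\<in>F. (of_real (w m) * g m) * (cnj (K (z m) p) + (-1) * cnj (K (z' m) p))) \<in> U"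
      by (intro U_sum F U_cmult U_add cnj_K_in_U z)
    then show ?thesis by (simp add: h_def[abs_def] D_def)
  qed
  have hL2: "h \<in> L2_space phase_measure" and sL2: "s \<in> L2_space phase_measure"
    using hU s U_L2 by auto
  have Dm: "D m \<in> borel_measurable phase_measure" if "m \<in> F" for m
    unfolding D_def[abs_def] using K_L2[OF z(1)[OF that]] K_L2[OF z(2)[OF that]]
    by (auto simp: L2_space_def)
  have intK: "integrable phase_measure (\<lambda>p. K u p * s p)" if "u \<in> {0<..} \<times> usphere" for u
    by (intro L2_space_mult_integrable K_L2 that sL2)
  have intD: "integrable phase_measure (\<lambda>p. D m p * s p)" if "m \<in> F" for m
    using intK[OF z(1)[OF that]] intK[OF z(2)[OF that]] by (simp add: D_def left_diff_distrib)
  have Ds: "(LINT p|phase_measure. D m p * s p) = g m" if "m \<in> F" for m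
  proof -
    have "(LINT p|phase_measure. D m p * s p) = kernel_int K s (z m) - kernel_int K s (z' m)"
      using intK[OF z(1)[OF that]] intK[OF z(2)[OF that]]
      by (simp add: D_def left_diff_distrib kernel_int_def)
    then show ?thesis using z[OF that] s by (simp add: g_def reproducing)
  qed
  have pair: "(LINT p|phase_measure. cnj (h p) * s p) = of_real q"
  proof -
    have "(LINT p|phase_measure. cnj (h p) * s p)
        = (LINT p|phase_measure. (\<Sum>m\<in>F. (of_real (w m) * cnj (g m)) * (D m p * s p)))"
      by (simp add: h_def sum_distrib_right sum_distrib_left mult_ac)
    also have "\<dots> = (\<Sum>m\<in>F. (LINT p|phase_measure. (of_real (w m) * cnj (g m)) * (D m p * s p)))"
      by (rule Bochner_Integration.integral_sum) (use intD in auto)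
    also have "\<dots> = (\<Sum>m\<in>F. (of_real (w m) * cnj (g m)) * g m)"
      by (rule sum.cong) (auto simp: Ds)
    also have "\<dots> = of_real q"
      unfolding q_def of_real_sum
    proof (rule sum.cong[OF refl])
      fix m
      have "cnj (g m) * g m = of_real ((cmod (g m))\<^sup>2)"
        by (simp only: complex_norm_square mult.commute)
      then show "of_real (w m) * cnj (g m) * g m = (of_real (w m * (cmod (g m))\<^sup>2) :: complex)"
        by (simp only: of_real_mult mult.assoc)
    qed
    finally show ?thesis .
  qed
  \<comment> \<open>Cauchy-Schwarz with a free parameter, which avoids square roots. At t = 1/\<tau>
    the term with \<open>h\<close> becomes at most q / 2 and is absorbed on the left.\<close>
  have young: "q \<le> t / 2 * phase_norm_sq h + 1 / (2 * t) * phase_norm_sq s" if t: "t > 0" for t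
  proof -
    have i: "integrable phase_measure (\<lambda>p. (cmod (h p))\<^sup>2)" "integrable phase_measure (\<lambda>p. (cmod (s p))\<^sup>2)"
      using hL2 sL2 by (auto simp: L2_space_def)
    have "q = cmod (LINT p|phase_measure. cnj (h p) * s p)"
      using q0 by (simp add: pair)
    also have "\<dots> \<le> (LINT p|phase_measure. cmod (cnj (h p) * s p))"
      by (rule integral_norm_bound)
    also have "\<dots> \<le> (LINT p|phase_measure. t / 2 * (cmod (h p))\<^sup>2 + 1 / (2 * t) * (cmod (s p))\<^sup>2)"
    proof (rule integral_mono')
      show "integrable phase_measure (\<lambda>p. t / 2 * (cmod (h p))\<^sup>2 + 1 / (2 * t) * (cmod (s p))\<^sup>2)"
        using i by auto
      fix p
      have "0 \<le> (t * cmod (h p) - cmod (s p))\<^sup>2" by simp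
      then have "2 * t * (cmod (h p) * cmod (s p)) \<le> t * t * (cmod (h p))\<^sup>2 + (cmod (s p))\<^sup>2"
        by (simp add: power2_eq_square algebra_simps)
      then have "cmod (h p) * cmod (s p) \<le> t / 2 * (cmod (h p))\<^sup>2 + 1 / (2 * t) * (cmod (s p))\<^sup>2"
        using t by (simp add: field_simps)
      then show "cmod (cnj (h p) * s p) \<le> t / 2 * (cmod (h p))\<^sup>2 + 1 / (2 * t) * (cmod (s p))\<^sup>2"
        by (simp add: norm_mult)
      show "0 \<le> t / 2 * (cmod (h p))\<^sup>2 + 1 / (2 * t) * (cmod (s p))\<^sup>2" using t by simp
    qed
    also have "\<dots> = t / 2 * phase_norm_sq h + 1 / (2 * t) * phase_norm_sq s"
      using i by (simp add: phase_norm_sq_def)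
    finally show ?thesis .
  qed
  have "ennreal ((1 - \<Delta>) * phase_norm_sq h)
      \<le> (\<Sum>l. ennreal (\<nu> l) * (\<integral>\<^sup>+y. ennreal ((cmod (h (b l, y)))\<^sup>2) \<partial>sphere_measure))"
    by (rule frame_lower[OF hU])
  also have "\<dots> \<le> (\<Sum>l. \<Sum>m\<in>F. ennreal (\<kappa> * (w m * (cmod (g m))\<^sup>2)) *
        (ennreal (\<nu> l) * (\<integral>\<^sup>+y. ennreal (cmod (D m (b l, y))) \<partial>sphere_measure)))"
  proof (intro suminf_le summableI)
    fix l
    have sec: "(\<lambda>y. D m (b l, y)) \<in> borel_measurable sphere_measure" if "m \<in> F" for m
      by (rule phase_section_measurable[OF Dm[OF that] b_pos])
    have "(\<integral>\<^sup>+y. ennreal ((cmod (h (b l, y)))\<^sup>2) \<partial>sphere_measure)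
        \<le> (\<integral>\<^sup>+y. (\<Sum>m\<in>F. ennreal (\<kappa> * (w m * (cmod (g m))\<^sup>2)) * ennreal (cmod (D m (b l, y)))) \<partial>sphere_measure)"
    proof (rule nn_integral_mono)
      fix y :: "real^'d::_" assume "y \<in> space sphere_measure"
      then have y: "y \<in> usphere" by simp
      let ?p = "(b l, y)"
      have "cmod (h ?p) \<le> (\<Sum>m\<in>F. w m * cmod (g m) * cmod (D m ?p))"
        unfolding h_def by (rule order_trans[OF norm_sum]) (use w in \<open>simp add: norm_mult\<close>)
      then have "(cmod (h ?p))\<^sup>2 \<le> (\<Sum>m\<in>F. w m * cmod (g m) * cmod (D m ?p))\<^sup>2"
        by (intro power_mono) auto
      also have "\<dots> \<le> (\<Sum>m\<in>F. w m * cmod (D m ?p)) * (\<Sum>m\<in>F. w m * (cmod (g m))\<^sup>2 * cmod (D m ?p))"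
        by (rule sum_mult_square_le) (use w in auto)
      also have "\<dots> \<le> \<kappa> * (\<Sum>m\<in>F. w m * (cmod (g m))\<^sup>2 * cmod (D m ?p))"
        using R2[OF y, of l] w by (intro mult_right_mono sum_nonneg) (auto simp: D_def)
      also have "\<dots> = (\<Sum>m\<in>F. \<kappa> * (w m * (cmod (g m))\<^sup>2) * cmod (D m ?p))"
        by (simp add: sum_distrib_left mult_ac)
      finally have "ennreal ((cmod (h ?p))\<^sup>2) \<le> ennreal (\<Sum>m\<in>F. \<kappa> * (w m * (cmod (g m))\<^sup>2) * cmod (D m ?p))"
        by (rule ennreal_leI)
      also have "\<dots> = (\<Sum>m\<in>F. ennreal (\<kappa> * (w m * (cmod (g m))\<^sup>2)) * ennreal (cmod (D m ?p)))"
        using w \<kappa> by (subst sum_ennreal[symmetric]) (auto simp: ennreal_mult intro!: sum.cong)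
      finally show "ennreal ((cmod (h ?p))\<^sup>2)
          \<le> (\<Sum>m\<in>F. ennreal (\<kappa> * (w m * (cmod (g m))\<^sup>2)) * ennreal (cmod (D m ?p)))" .
    qed
    also have "\<dots> = (\<Sum>m\<in>F. ennreal (\<kappa> * (w m * (cmod (g m))\<^sup>2)) * (\<integral>\<^sup>+y. ennreal (cmod (D m (b l, y))) \<partial>sphere_measure))"
      using sec by (subst nn_integral_sum) (auto intro!: sum.cong nn_integral_cmult)
    finally have "ennreal (\<nu> l) * (\<integral>\<^sup>+y. ennreal ((cmod (h (b l, y)))\<^sup>2) \<partial>sphere_measure)
        \<le> ennreal (\<nu> l) * \<dots>"
      by (rule mult_left_mono) simp
    then show "ennreal (\<nu> l) * (\<integral>\<^sup>+y. ennreal ((cmod (h (b l, y)))\<^sup>2) \<partial>sphere_measure)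
        \<le> (\<Sum>m\<in>F. ennreal (\<kappa> * (w m * (cmod (g m))\<^sup>2)) *
        (ennreal (\<nu> l) * (\<integral>\<^sup>+y. ennreal (cmod (D m (b l, y))) \<partial>sphere_measure)))"
      by (simp add: sum_distrib_left mult.left_commute)
  qed
  also have "\<dots> = (\<Sum>m\<in>F. ennreal (\<kappa> * (w m * (cmod (g m))\<^sup>2)) *
        (\<Sum>l. ennreal (\<nu> l) * (\<integral>\<^sup>+y. ennreal (cmod (D m (b l, y))) \<partial>sphere_measure)))"
    by (subst suminf_sum) auto
  also have "\<dots> \<le> (\<Sum>m\<in>F. ennreal (\<kappa> * (w m * (cmod (g m))\<^sup>2)) * ennreal \<kappa>)"
    using R1 by (intro sum_mono mult_left_mono) (auto simp: D_def)
  also have "\<dots> = (\<Sum>m\<in>F. ennreal (\<kappa>\<^sup>2 * (w m * (cmod (g m))\<^sup>2)))"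
    using \<kappa> w by (intro sum.cong) (auto simp: ennreal_mult[symmetric] power2_eq_square mult_ac)
  also have "\<dots> = ennreal (\<kappa>\<^sup>2 * q)"
    using w by (subst sum_ennreal) (auto simp: q_def sum_distrib_left)
  finally have "(1 - \<Delta>) * phase_norm_sq h \<le> \<kappa>\<^sup>2 * q"
    by (rule ennreal_le_iff[THEN iffD1, rotated]) (use q0 in simp)
  then have hq: "phase_norm_sq h \<le> \<kappa>\<^sup>2 / (1 - \<Delta>) * q"
    using \<Delta> by (simp add: field_simps)
  define \<tau> where "\<tau> = \<kappa>\<^sup>2 / (1 - \<Delta>)"
  have \<tau>: "\<tau> > 0" using \<kappa> \<Delta> by (simp add: \<tau>_def)
  have "q \<le> 1 / \<tau> / 2 * phase_norm_sq h + 1 / (2 * (1 / \<tau>)) * phase_norm_sq s"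
    using young[of "1 / \<tau>"] \<tau> by simp
  also have "\<dots> \<le> 1 / \<tau> / 2 * (\<tau> * q) + \<tau> / 2 * phase_norm_sq s"
    using mult_left_mono[OF hq, folded \<tau>_def, of "1 / \<tau> / 2"] \<tau> by simp
  also have "\<dots> = q / 2 + \<tau> / 2 * phase_norm_sq s"
    using \<tau> by simp
  finally have "q \<le> \<tau> * phase_norm_sq s" by simp
  then show ?thesis by (simp add: q_def g_def \<tau>_def)
qed

end

section \<open>Kernel differences and the sums of the majorant\<close>

lemma decay_majorant_commute: "decay_majorant n a b x y = decay_majorant n b a y x"
  by (simp add: decay_majorant_def min.commute add.commute norm_minus_commute)

lemma decay_majorant_nonneg: "a > 0 \<Longrightarrow> b > 0 \<Longrightarrow> 0 \<le> decay_majorant n a b x y"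
  by (simp add: decay_majorant_def)

lemma decay_majorant_measurable [measurable]: "decay_majorant n a b x \<in> borel_measurable borel"
  unfolding decay_majorant_def by measurable

text \<open>A shift of the centre by at most a / 2 changes a + b + |u - y| by at most a factor 2. So
  a single centre can serve for a whole arc, and every point of a cell can serve as the
  centre.\<close>

lemma decay_majorant_perturb:
  assumes ab: "a > 0" "b > 0" and uw: "norm (u - w) \<le> a / 2"
  shows "decay_majorant n a b w y \<le> 2 ^ (n + 1) * decay_majorant n a b u y"
proof -
  define Tw Tu where "Tw = a + b + norm (w - y)" and "Tu = a + b + norm (u - y)"
  have T: "Tw > 0" "Tu > 0" using ab by (auto simp: Tw_def Tu_def add_pos_nonneg)
  have "norm (u - y) \<le> norm (u - w) + norm (w - y)"
    using norm_triangle_ineq[of "u - w" "w - y"] by simp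
  then have "Tu \<le> 2 * Tw" using uw ab norm_ge_zero[of "w - y"] unfolding Tw_def Tu_def by argo
  then have "Tu ^ (n + 1) \<le> (2 * Tw) ^ (n + 1)" using T by (intro power_mono) auto
  then have "Tu ^ (n + 1) \<le> 2 ^ (n + 1) * Tw ^ (n + 1)" by (simp only: power_mult_distrib)
  then have "2 ^ (n + 1) / (2 ^ (n + 1) * Tw ^ (n + 1)) \<le> 2 ^ (n + 1) / Tu ^ (n + 1)"
    using T by (intro divide_left_mono mult_pos_pos) auto
  then have "1 / Tw ^ (n + 1) \<le> 2 ^ (n + 1) / Tu ^ (n + 1)" by simp
  then have "min (a / b) (b / a) * (a + b) * (1 / Tw ^ (n + 1))
      \<le> min (a / b) (b / a) * (a + b) * (2 ^ (n + 1) / Tu ^ (n + 1))"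
    using ab by (intro mult_left_mono) auto
  then show ?thesis
    by (simp add: decay_majorant_def Tw_def Tu_def mult_ac)
qed

locale localized_frame = semicontinuous_frame \<Psi> U K b \<delta> C \<Delta>
  for \<Psi> :: "real \<Rightarrow> real \<Rightarrow> complex"
    and U :: "(real \<times> (real^'d::{finite,wellorder}) \<Rightarrow> complex) set"
    and K :: "real \<times> (real^'d::_) \<Rightarrow> real \<times> (real^'d::_) \<Rightarrow> complex"
    and b :: "nat \<Rightarrow> real" and \<delta> C \<Delta> :: real +
  fixes n :: nat and c :: real
  assumes card: "CARD('d) = n + 1"
    and c_pos: "c > 0"
    and gradient_decay: "\<lbrakk>0 < \<alpha>; \<alpha> \<le> b 0; 0 < \<beta>; \<beta> \<le> b 0; x \<in> usphere; y \<in> usphere\<rbrakk> \<Longrightarrow>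
          \<exists>g. has_surface_gradient (\<lambda>z. K (\<alpha>, z) (\<beta>, y)) g x \<and> (\<alpha> + \<beta>) * norm g \<le> c * decay_majorant n \<alpha> \<beta> x y"
begin

text \<open>The gradient bound has the denominator b_i + b_l and the arc has length at most \<rho>
  b_i, so the quotient of the scales is at most 1 and the factor \<rho> survives. The condition
  \<rho> \<le> 1/4 keeps the arc within b_i / 2 of the centre \<open>u\<close>, as the perturbation
  of the majorant demands; \<rho> b_0 < pi rules out antipodal points. The centre is left free so
  that the bound can be integrated over \<open>u\<close>.\<close>

lemma kernel_difference_bound:
  assumes \<rho>: "0 < \<rho>" "\<rho> \<le> 1 / 4" "\<rho> * b 0 < pi"
    and pts: "x \<in> usphere" "x' \<in> usphere" "u \<in> usphere" "y \<in> usphere"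
    and dist: "geo_dist x x' \<le> \<rho> * b i" "norm (u - x) \<le> \<rho> * b i"
  shows "cmod (K (b i, x) (b l, y) - K (b i, x') (b l, y)) \<le> \<rho> * (c * 2 ^ (n + 1)) * decay_majorant n (b i) (b l) u y"
proof -
  let ?a = "b i" and ?b = "b l"
  let ?A = "c * 2 ^ (n + 1) * decay_majorant n ?a ?b u y"
  have pos: "?a > 0" "?b > 0" by (rule b_pos)+
  have le0: "?a \<le> b 0" "?b \<le> b 0" by (rule scale_sequence_le_0[OF scales])+
  have A: "?A \<ge> 0" using c_pos pos by (simp add: decay_majorant_nonneg)
  have "cmod (K (?a, x) (?b, y) - K (?a, x') (?b, y)) \<le> (?A / (?a + ?b)) * geo_dist x x'"
  proof (rule surface_gradient_mean_value[of x x' "\<lambda>z. K (?a, z) (?b, y)"])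
    have "\<rho> * ?a \<le> \<rho> * b 0" using \<rho> le0 by (intro mult_left_mono) auto
    then show "geo_dist x x' < pi" using dist \<rho> by linarith
    fix w assume w: "w \<in> usphere" "norm (w - x) \<le> geo_dist x x'"
    have "norm (u - w) \<le> norm (u - x) + norm (x - w)"
      using norm_triangle_ineq[of "u - x" "x - w"] by simp
    also have "\<dots> \<le> 2 * (\<rho> * ?a)"
      using dist w(2) by (simp add: norm_minus_commute)
    also have "\<dots> \<le> 2 * (1 / 4 * ?a)" using \<rho> pos by (intro mult_left_mono mult_right_mono) auto
    finally have uw: "norm (u - w) \<le> ?a / 2" by simp
    obtain g where g: "has_surface_gradient (\<lambda>z. K (?a, z) (?b, y)) g w"
        "(?a + ?b) * norm g \<le> c * decay_majorant n ?a ?b w y"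
      using gradient_decay[of ?a ?b w y] pos le0 w(1) pts by auto
    have "c * decay_majorant n ?a ?b w y \<le> c * (2 ^ (n + 1) * decay_majorant n ?a ?b u y)"
      using decay_majorant_perturb[OF pos uw] c_pos by (intro mult_left_mono) auto
    then have "(?a + ?b) * norm g \<le> ?A" using g(2) by (simp add: mult_ac)
    then have "norm g \<le> ?A / (?a + ?b)" using pos by (simp add: field_simps)
    with g(1) show "\<exists>g. has_surface_gradient (\<lambda>z. K (?a, z) (?b, y)) g w \<and> norm g \<le> ?A / (?a + ?b)"
      by blast
  qed (use pts in auto)
  also have "\<dots> \<le> (?A / (?a + ?b)) * (\<rho> * ?a)"
    using dist A pos by (intro mult_left_mono) auto
  also have "\<dots> = \<rho> * ?A * (?a / (?a + ?b))" by simp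
  also have "\<dots> \<le> \<rho> * ?A * 1"
    using A pos \<rho> by (intro mult_left_mono) auto
  finally show ?thesis by (simp add: mult_ac)
qed

text \<open>The integral over the sphere is bounded uniformly in both scales and the weights by C ln
  \<delta>, so only the ratios of the scales remain to be summed. As the majorant is symmetric, the
  same constant serves both directions of Schur's test.\<close>

lemma decay_majorant_sum_bounded:
  obtains c' where "c' > 0"
    "\<forall>i (x :: real^'d::_). (\<Sum>l. ennreal (\<nu> l) * (\<integral>\<^sup>+y. ennreal (decay_majorant n (b i) (b l) x y) \<partial>sphere_measure)) \<le> ennreal c'"
proof -
  obtain S where S: "S \<ge> 0" "\<And>i. (\<Sum>j. ennreal (min (b i / b j) (b j / b i))) \<le> ennreal S"
    using scale_sequence_ratio_sum_bounded[OF scales] by blast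
  define I where "I = real (n + 1) * unit_ball_vol (real (n + 1)) * 2 ^ (n + 1) * 2 ^ (n + 1) * 2"
  have I: "I \<ge> 0" by (simp add: I_def)
  define k where "k = C * ln \<delta> * I"
  have k: "k \<ge> 0"
    using C_pos I scale_sequence_delta_gt_1[OF scales] by (simp add: k_def)
  \<comment> \<open>The added 1 makes the constant positive even if the product k S
    vanishes.\<close>
  have main: "(\<Sum>l. ennreal (\<nu> l) * (\<integral>\<^sup>+y. ennreal (decay_majorant n (b i) (b l) x y) \<partial>sphere_measure)) \<le> ennreal (k * S + 1)"
    for i and x :: "real^'d::_"
  proof -
    have "(\<Sum>l. ennreal (\<nu> l) * (\<integral>\<^sup>+y. ennreal (decay_majorant n (b i) (b l) x y) \<partial>sphere_measure))
        \<le> (\<Sum>l. ennreal k * ennreal (min (b i / b l) (b l / b i)))"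
    proof (intro suminf_le summableI)
      fix l
      let ?m = "min (b i / b l) (b l / b i)"
      have m: "?m \<ge> 0" using b_pos[of i] b_pos[of l] by simp
      have A: "b i + b l > 0" using b_pos[of i] b_pos[of l] by simp
      have nonneg: "0 \<le> (b i + b l) / (b i + b l + norm (x - y)) ^ (n + 1)" for y
        using A norm_ge_zero[of "x - y"] by (intro divide_nonneg_nonneg zero_le_power) linarith+
      have "(\<integral>\<^sup>+y. ennreal (decay_majorant n (b i) (b l) x y) \<partial>sphere_measure)
          = (\<integral>\<^sup>+y. ennreal ?m * ennreal ((b i + b l) / (b i + b l + norm (x - y)) ^ (n + 1)) \<partial>sphere_measure)"
        by (intro nn_integral_cong) (simp only: decay_majorant_def ennreal_mult[OF m nonneg])
      also have "\<dots> = ennreal ?m * (\<integral>\<^sup>+y. ennreal ((b i + b l) / (b i + b l + norm (x - y)) ^ (n + 1)) \<partial>sphere_measure)"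
        by (intro nn_integral_cmult borel_measurable_sphere_measureI) measurable
      also have "\<dots> \<le> ennreal ?m * ennreal I"
        unfolding I_def by (intro mult_left_mono nn_integral_sphere_decay_le A card) simp
      finally have "ennreal (\<nu> l) * (\<integral>\<^sup>+y. ennreal (decay_majorant n (b i) (b l) x y) \<partial>sphere_measure)
          \<le> ennreal (\<nu> l) * (ennreal ?m * ennreal I)"
        by (rule mult_left_mono) simp
      also have "\<dots> \<le> ennreal (C * ln \<delta>) * (ennreal ?m * ennreal I)"
        using C_pos scale_weight_le[OF scales] by (intro mult_right_mono ennreal_leI mult_left_mono) auto
      also have "\<dots> = ennreal k * ennreal ?m"
        using C_pos scale_sequence_delta_gt_1[OF scales] m I
        by (simp add: k_def ennreal_mult[symmetric] mult_ac)
      finally show "ennreal (\<nu> l) * (\<integral>\<^sup>+y. ennreal (decay_majorant n (b i) (b l) x y) \<partial>sphere_measure)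
          \<le> ennreal k * ennreal ?m" .
    qed
    also have "\<dots> = ennreal k * (\<Sum>l. ennreal (min (b i / b l) (b l / b i)))"
      by (rule ennreal_suminf_cmult)
    also have "\<dots> \<le> ennreal k * ennreal S"
      by (intro mult_left_mono S(2)) simp
    also have "\<dots> = ennreal (k * S)" using k S(1) by (simp add: ennreal_mult)
    also have "\<dots> \<le> ennreal (k * S + 1)" by (intro ennreal_leI) simp
    finally show ?thesis .
  qed
  have "k * S + 1 > 0" using k S(1) by (simp add: add_nonneg_pos)
  then show ?thesis using main by (intro that) auto
qed

end

section \<open>The sampling error\<close>

text \<open>Monotone convergence for finitely many functions along a common index. It suffices to
  bound simple minorants with finite values, which involve only finitely many level sets.\<close>

lemma nn_integral_sum_le_simple:
  fixes h :: "'i \<Rightarrow> 'a \<Rightarrow> ennreal"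
  assumes I: "finite I" and h: "\<And>i. i \<in> I \<Longrightarrow> h i \<in> borel_measurable M"
    and le: "\<And>u. (\<And>i. i \<in> I \<Longrightarrow> simple_function M (u i)) \<Longrightarrow> (\<And>i x. i \<in> I \<Longrightarrow> u i x \<le> h i x)
        \<Longrightarrow> (\<And>i x. i \<in> I \<Longrightarrow> u i x < top) \<Longrightarrow> (\<Sum>i\<in>I. k i * integral\<^sup>S M (u i)) \<le> B"
  shows "(\<Sum>i\<in>I. k i * integral\<^sup>N M (h i)) \<le> B"
proof -
  have "\<exists>f. incseq f \<and> (\<forall>j. (\<forall>x. f j x < top) \<and> simple_function M (f j)) \<and> h i = (SUP j. f j)" if "i \<in> I" for i
    by (rule borel_measurable_implies_simple_function_sequence[OF h[OF that]])
  then obtain f where f: "\<And>i. i \<in> I \<Longrightarrow> incseq (f i)" "\<And>i j x. i \<in> I \<Longrightarrow> f i j x < top"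
      "\<And>i j. i \<in> I \<Longrightarrow> simple_function M (f i j)" "\<And>i. i \<in> I \<Longrightarrow> h i = (SUP j. f i j)"
    by metis
  have int: "integral\<^sup>N M (h i) = (SUP j. integral\<^sup>S M (f i j))" if "i \<in> I" for i
  proof -
    have "integral\<^sup>N M (h i) = (\<integral>\<^sup>+x. (SUP j. f i j x) \<partial>M)"
      unfolding f(4)[OF that] by (rule nn_integral_cong) (rule SUP_apply)
    also have "\<dots> = (SUP j. integral\<^sup>N M (f i j))"
      using f(1,3)[OF that] by (intro nn_integral_monotone_convergence_SUP borel_measurable_simple_function)
    finally show ?thesis using f(3)[OF that] by (simp add: nn_integral_eq_simple_integral)
  qed
  have "(\<Sum>i\<in>I. k i * integral\<^sup>N M (h i)) = (\<Sum>i\<in>I. SUP j. k i * integral\<^sup>S M (f i j))"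
    by (simp add: int SUP_mult_left_ennreal)
  also have "\<dots> = (SUP j. \<Sum>i\<in>I. k i * integral\<^sup>S M (f i j))"
  proof (rule ennreal_SUP_sum[symmetric])
    fix i assume i: "i \<in> I"
    show "incseq (\<lambda>j. k i * integral\<^sup>S M (f i j))"
    proof (rule incseq_SucI)
      fix j
      have "integral\<^sup>S M (f i j) \<le> integral\<^sup>S M (f i (Suc j))"
        using f(1,3)[OF i] by (intro simple_integral_mono) (auto simp: incseq_Suc_iff le_fun_def)
      then show "k i * integral\<^sup>S M (f i j) \<le> k i * integral\<^sup>S M (f i (Suc j))"
        by (rule mult_left_mono) simp
    qed
  qed
  also have "\<dots> \<le> B"
  proof (rule SUP_least)
    fix j
    have "f i j x \<le> h i x" if "i \<in> I" for i x
    proof -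
      have "f i j \<le> h i" unfolding f(4)[OF that] by (rule SUP_upper) simp
      then show ?thesis by (rule le_funD)
    qed
    then show "(\<Sum>i\<in>I. k i * integral\<^sup>S M (f i j)) \<le> B"
      by (intro le) (use f in auto)
  qed
  finally show ?thesis .
qed

context localized_frame
begin

text \<open>Cells are indexed by the position j of the scale instead of the scale itself; sample
  points are kept apart, as a selection with \<open>t j Q \<in> Q\<close>.\<close>

definition mesh :: "real \<Rightarrow> (nat \<Rightarrow> (real^'d::_) set set) \<Rightarrow> bool" where
  "mesh \<rho> p \<longleftrightarrow> (\<forall>j. finite (p j) \<and> partition_on usphere (p j) \<and>
     (\<forall>Q\<in>p j. Q \<in> sets (completion sphere_measure) \<and> (\<forall>x\<in>Q. \<forall>y\<in>Q. geo_dist x y \<le> \<rho> * b j)))"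

lemma mesh_sum_indicator_le:
  assumes "mesh \<rho> p"
  shows "(\<Sum>Q\<in>p j. indicator Q x) \<le> (1 :: ennreal)"
proof -
  have fin: "finite (p j)" and dis: "\<And>Q R. Q \<in> p j \<Longrightarrow> R \<in> p j \<Longrightarrow> Q \<noteq> R \<Longrightarrow> Q \<inter> R = {}"
    using assms by (auto simp: mesh_def partition_on_def disjoint_def)
  show ?thesis
  proof (cases "\<exists>Q\<in>p j. x \<in> Q")
    case True
    then obtain Q where Q: "Q \<in> p j" "x \<in> Q" by blast
    have "(\<Sum>R\<in>p j. indicator R x) = (\<Sum>R\<in>{Q}. indicator R x :: ennreal)"
      using fin Q dis by (intro sum.mono_neutral_right) (auto simp: indicator_def)
    then show ?thesis using Q by simp
  next
    case False
    then have "(\<Sum>Q\<in>p j. indicator Q x :: ennreal) = 0"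
      by (intro sum.neutral) auto
    then show ?thesis by simp
  qed
qed

text \<open>The simple functions \<open>u\<close> approximate \<open>|s(b\<^sub>j, \<sqdot>) - s(b\<^sub>j, t\<^sub>Q)|\<^sup>2\<close> from below; a value \<open>v\<close> of
  \<open>u\<close> is bounded by the value of this function at an arbitrary point of the level set of \<open>v\<close>.\<close>

lemma simple_difference_bound:
  fixes c' :: real
  assumes c': "c' > 0"
    "\<And>i (x :: real^'d::_). (\<Sum>l. ennreal (\<nu> l) * (\<integral>\<^sup>+y. ennreal (decay_majorant n (b i) (b l) x y) \<partial>sphere_measure)) \<le> ennreal c'"
    and \<rho>: "0 < \<rho>" "\<rho> \<le> 1 / 4" "\<rho> * b 0 < pi"
    and mesh: "mesh \<rho> p" and t: "\<And>j Q. Q \<in> p j \<Longrightarrow> t j Q \<in> Q"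
    and s: "s \<in> U"
    and u: "\<And>i. i \<in> Sigma {..<N} p \<Longrightarrow> simple_function (completion sphere_measure) (u i)"
      "\<And>i x. i \<in> Sigma {..<N} p \<Longrightarrow>
         u i x \<le> ennreal ((cmod (s (b (fst i), x) - s (b (fst i), t (fst i) (snd i))))\<^sup>2) * indicator (snd i) x"
      "\<And>i x. i \<in> Sigma {..<N} p \<Longrightarrow> u i x < top"
  shows "(\<Sum>i\<in>Sigma {..<N} p. ennreal (\<nu> (fst i)) * integral\<^sup>S (completion sphere_measure) (u i))
    \<le> ennreal ((\<rho> * (c * 2 ^ (n + 1) * c'))\<^sup>2 / (1 - \<Delta>) * phase_norm_sq s)"
proof -
  let ?M = "completion (sphere_measure :: (real^'d::_) measure)"
  define I where "I = Sigma {..<N} p"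
  define cell where "cell i v = u i -` {v} \<inter> usphere" for i v
  \<comment> \<open>An index m = ((j, Q), v) names a level set. Dropping the value 0 forces the
    level set into Q, where the distance to the sample point is controlled.\<close>
  define F where "F = Sigma I (\<lambda>i. u i ` usphere - {0})"
  define x where "x m = (SOME x. x \<in> cell (fst m) (snd m))" for m
  define w where "w m = \<nu> (fst (fst m)) * measure ?M (cell (fst m) (snd m))" for m
  define z where "z m = (b (fst (fst m)), x m)" for m
  define z' where "z' m = (b (fst (fst m)), t (fst (fst m)) (snd (fst m)))"
    for m :: "(nat \<times> (real^'d::_) set) \<times> ennreal"
  define \<kappa> where "\<kappa> = \<rho> * (c * 2 ^ (n + 1) * c')"
  define k where "k = \<rho> * (c * 2 ^ (n + 1))"
  have k: "k > 0" "\<kappa> = k * c'" using \<rho> c_pos by (auto simp: k_def \<kappa>_def)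
  have \<kappa>: "\<kappa> > 0" using k c' by simp
  have finp: "finite (p j)" and Up: "\<Union> (p j) = usphere" for j
    using mesh by (simp_all add: mesh_def partition_on_def)
  have Qsub: "Q \<subseteq> usphere" if "Q \<in> p j" for j Q
    using that unfolding Up[of j, symmetric] by blast
  have diam: "geo_dist x y \<le> \<rho> * b j" if "Q \<in> p j" "x \<in> Q" "y \<in> Q" for j Q x y
    using mesh that by (auto simp: mesh_def)
  have finI: "finite I" unfolding I_def using finp by auto
  have fin: "finite (u i ` usphere)" if "i \<in> I" for i
    using simple_functionD(1)[OF u(1)] that by (auto simp: I_def)
  have finF: "finite F" unfolding F_def using finI fin by auto
  have cellM: "cell i v \<in> sets ?M" if "i \<in> I" for i v
    using simple_functionD(2)[OF u(1)] that by (auto simp: I_def cell_def)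
  have cellQ: "cell i v \<subseteq> snd i" if "i \<in> I" "v \<noteq> 0" for i v
  proof
    fix r assume r: "r \<in> cell i v"
    show "r \<in> snd i"
    proof (rule ccontr)
      assume "r \<notin> snd i"
      then have "u i r \<le> 0" using u(2)[of i r] that(1) by (simp add: I_def)
      then show False using r that(2) by (simp add: cell_def)
    qed
  qed
  have mF: "fst m \<in> I" "snd m \<noteq> 0" "x m \<in> cell (fst m) (snd m)" if "m \<in> F" for m
  proof -
    show "fst m \<in> I" "snd m \<noteq> 0" using that by (auto simp: F_def)
    have "\<exists>y. y \<in> cell (fst m) (snd m)" using that by (auto simp: F_def cell_def)
    then show "x m \<in> cell (fst m) (snd m)" unfolding x_def by (rule someI_ex)
  qed
  have mQ: "snd (fst m) \<in> p (fst (fst m))" if "m \<in> F" for m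
    using mF(1)[OF that] by (auto simp: I_def)
  have xQ: "x m \<in> snd (fst m)" and x: "x m \<in> usphere" if "m \<in> F" for m
    using cellQ[OF mF(1,2)[OF that]] mF(3)[OF that] by (auto simp: cell_def)
  have tQ: "t (fst (fst m)) (snd (fst m)) \<in> snd (fst m)" if "m \<in> F" for m
    by (rule t[OF mQ[OF that]])
  have tS: "t (fst (fst m)) (snd (fst m)) \<in> usphere" if "m \<in> F" for m
    using tQ[OF that] Qsub[OF mQ[OF that]] by auto
  have w0: "w m \<ge> 0" for m unfolding w_def using \<nu>_nonneg by simp
  \<comment> \<open>The centre \<open>r\<close> may be any point of the level set. With r =
    \<open>x m\<close> this gives \<open>R1\<close>; integrated over \<open>r\<close> it turns the
    finite sum of \<open>R2\<close> into integrals.\<close>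
  have D: "cmod (K (z m) (b l, y) - K (z' m) (b l, y)) \<le> k * decay_majorant n (b (fst (fst m))) (b l) r y"
    if m: "m \<in> F" and r: "r \<in> cell (fst m) (snd m)" and y: "y \<in> usphere" for m r l y
  proof -
    have rQ: "r \<in> snd (fst m)" "r \<in> usphere"
      using cellQ[OF mF(1,2)[OF m]] r by (auto simp: cell_def)
    have "norm (r - x m) \<le> geo_dist r (x m)"
      using rQ x[OF m] by (intro norm_diff_le_geo_dist)
    also have "\<dots> \<le> \<rho> * b (fst (fst m))"
      by (rule diam[OF mQ[OF m] rQ(1) xQ[OF m]])
    finally have "norm (r - x m) \<le> \<rho> * b (fst (fst m))" .
    with \<rho> show ?thesis unfolding z_def z'_def k_def
      by (intro kernel_difference_bound x[OF m] tS[OF m] rQ(2) y diam[OF mQ[OF m] xQ[OF m] tQ[OF m]])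
  qed
  have ew: "ennreal (w m * d) = ennreal (\<nu> (fst (fst m))) * (ennreal d * emeasure ?M (cell (fst m) (snd m)))"
    if "d \<ge> 0" for m d
  proof -
    have "w m * d = \<nu> (fst (fst m)) * (d * measure ?M (cell (fst m) (snd m)))"
      by (simp add: w_def mult_ac)
    then have "ennreal (w m * d) = ennreal (\<nu> (fst (fst m))) * ennreal (d * measure ?M (cell (fst m) (snd m)))"
      using that by (simp only: ennreal_mult[OF \<nu>_nonneg mult_nonneg_nonneg] measure_nonneg)
    then show ?thesis using that by (simp add: emeasure_completion_sphere_measure ennreal_mult)
  qed
  have De: "ennreal (cmod (K (z m) (b l, y) - K (z' m) (b l, y)))
      \<le> ennreal k * ennreal (decay_majorant n (b (fst (fst m))) (b l) r y)"
    if "m \<in> F" "r \<in> cell (fst m) (snd m)" "y \<in> usphere" for m r l y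
    using ennreal_leI[OF D[OF that]] k by (simp add: ennreal_mult decay_majorant_nonneg b_pos)
  have majm: "(\<lambda>y. ennreal (decay_majorant n (b i) (b l) r y)) \<in> borel_measurable sphere_measure" for i l r
    by (intro borel_measurable_sphere_measureI) measurable
  have R1: "(\<Sum>l. ennreal (\<nu> l) * (\<integral>\<^sup>+y. ennreal (cmod (K (z m) (b l, y) - K (z' m) (b l, y))) \<partial>sphere_measure)) \<le> ennreal \<kappa>"
    if m: "m \<in> F" for m
  proof -
    let ?j = "fst (fst m)"
    have "(\<Sum>l. ennreal (\<nu> l) * (\<integral>\<^sup>+y. ennreal (cmod (K (z m) (b l, y) - K (z' m) (b l, y))) \<partial>sphere_measure))
        \<le> (\<Sum>l. ennreal k * (ennreal (\<nu> l) * (\<integral>\<^sup>+y. ennreal (decay_majorant n (b ?j) (b l) (x m) y) \<partial>sphere_measure)))"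
    proof (intro suminf_le summableI)
      fix l
      have "(\<integral>\<^sup>+y. ennreal (cmod (K (z m) (b l, y) - K (z' m) (b l, y))) \<partial>sphere_measure)
          \<le> (\<integral>\<^sup>+y. ennreal k * ennreal (decay_majorant n (b ?j) (b l) (x m) y) \<partial>sphere_measure)"
        by (intro nn_integral_mono De[OF m mF(3)[OF m]]) simp
      also have "\<dots> = ennreal k * (\<integral>\<^sup>+y. ennreal (decay_majorant n (b ?j) (b l) (x m) y) \<partial>sphere_measure)"
        by (rule nn_integral_cmult[OF majm])
      finally have "ennreal (\<nu> l) * (\<integral>\<^sup>+y. ennreal (cmod (K (z m) (b l, y) - K (z' m) (b l, y))) \<partial>sphere_measure)
        \<le> ennreal (\<nu> l) * \<dots>"
        by (rule mult_left_mono) simp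
      then show "ennreal (\<nu> l) * (\<integral>\<^sup>+y. ennreal (cmod (K (z m) (b l, y) - K (z' m) (b l, y))) \<partial>sphere_measure)
          \<le> ennreal k * (ennreal (\<nu> l) * (\<integral>\<^sup>+y. ennreal (decay_majorant n (b ?j) (b l) (x m) y) \<partial>sphere_measure))"
        by (simp only: mult.left_commute)
    qed
    also have "\<dots> = ennreal k * (\<Sum>l. ennreal (\<nu> l) * (\<integral>\<^sup>+y. ennreal (decay_majorant n (b ?j) (b l) (x m) y) \<partial>sphere_measure))"
      by (rule ennreal_suminf_cmult)
    also have "\<dots> \<le> ennreal k * ennreal c'"
      by (rule mult_left_mono[OF c'(2)]) simp
    also have "\<dots> = ennreal \<kappa>" using k c' by (simp add: ennreal_mult)
    finally show ?thesis .
  qed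
  have R2: "(\<Sum>m\<in>F. w m * cmod (K (z m) (b l, y) - K (z' m) (b l, y))) \<le> \<kappa>" if y: "y \<in> usphere" for l y
  proof -
    \<comment> \<open>The arguments are swapped by symmetry of the majorant, so that summing over j
      and integrating over r is again a sum bounded by c'.\<close>
    let ?g = "\<lambda>j r. ennreal (decay_majorant n (b l) (b j) y r)"
    have gm: "?g j \<in> borel_measurable ?M" for j
      by (rule measurable_completion[OF majm])
    have "ennreal (\<Sum>m\<in>F. w m * cmod (K (z m) (b l, y) - K (z' m) (b l, y)))
        = (\<Sum>m\<in>F. ennreal (w m * cmod (K (z m) (b l, y) - K (z' m) (b l, y))))"
      using w0 by (intro sum_ennreal[symmetric]) simp
    \<comment> \<open>The weight contains the measure of the level set, so each summand is at most
      an integral over it. Level sets are disjoint inside a cell, and cells inside the sphere; hence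
      one integral over the sphere remains per scale.\<close>
    also have "\<dots> \<le> (\<Sum>m\<in>F. ennreal (\<nu> (fst (fst m))) *
        (\<integral>\<^sup>+r. ennreal k * ?g (fst (fst m)) r * indicator (cell (fst m) (snd m)) r \<partial>?M))"
    proof (rule sum_mono)
      fix m assume m: "m \<in> F"
      let ?D = "cmod (K (z m) (b l, y) - K (z' m) (b l, y))" and ?C = "cell (fst m) (snd m)"
      have "ennreal (w m * ?D) = ennreal (\<nu> (fst (fst m))) * (ennreal ?D * emeasure ?M ?C)"
        by (rule ew) simp
      also have "ennreal ?D * emeasure ?M ?C = (\<integral>\<^sup>+r. ennreal ?D * indicator ?C r \<partial>?M)"
        by (rule nn_integral_cmult_indicator[symmetric, OF cellM[OF mF(1)[OF m]]])
      also have "\<dots> \<le> (\<integral>\<^sup>+r. ennreal k * ?g (fst (fst m)) r * indicator ?C r \<partial>?M)"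
      proof (rule nn_integral_mono)
        fix r
        show "ennreal ?D * indicator ?C r \<le> ennreal k * ?g (fst (fst m)) r * indicator ?C r"
          using De[OF m _ y, of r l] by (simp add: indicator_def decay_majorant_commute[of n "b l"])
      qed
      finally show "ennreal (w m * ?D) \<le> ennreal (\<nu> (fst (fst m))) *
        (\<integral>\<^sup>+r. ennreal k * ?g (fst (fst m)) r * indicator ?C r \<partial>?M)"
        by (simp add: mult_left_mono)
    qed
    also have "\<dots> = (\<Sum>i\<in>I. \<Sum>v\<in>u i ` usphere - {0}. ennreal (\<nu> (fst i)) *
        (\<integral>\<^sup>+r. ennreal k * ?g (fst i) r * indicator (cell i v) r \<partial>?M))"
      unfolding F_def using finI fin by (subst sum.Sigma) (auto simp: case_prod_beta)
    also have "\<dots> \<le> (\<Sum>i\<in>I. ennreal (\<nu> (fst i)) * (\<integral>\<^sup>+r. ennreal k * ?g (fst i) r * indicator (snd i) r \<partial>?M))"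
    proof (rule sum_mono)
      fix i assume i: "i \<in> I"
      have "(\<Sum>v\<in>u i ` usphere - {0}. ennreal (\<nu> (fst i)) * (\<integral>\<^sup>+r. ennreal k * ?g (fst i) r * indicator (cell i v) r \<partial>?M))
          = ennreal (\<nu> (fst i)) * (\<integral>\<^sup>+r. (\<Sum>v\<in>u i ` usphere - {0}. ennreal k * ?g (fst i) r * indicator (cell i v) r) \<partial>?M)"
        using gm cellM[OF i]
        by (subst nn_integral_sum) (auto simp: sum_distrib_left intro!: borel_measurable_times_ennreal borel_measurable_indicator)
      also have "\<dots> \<le> ennreal (\<nu> (fst i)) * (\<integral>\<^sup>+r. ennreal k * ?g (fst i) r * indicator (snd i) r \<partial>?M)"
      proof (intro mult_left_mono nn_integral_mono)
        fix r
        have "(\<Sum>v\<in>u i ` usphere - {0}. indicator (cell i v) r) \<le> (indicator (snd i) r :: ennreal)"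
        proof (cases "u i r \<in> u i ` usphere - {0} \<and> r \<in> usphere")
          case True
          then have "(\<Sum>v\<in>u i ` usphere - {0}. indicator (cell i v) r) = (\<Sum>v\<in>{u i r}. indicator (cell i v) r :: ennreal)"
            using fin[OF i] by (intro sum.mono_neutral_right) (auto simp: cell_def)
          also have "\<dots> = indicator (cell i (u i r)) r" by simp
          also have "\<dots> \<le> indicator (snd i) r"
            using cellQ[OF i, of "u i r"] True by (auto simp: indicator_def)
          finally show ?thesis .
        next
          case False
          then have "(\<Sum>v\<in>u i ` usphere - {0}. indicator (cell i v) r) = (0 :: ennreal)"
            by (intro sum.neutral) (auto simp: cell_def indicator_def)
          then show ?thesis by simp
        qed
        then show "(\<Sum>v\<in>u i ` usphere - {0}. ennreal k * ?g (fst i) r * indicator (cell i v) r)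
            \<le> ennreal k * ?g (fst i) r * indicator (snd i) r"
          unfolding sum_distrib_left[symmetric] by (rule mult_left_mono) simp
      qed simp
      finally show "(\<Sum>v\<in>u i ` usphere - {0}. ennreal (\<nu> (fst i)) * (\<integral>\<^sup>+r. ennreal k * ?g (fst i) r * indicator (cell i v) r \<partial>?M))
          \<le> ennreal (\<nu> (fst i)) * (\<integral>\<^sup>+r. ennreal k * ?g (fst i) r * indicator (snd i) r \<partial>?M)" .
    qed
    also have "\<dots> = (\<Sum>j<N. \<Sum>Q\<in>p j. ennreal (\<nu> j) * (\<integral>\<^sup>+r. ennreal k * ?g j r * indicator Q r \<partial>?M))"
      unfolding I_def using finp by (subst sum.Sigma) (auto simp: case_prod_beta)
    also have "\<dots> \<le> (\<Sum>j<N. ennreal k * (ennreal (\<nu> j) * (\<integral>\<^sup>+r. ?g j r \<partial>sphere_measure)))"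
    proof (rule sum_mono)
      fix j
      have Qm: "Q \<in> sets ?M" if "Q \<in> p j" for Q
        using mesh that by (auto simp: mesh_def)
      have "(\<Sum>Q\<in>p j. ennreal (\<nu> j) * (\<integral>\<^sup>+r. ennreal k * ?g j r * indicator Q r \<partial>?M))
          = ennreal (\<nu> j) * (\<integral>\<^sup>+r. (\<Sum>Q\<in>p j. ennreal k * ?g j r * indicator Q r) \<partial>?M)"
        using gm Qm
        by (subst nn_integral_sum) (auto simp: sum_distrib_left intro!: borel_measurable_times_ennreal borel_measurable_indicator)
      also have "\<dots> \<le> ennreal (\<nu> j) * (\<integral>\<^sup>+r. ennreal k * ?g j r \<partial>?M)"
      proof (intro mult_left_mono nn_integral_mono)
        fix r
        have "ennreal k * ?g j r * (\<Sum>Q\<in>p j. indicator Q r) \<le> ennreal k * ?g j r * 1"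
          by (intro mult_left_mono mesh_sum_indicator_le[OF mesh]) simp
        then show "(\<Sum>Q\<in>p j. ennreal k * ?g j r * indicator Q r) \<le> ennreal k * ?g j r"
          by (simp add: sum_distrib_left)
      qed simp
      also have "(\<integral>\<^sup>+r. ennreal k * ?g j r \<partial>?M) = ennreal k * (\<integral>\<^sup>+r. ?g j r \<partial>sphere_measure)"
        by (simp add: nn_integral_completion nn_integral_cmult[OF majm])
      finally show "(\<Sum>Q\<in>p j. ennreal (\<nu> j) * (\<integral>\<^sup>+r. ennreal k * ?g j r * indicator Q r \<partial>?M))
          \<le> ennreal k * (ennreal (\<nu> j) * (\<integral>\<^sup>+r. ?g j r \<partial>sphere_measure))"
        by (simp only: mult.left_commute)
    qed
    also have "\<dots> = ennreal k * (\<Sum>j<N. ennreal (\<nu> j) * (\<integral>\<^sup>+r. ?g j r \<partial>sphere_measure))"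
      by (simp add: sum_distrib_left)
    also have "\<dots> \<le> ennreal k * (\<Sum>j. ennreal (\<nu> j) * (\<integral>\<^sup>+r. ?g j r \<partial>sphere_measure))"
      by (intro mult_left_mono sum_le_suminf) auto
    also have "\<dots> \<le> ennreal k * ennreal c'"
      by (rule mult_left_mono[OF c'(2)]) simp
    also have "\<dots> = ennreal \<kappa>" using k c' by (simp add: ennreal_mult)
    finally show ?thesis
      by (rule ennreal_le_iff[THEN iffD1, rotated]) (use \<kappa> in simp)
  qed
  have "(\<Sum>i\<in>I. ennreal (\<nu> (fst i)) * integral\<^sup>S ?M (u i))
      = (\<Sum>i\<in>I. \<Sum>v\<in>u i ` usphere - {0}. ennreal (\<nu> (fst i)) * (v * emeasure ?M (cell i v)))"
  proof (rule sum.cong[OF refl])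
    fix i assume i: "i \<in> I"
    have "integral\<^sup>S ?M (u i) = (\<Sum>v\<in>u i ` usphere. v * emeasure ?M (cell i v))"
      by (simp add: simple_integral_def cell_def)
    also have "\<dots> = (\<Sum>v\<in>u i ` usphere - {0}. v * emeasure ?M (cell i v))"
      using fin[OF i] by (intro sum.mono_neutral_right) auto
    finally show "ennreal (\<nu> (fst i)) * integral\<^sup>S ?M (u i)
        = (\<Sum>v\<in>u i ` usphere - {0}. ennreal (\<nu> (fst i)) * (v * emeasure ?M (cell i v)))"
      by (simp add: sum_distrib_left)
  qed
  also have "\<dots> = (\<Sum>m\<in>F. ennreal (\<nu> (fst (fst m))) * (snd m * emeasure ?M (cell (fst m) (snd m))))"
    unfolding F_def using finI fin by (subst sum.Sigma) (auto simp: case_prod_beta)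
  also have "\<dots> \<le> (\<Sum>m\<in>F. ennreal (w m * (cmod (s (z m) - s (z' m)))\<^sup>2))"
  proof (rule sum_mono)
    fix m assume m: "m \<in> F"
    have "snd m = u (fst m) (x m)" using mF(3)[OF m] by (simp add: cell_def)
    also have "\<dots> \<le> ennreal ((cmod (s (z m) - s (z' m)))\<^sup>2) * indicator (snd (fst m)) (x m)"
      unfolding z_def z'_def by (rule u(2)) (use mF(1)[OF m] in \<open>simp add: I_def\<close>)
    also have "\<dots> = ennreal ((cmod (s (z m) - s (z' m)))\<^sup>2)" using xQ[OF m] by simp
    finally have le: "snd m \<le> ennreal ((cmod (s (z m) - s (z' m)))\<^sup>2)" .
    have "ennreal (\<nu> (fst (fst m))) * (snd m * emeasure ?M (cell (fst m) (snd m)))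
        \<le> ennreal (\<nu> (fst (fst m))) * (ennreal ((cmod (s (z m) - s (z' m)))\<^sup>2) * emeasure ?M (cell (fst m) (snd m)))"
      by (intro mult_left_mono mult_right_mono le) auto
    also have "\<dots> = ennreal (w m * (cmod (s (z m) - s (z' m)))\<^sup>2)"
      by (rule ew[symmetric]) simp
    finally show "ennreal (\<nu> (fst (fst m))) * (snd m * emeasure ?M (cell (fst m) (snd m)))
        \<le> ennreal (w m * (cmod (s (z m) - s (z' m)))\<^sup>2)" .
  qed
  also have "\<dots> = ennreal (\<Sum>m\<in>F. w m * (cmod (s (z m) - s (z' m)))\<^sup>2)"
    using w0 by (intro sum_ennreal) simp
  also have "\<dots> \<le> ennreal (\<kappa>\<^sup>2 / (1 - \<Delta>) * phase_norm_sq s)"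
  proof (intro ennreal_leI finite_difference_bound finF w0 \<kappa> R1 R2 s)
    fix m assume m: "m \<in> F"
    show "z m \<in> {0<..} \<times> usphere" "z' m \<in> {0<..} \<times> usphere"
      using x[OF m] tS[OF m] b_pos by (auto simp: z_def z'_def)
  qed
  finally show ?thesis by (simp only: I_def \<kappa>_def)
qed

text \<open>The estimate for the first N scales does not depend on N and so passes to the series.
  Its constant is quadratic in the mesh size, while c' depends neither on the mesh nor on the sample
  points.\<close>

lemma sampling_error_bound:
  obtains c' where "c' > 0"
    "\<forall>\<rho> p t s. 0 < \<rho> \<and> \<rho> \<le> 1 / 4 \<and> \<rho> * b 0 < pi \<and> mesh \<rho> p \<and> (\<forall>j. \<forall>Q\<in>p j. t j Q \<in> Q) \<and> s \<in> U \<longrightarrow>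
       (\<Sum>j. ennreal (\<nu> j) * (\<Sum>Q\<in>p j. \<integral>\<^sup>+x. ennreal ((cmod (s (b j, x) - s (b j, t j Q)))\<^sup>2) * indicator Q x \<partial>completion sphere_measure))
       \<le> ennreal ((\<rho> * c')\<^sup>2 / (1 - \<Delta>) * phase_norm_sq s)"
proof -
  obtain c1 where c1: "c1 > 0"
    "\<forall>i (x :: real^'d::_). (\<Sum>l. ennreal (\<nu> l) * (\<integral>\<^sup>+y. ennreal (decay_majorant n (b i) (b l) x y) \<partial>sphere_measure)) \<le> ennreal c1"
    by (rule decay_majorant_sum_bounded)
  let ?M = "completion (sphere_measure :: (real^'d::_) measure)"
  have "(\<Sum>j. ennreal (\<nu> j) * (\<Sum>Q\<in>p j. \<integral>\<^sup>+x. ennreal ((cmod (s (b j, x) - s (b j, t j Q)))\<^sup>2) * indicator Q x \<partial>?M))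
      \<le> ennreal ((\<rho> * (c * 2 ^ (n + 1) * c1))\<^sup>2 / (1 - \<Delta>) * phase_norm_sq s)"
    if \<rho>: "0 < \<rho>" "\<rho> \<le> 1 / 4" "\<rho> * b 0 < pi" and mesh: "mesh \<rho> p"
      and t: "\<And>j Q. Q \<in> p j \<Longrightarrow> t j Q \<in> Q" and s: "s \<in> U" for \<rho> p t s
  proof (rule suminf_le_const[OF summableI])
    fix N
    let ?h = "\<lambda>i x. ennreal ((cmod (s (b (fst i), x) - s (b (fst i), t (fst i) (snd i))))\<^sup>2) * indicator (snd i) x"
    have fin: "finite (p j)" and Qm: "\<And>Q. Q \<in> p j \<Longrightarrow> Q \<in> sets ?M" for j
      using mesh by (auto simp: mesh_def)
    have "s \<in> borel_measurable phase_measure"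
      using s U_L2 by (auto simp: L2_space_def)
    then have sm: "(\<lambda>x. s (b j, x)) \<in> borel_measurable ?M" for j
      by (intro measurable_completion phase_section_measurable b_pos)
    have "(\<Sum>j<N. ennreal (\<nu> j) * (\<Sum>Q\<in>p j. \<integral>\<^sup>+x. ennreal ((cmod (s (b j, x) - s (b j, t j Q)))\<^sup>2) * indicator Q x \<partial>?M))
        = (\<Sum>i\<in>Sigma {..<N} p. ennreal (\<nu> (fst i)) * integral\<^sup>N ?M (?h i))"
      unfolding sum_distrib_left using fin by (subst sum.Sigma) (auto simp: case_prod_beta)
    also have "\<dots> \<le> ennreal ((\<rho> * (c * 2 ^ (n + 1) * c1))\<^sup>2 / (1 - \<Delta>) * phase_norm_sq s)"
    proof (rule nn_integral_sum_le_simple)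
      show "finite (Sigma {..<N} p)" using fin by auto
      show "?h i \<in> borel_measurable ?M" if "i \<in> Sigma {..<N} p" for i
        using sm[of "fst i"] Qm[of "snd i" "fst i"] that
        by (intro borel_measurable_times_ennreal borel_measurable_indicator) auto
    qed (rule simple_difference_bound[OF c1(1) c1(2)[rule_format] \<rho> mesh t s])
    finally show "(\<Sum>j<N. ennreal (\<nu> j) * (\<Sum>Q\<in>p j. \<integral>\<^sup>+x. ennreal ((cmod (s (b j, x) - s (b j, t j Q)))\<^sup>2) * indicator Q x \<partial>?M))
      \<le> ennreal ((\<rho> * (c * 2 ^ (n + 1) * c1))\<^sup>2 / (1 - \<Delta>) * phase_norm_sq s)" .
  qed
  then show ?thesis
    using c_pos c1(1) by (intro that[of "c * 2 ^ (n + 1) * c1"]) auto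
qed

end

section \<open>From the sampling error to the frame bounds\<close>

lemma norm_square_young:
  fixes u v :: complex
  assumes "\<tau> > 0"
  shows "(cmod u)\<^sup>2 \<le> (1 + \<tau>) * (cmod v)\<^sup>2 + (1 + 1 / \<tau>) * (cmod (u - v))\<^sup>2"
proof -
  let ?a = "cmod v" and ?d = "cmod (u - v)"
  have "cmod u \<le> ?a + ?d" using norm_triangle_ineq[of v "u - v"] by simp
  then have "(cmod u)\<^sup>2 \<le> (?a + ?d)\<^sup>2" by (intro power_mono) auto
  also have "\<dots> = ?a\<^sup>2 + ?d\<^sup>2 + 2 * (?a * ?d)" by (simp add: power2_sum)
  also have "2 * (?a * ?d) \<le> \<tau> * ?a\<^sup>2 + 1 / \<tau> * ?d\<^sup>2"
  proof -
    have "0 \<le> (\<tau> * ?a - ?d)\<^sup>2" by simp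
    then have "\<tau> * (2 * (?a * ?d)) \<le> \<tau> * (\<tau> * ?a\<^sup>2 + 1 / \<tau> * ?d\<^sup>2)"
      using assms by (simp add: power2_eq_square algebra_simps)
    then show ?thesis using assms by (simp only: mult_le_cancel_left_pos)
  qed
  finally show ?thesis by (simp add: algebra_simps)
qed

text \<open>A finite set of indices meets only finitely many values of j, so the finite subsums and
  the partial sums over j < N have the same supremum. This converts the unordered sum over a grid
  into a series over the scales.\<close>

lemma infsum_Sigma_finite_ennreal:
  fixes f :: "nat \<times> 'b \<Rightarrow> ennreal"
  assumes "\<And>j. finite (p j)"
  shows "infsum f (Sigma UNIV p) = (\<Sum>j. \<Sum>Q\<in>p j. f (j, Q))"
proof -
  have fin: "finite (Sigma {..<N} p)" for N :: nat using assms by auto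
  have part: "(\<Sum>j<N. \<Sum>Q\<in>p j. f (j, Q)) = sum f (Sigma {..<N} p)" for N
    using assms by (subst sum.Sigma) auto
  have "infsum f (Sigma UNIV p) = (SUP F\<in>{F. finite F \<and> F \<subseteq> Sigma UNIV p}. sum f F)"
    by (rule nonneg_infsum_complete) simp
  also have "\<dots> = (SUP N. \<Sum>j<N. \<Sum>Q\<in>p j. f (j, Q))"
  proof (rule antisym)
    show "(SUP F\<in>{F. finite F \<and> F \<subseteq> Sigma UNIV p}. sum f F) \<le> (SUP N. \<Sum>j<N. \<Sum>Q\<in>p j. f (j, Q))"
    proof (rule SUP_least)
      fix F assume F: "F \<in> {F. finite F \<and> F \<subseteq> Sigma UNIV p}"
      obtain N where N: "fst ` F \<subseteq> {..<N}"
        using finite_nat_iff_bounded[of "fst ` F"] F by auto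
      have "F \<subseteq> Sigma {..<N} p"
      proof
        fix i assume i: "i \<in> F"
        then have "i \<in> Sigma UNIV p" "fst i \<in> {..<N}" using F N by auto
        then show "i \<in> Sigma {..<N} p" by auto
      qed
      then have "sum f F \<le> sum f (Sigma {..<N} p)"
        using fin by (intro sum_mono2) auto
      also have "\<dots> = (\<Sum>j<N. \<Sum>Q\<in>p j. f (j, Q))" by (rule part[symmetric])
      also have "\<dots> \<le> (SUP N. \<Sum>j<N. \<Sum>Q\<in>p j. f (j, Q))" by (rule SUP_upper) simp
      finally show "sum f F \<le> (SUP N. \<Sum>j<N. \<Sum>Q\<in>p j. f (j, Q))" .
    qed
    show "(SUP N. \<Sum>j<N. \<Sum>Q\<in>p j. f (j, Q)) \<le> (SUP F\<in>{F. finite F \<and> F \<subseteq> Sigma UNIV p}. sum f F)"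
      unfolding part by (intro SUP_least SUP_upper) (use fin in auto)
  qed
  also have "\<dots> = (\<Sum>j. \<Sum>Q\<in>p j. f (j, Q))"
    by (rule suminf_eq_SUP[symmetric])
  finally show ?thesis .
qed

context localized_frame
begin

text \<open>The semicontinuous frame sum, the grid sum and the sampling error are all instances:
  \<open>f j Q\<close> is s(b_j, x), its value at the sample point of Q, or the difference of the
  two.\<close>

abbreviation energy :: "(nat \<Rightarrow> (real^'d::_) set set) \<Rightarrow> (nat \<Rightarrow> (real^'d::_) set \<Rightarrow> real^'d::_ \<Rightarrow> complex) \<Rightarrow> ennreal" where
  "energy p f \<equiv> (\<Sum>j. ennreal (\<nu> j) * (\<Sum>Q\<in>p j. \<integral>\<^sup>+x. ennreal ((cmod (f j Q x))\<^sup>2) * indicator Q x \<partial>completion sphere_measure))"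

text \<open>A triangle inequality for squared norms. Taken with \<open>f\<close> and
  \<open>g\<close> in either order, it transfers an upper as well as a lower bound.\<close>

lemma energy_young:
  assumes mesh: "mesh \<rho> p" and \<tau>: "\<tau> > 0"
    and f: "\<And>j Q. f j Q \<in> borel_measurable (completion sphere_measure)"
    and g: "\<And>j Q. g j Q \<in> borel_measurable (completion sphere_measure)"
  shows "energy p f \<le> ennreal (1 + \<tau>) * energy p g + ennreal (1 + 1 / \<tau>) * energy p (\<lambda>j Q x. f j Q x - g j Q x)"
proof -
  let ?M = "completion (sphere_measure :: (real^'d::_) measure)"
  let ?I = "\<lambda>h j Q. \<integral>\<^sup>+x. ennreal ((cmod (h j Q x))\<^sup>2) * indicator Q x \<partial>?M"
  let ?d = "\<lambda>j Q x. f j Q x - g j Q x"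
  have "energy p f \<le> (\<Sum>j. ennreal (1 + \<tau>) * (ennreal (\<nu> j) * (\<Sum>Q\<in>p j. ?I g j Q))
      + ennreal (1 + 1 / \<tau>) * (ennreal (\<nu> j) * (\<Sum>Q\<in>p j. ?I ?d j Q)))"
  proof (intro suminf_le summableI)
    fix j
    have "?I f j Q \<le> ennreal (1 + \<tau>) * ?I g j Q + ennreal (1 + 1 / \<tau>) * ?I ?d j Q" if "Q \<in> p j" for Q
    proof -
      have Q: "Q \<in> sets ?M" using mesh that by (auto simp: mesh_def)
      have m: "(\<lambda>x. ennreal ((cmod (g j Q x))\<^sup>2) * indicator Q x) \<in> borel_measurable ?M"
          "(\<lambda>x. ennreal ((cmod (?d j Q x))\<^sup>2) * indicator Q x) \<in> borel_measurable ?M"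
        using f[of j Q] g[of j Q] Q by (auto intro!: borel_measurable_times_ennreal borel_measurable_indicator)
      have "?I f j Q \<le> (\<integral>\<^sup>+x. ennreal (1 + \<tau>) * (ennreal ((cmod (g j Q x))\<^sup>2) * indicator Q x)
          + ennreal (1 + 1 / \<tau>) * (ennreal ((cmod (?d j Q x))\<^sup>2) * indicator Q x) \<partial>?M)"
      proof (rule nn_integral_mono)
        fix x
        have "ennreal ((cmod (f j Q x))\<^sup>2) \<le> ennreal ((1 + \<tau>) * (cmod (g j Q x))\<^sup>2 + (1 + 1 / \<tau>) * (cmod (?d j Q x))\<^sup>2)"
          by (intro ennreal_leI norm_square_young \<tau>)
        also have "\<dots> = ennreal (1 + \<tau>) * ennreal ((cmod (g j Q x))\<^sup>2) + ennreal (1 + 1 / \<tau>) * ennreal ((cmod (?d j Q x))\<^sup>2)"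
          using \<tau> by (subst ennreal_plus) (auto simp: ennreal_mult)
        finally show "ennreal ((cmod (f j Q x))\<^sup>2) * indicator Q x
            \<le> ennreal (1 + \<tau>) * (ennreal ((cmod (g j Q x))\<^sup>2) * indicator Q x)
             + ennreal (1 + 1 / \<tau>) * (ennreal ((cmod (?d j Q x))\<^sup>2) * indicator Q x)"
          by (simp add: indicator_def)
      qed
      also have "\<dots> = ennreal (1 + \<tau>) * ?I g j Q + ennreal (1 + 1 / \<tau>) * ?I ?d j Q"
        using m by (simp only: nn_integral_add nn_integral_cmult borel_measurable_times_ennreal borel_measurable_const)
      finally show ?thesis .
    qed
    then have "(\<Sum>Q\<in>p j. ?I f j Q) \<le> (\<Sum>Q\<in>p j. ennreal (1 + \<tau>) * ?I g j Q + ennreal (1 + 1 / \<tau>) * ?I ?d j Q)"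
      by (rule sum_mono)
    also have "\<dots> = ennreal (1 + \<tau>) * (\<Sum>Q\<in>p j. ?I g j Q) + ennreal (1 + 1 / \<tau>) * (\<Sum>Q\<in>p j. ?I ?d j Q)"
      by (simp only: sum.distrib sum_distrib_left)
    finally have "ennreal (\<nu> j) * (\<Sum>Q\<in>p j. ?I f j Q) \<le> ennreal (\<nu> j) * \<dots>"
      by (rule mult_left_mono) simp
    then show "ennreal (\<nu> j) * (\<Sum>Q\<in>p j. ?I f j Q)
        \<le> ennreal (1 + \<tau>) * (ennreal (\<nu> j) * (\<Sum>Q\<in>p j. ?I g j Q))
         + ennreal (1 + 1 / \<tau>) * (ennreal (\<nu> j) * (\<Sum>Q\<in>p j. ?I ?d j Q))"
      by (simp only: distrib_left mult.left_commute)
  qed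
  also have "\<dots> = ennreal (1 + \<tau>) * energy p g + ennreal (1 + 1 / \<tau>) * energy p ?d"
    by (subst suminf_add[symmetric]) (simp_all only: summableI ennreal_suminf_cmult)
  finally show ?thesis .
qed

lemma mesh_nn_integral:
  assumes mesh: "mesh \<rho> p" and h: "h \<in> borel_measurable (completion sphere_measure)"
  shows "(\<Sum>Q\<in>p j. \<integral>\<^sup>+x. h x * indicator Q x \<partial>completion sphere_measure) = (\<integral>\<^sup>+x. h x \<partial>sphere_measure)"
proof -
  let ?M = "completion (sphere_measure :: (real^'d::_) measure)"
  have fin: "finite (p j)" and dis: "disjoint (p j)" and Un: "\<Union> (p j) = usphere"
    and Qm: "\<And>Q. Q \<in> p j \<Longrightarrow> Q \<in> sets ?M"
    using mesh by (auto simp: mesh_def partition_on_def)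
  have "(\<Sum>Q\<in>p j. \<integral>\<^sup>+x. h x * indicator Q x \<partial>?M) = (\<integral>\<^sup>+x. (\<Sum>Q\<in>p j. h x * indicator Q x) \<partial>?M)"
    using h Qm by (intro nn_integral_sum[symmetric]) auto
  also have "\<dots> = (\<integral>\<^sup>+x. h x \<partial>?M)"
  proof (rule nn_integral_cong)
    fix x assume "x \<in> space ?M"
    then have "x \<in> \<Union> (p j)" unfolding Un by simp
    then obtain Q where Q: "Q \<in> p j" "x \<in> Q" by blast
    have "(\<Sum>R\<in>p j. h x * indicator R x) = (\<Sum>R\<in>{Q}. h x * indicator R x)"
      using fin Q dis by (intro sum.mono_neutral_right) (auto simp: indicator_def disjoint_def)
    then show "(\<Sum>R\<in>p j. h x * indicator R x) = h x" using Q by simp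
  qed
  finally show ?thesis by (simp add: nn_integral_completion)
qed

text \<open>The new constant (1 + \<Delta>) / 2 lies midway between \<Delta> and 1 and so leaves the
  slack (1 - \<Delta>) / 2 on either side. In the upper bound, half of it pays for the factor 1 +
  \<tau> and half for the sampling error.\<close>

lemma sampled_frame:
  obtains \<rho> where "\<rho> > 0"
    "\<forall>p t s. mesh \<rho> p \<and> (\<forall>j. \<forall>Q\<in>p j. t j Q \<in> Q) \<and> s \<in> U \<longrightarrow>
       ennreal ((1 - (1 + \<Delta>) / 2) * phase_norm_sq s) \<le> energy p (\<lambda>j Q x. s (b j, t j Q)) \<and>
       energy p (\<lambda>j Q x. s (b j, t j Q)) \<le> ennreal ((1 + (1 + \<Delta>) / 2) * phase_norm_sq s)"
proof -
  obtain c' where c': "c' > 0"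
    "\<forall>\<rho> p t s. 0 < \<rho> \<and> \<rho> \<le> 1 / 4 \<and> \<rho> * b 0 < pi \<and> mesh \<rho> p \<and> (\<forall>j. \<forall>Q\<in>p j. t j Q \<in> Q) \<and> s \<in> U \<longrightarrow>
       energy p (\<lambda>j Q x. s (b j, x) - s (b j, t j Q)) \<le> ennreal ((\<rho> * c')\<^sup>2 / (1 - \<Delta>) * phase_norm_sq s)"
    by (rule sampling_error_bound)
  define e where "e = 1 - \<Delta>"
  have e: "0 < e" "e \<le> 1" using \<Delta> by (auto simp: e_def)
  \<comment> \<open>Chosen with \<tau> = e / 8 so that (1 + 1/\<tau>) \<theta>^2 / e \<le>
    (2/\<tau>) \<theta>^2 / e = e^2 / 4 \<le> e / 4.\<close>
  define \<theta> where "\<theta> = e\<^sup>2 / 8"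
  \<comment> \<open>The entry 1/4 is the limit for moving the centre of the majorant, 1 / b_0 gives
    \<rho> b_0 \<le> 1 < pi, and \<theta> / c' makes the sampling error small.\<close>
  define \<rho> where "\<rho> = min (1 / 4) (min (1 / b 0) (\<theta> / c'))"
  define \<tau> where "\<tau> = e / 8"
  have \<theta>: "\<theta> > 0" using e by (simp add: \<theta>_def)
  have \<tau>: "\<tau> > 0" using e by (simp add: \<tau>_def)
  have \<rho>: "0 < \<rho>" "\<rho> \<le> 1 / 4" "\<rho> * b 0 \<le> 1" "\<rho> * c' \<le> \<theta>"
  proof -
    show "0 < \<rho>" using b_pos[of 0] c'(1) \<theta> by (auto simp: \<rho>_def)
    show "\<rho> \<le> 1 / 4" by (simp only: \<rho>_def min.cobounded1)
    have "\<rho> \<le> 1 / b 0" "\<rho> \<le> \<theta> / c'" by (auto simp: \<rho>_def)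
    then show "\<rho> * b 0 \<le> 1" "\<rho> * c' \<le> \<theta>" using b_pos[of 0] c'(1) by (auto simp: field_simps)
  qed
  have small: "(1 + 1 / \<tau>) * ((\<rho> * c')\<^sup>2 / e) \<le> e / 4"
  proof -
    have "(\<rho> * c')\<^sup>2 \<le> \<theta>\<^sup>2" using \<rho> c'(1) by (intro power_mono) auto
    then have "(1 + 1 / \<tau>) * ((\<rho> * c')\<^sup>2 / e) \<le> (1 + 1 / \<tau>) * (\<theta>\<^sup>2 / e)"
      using e \<tau> by (intro mult_left_mono divide_right_mono) auto
    also have "\<dots> \<le> (2 / \<tau>) * (\<theta>\<^sup>2 / e)"
      using e by (intro mult_right_mono) (auto simp: \<tau>_def field_simps)
    also have "\<dots> = e * e / 4"
      using e by (simp add: \<tau>_def \<theta>_def power2_eq_square field_simps)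
    also have "\<dots> \<le> e / 4" using e mult_left_mono[of e 1 e] by simp
    finally show ?thesis .
  qed
  have "ennreal ((1 - (1 + \<Delta>) / 2) * phase_norm_sq s) \<le> energy p (\<lambda>j Q x. s (b j, t j Q)) \<and>
       energy p (\<lambda>j Q x. s (b j, t j Q)) \<le> ennreal ((1 + (1 + \<Delta>) / 2) * phase_norm_sq s)"
    if mesh: "mesh \<rho> p" and t: "\<forall>j. \<forall>Q\<in>p j. t j Q \<in> Q" and s: "s \<in> U" for p t s
  proof -
    let ?N = "phase_norm_sq s"
    let ?f = "\<lambda>j (Q :: (real^'d::_) set) x. s (b j, x)" and ?g = "\<lambda>j Q (x :: real^'d::_). s (b j, t j Q)"
    have N: "?N \<ge> 0" by (rule phase_norm_sq_nonneg)
    have "s \<in> borel_measurable phase_measure"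
      using s U_L2 by (auto simp: L2_space_def)
    then have fm: "(\<lambda>x. s (b j, x)) \<in> borel_measurable (completion sphere_measure)" for j
      by (intro measurable_completion phase_section_measurable b_pos)
    have gm: "?g j Q \<in> borel_measurable (completion sphere_measure)" for j Q by simp
    define E where "E = energy p (\<lambda>j Q x. ?f j Q x - ?g j Q x)"
    have "\<rho> * b 0 < pi" using \<rho>(3) pi_gt3 by linarith
    then have "E \<le> ennreal ((\<rho> * c')\<^sup>2 / (1 - \<Delta>) * ?N)"
      unfolding E_def by (intro c'(2)[rule_format] conjI \<rho> mesh t s)
    then have "ennreal (1 + 1 / \<tau>) * E \<le> ennreal (1 + 1 / \<tau>) * ennreal ((\<rho> * c')\<^sup>2 / e * ?N)"
      unfolding e_def by (rule mult_left_mono) simp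
    also have "\<dots> = ennreal ((1 + 1 / \<tau>) * ((\<rho> * c')\<^sup>2 / e) * ?N)"
      using \<tau> e N by (subst ennreal_mult[symmetric]) (auto simp: mult.assoc)
    also have "\<dots> \<le> ennreal (e / 4 * ?N)"
      using N small by (intro ennreal_leI mult_right_mono)
    finally have E: "ennreal (1 + 1 / \<tau>) * E \<le> ennreal (e / 4 * ?N)" .
    have sw: "energy p (\<lambda>j Q x. ?g j Q x - ?f j Q x) = E"
      unfolding E_def by (simp only: norm_minus_commute)
    have A: "energy p ?f = (\<Sum>j. ennreal (\<nu> j) * (\<integral>\<^sup>+x. ennreal ((cmod (s (b j, x)))\<^sup>2) \<partial>sphere_measure))"
      using fm by (subst mesh_nn_integral[OF mesh]) auto
    have Au: "energy p ?f \<le> ennreal ((1 + \<Delta>) * ?N)" and Al: "ennreal ((1 - \<Delta>) * ?N) \<le> energy p ?f"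
      unfolding A using frame_lower[OF s] frame_upper[OF s] by auto
    have "energy p ?g \<le> ennreal (1 + \<tau>) * energy p ?f + ennreal (1 + 1 / \<tau>) * E"
      using energy_young[OF mesh \<tau>, of ?g ?f] fm gm unfolding sw by blast
    also have "\<dots> \<le> ennreal (1 + \<tau>) * ennreal ((1 + \<Delta>) * ?N) + ennreal (e / 4 * ?N)"
      by (intro add_mono mult_left_mono Au E) simp
    also have "\<dots> = ennreal (((1 + \<tau>) * (1 + \<Delta>) + e / 4) * ?N)"
    proof -
      have nn: "0 \<le> 1 + \<tau>" "0 \<le> (1 + \<Delta>) * ?N" "0 \<le> e / 4 * ?N" using \<tau> \<Delta> e N by auto
      show ?thesis
        unfolding ennreal_mult[OF nn(1,2), symmetric] ennreal_plus[OF mult_nonneg_nonneg[OF nn(1,2)] nn(3), symmetric]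
        by (simp only: distrib_right[of _ _ ?N] mult.assoc)
    qed
    also have "\<dots> \<le> ennreal ((1 + (1 + \<Delta>) / 2) * ?N)"
    proof (intro ennreal_leI mult_right_mono N)
      have "\<tau> * (1 + \<Delta>) \<le> \<tau> * 2" using \<tau> \<Delta> by (intro mult_left_mono) auto
      moreover have "(1 + \<tau>) * (1 + \<Delta>) = 1 + \<Delta> + \<tau> * (1 + \<Delta>)" by (simp add: algebra_simps)
      moreover have "\<tau> * 2 = (1 - \<Delta>) / 4" "e / 4 = (1 - \<Delta>) / 4" by (auto simp: \<tau>_def e_def)
      ultimately show "(1 + \<tau>) * (1 + \<Delta>) + e / 4 \<le> 1 + (1 + \<Delta>) / 2" by argo
    qed
    finally have upper: "energy p ?g \<le> ennreal ((1 + (1 + \<Delta>) / 2) * ?N)" .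
    \<comment> \<open>By the upper bound the grid energy is finite, so the lower bound can be
      computed in the reals, where the error term may be subtracted.\<close>
    obtain G where G: "energy p ?g = ennreal G" "G \<ge> 0"
      using upper by (cases "energy p ?g") (auto simp: top_unique)
    have "ennreal ((1 - \<Delta>) * ?N) \<le> energy p ?f" by (rule Al)
    also have "\<dots> \<le> ennreal (1 + \<tau>) * energy p ?g + ennreal (1 + 1 / \<tau>) * E"
      unfolding E_def using fm gm by (intro energy_young[OF mesh \<tau>])
    also have "\<dots> \<le> ennreal (1 + \<tau>) * ennreal G + ennreal (e / 4 * ?N)"
      unfolding G by (intro add_mono E) simp
    also have "\<dots> = ennreal ((1 + \<tau>) * G + e / 4 * ?N)"
      using \<tau> e N G by (subst ennreal_plus) (auto simp: ennreal_mult)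
    finally have "(1 - \<Delta>) * ?N \<le> (1 + \<tau>) * G + e / 4 * ?N"
      by (rule ennreal_le_iff[THEN iffD1, rotated]) (use \<tau> e N G in simp)
    then have "3 / 4 * (e * ?N) \<le> (1 + \<tau>) * G"
      unfolding e_def[symmetric] by argo
    moreover have "(1 + \<tau>) * G \<le> 9 / 8 * G"
      using e G by (intro mult_right_mono) (auto simp: \<tau>_def)
    ultimately have "e / 2 * ?N \<le> G"
      using mult_nonneg_nonneg[OF less_imp_le[OF e(1)] N] by argo
    then have "ennreal ((1 - (1 + \<Delta>) / 2) * ?N) \<le> ennreal G"
      by (intro ennreal_leI) (simp add: e_def field_simps)
    with upper G show ?thesis by simp
  qed
  then show ?thesis using \<rho>(1) by (intro that[of \<rho>]) auto
qed

end

section \<open>Grids as meshes with sample points\<close>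

theorem theorem4p2:
  fixes n :: nat
    and \<Psi> :: "real \<Rightarrow> real \<Rightarrow> complex"
    and U :: "(real \<times> (real^'d::{finite,wellorder}) \<Rightarrow> complex) set"
    and K :: "real \<times> (real^'d::_) \<Rightarrow> real \<times> (real^'d::_) \<Rightarrow> complex"
    and b :: "nat \<Rightarrow> real"
    and \<delta> C \<Delta> \<dd> \<omega> \<epsilon> \<epsilon>t :: real
  assumes "n \<ge> 2" and "CARD('d) = n + 1"
    and "spherical_wavelet TYPE('d) \<Psi>"
    and "U = wavelet_image \<Psi>" and "U \<subseteq> L2_space phase_measure"
    and "reproducing_kernel U K"
    and "scale_sequence \<delta> b"
    and "0 \<le> \<Delta>" and "\<Delta> < 1"
    and "\<forall>s\<in>U.
           ennreal ((1 - \<Delta>) * phase_norm_sq s)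
             \<le> ennreal C * (\<Sum>j. (\<integral>\<^sup>+x. ennreal ((cmod (kernel_int K s (b j, x)))\<^sup>2) \<partial>sphere_measure)
                                  * ennreal (scale_weight b (b j))) \<and>
           ennreal C * (\<Sum>j. (\<integral>\<^sup>+x. ennreal ((cmod (kernel_int K s (b j, x)))\<^sup>2) \<partial>sphere_measure)
                              * ennreal (scale_weight b (b j)))
             \<le> ennreal ((1 + \<Delta>) * phase_norm_sq s)"
    and "\<dd> > 0" and "\<omega> > 0" and "\<epsilon> > 0" and "\<epsilon>t > 0" and "\<epsilon>t < 1 / 2"
    and "\<forall>\<alpha>\<in>{0<..b 0}. \<forall>\<beta>\<in>{0<..b 0}. \<forall>x\<in>usphere. \<forall>y\<in>usphere.
           kernel_bound n \<dd> \<omega> \<epsilon> \<epsilon>t (\<alpha>, x) (\<beta>, y) (cmod (K (\<alpha>, x) (\<beta>, y))) \<and>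
           (\<exists>g. has_surface_gradient (\<lambda>z. K (\<alpha>, z) (\<beta>, y)) g x \<and>
                kernel_bound n \<dd> \<omega> \<epsilon> \<epsilon>t (\<alpha>, x) (\<beta>, y) ((\<alpha> + \<beta>) * norm g)) \<and>
           (\<exists>g. has_surface_gradient (\<lambda>z. K (\<alpha>, x) (\<beta>, z)) g y \<and>
                kernel_bound n \<dd> \<omega> \<epsilon> \<epsilon>t (\<alpha>, x) (\<beta>, y) ((\<alpha> + \<beta>) * norm g))"
  shows "\<exists>\<rho>>0. \<forall>\<Xi> P \<Lambda>. grid_of_type \<delta> \<Xi> b P \<Lambda> \<and> \<Xi> \<le> \<rho> \<longrightarrow>
           (\<exists>\<epsilon>'. 0 \<le> \<epsilon>' \<and> \<epsilon>' < 1 \<and>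
             (\<forall>s\<in>U.
                ennreal ((1 - \<epsilon>') * phase_norm_sq s)
                  \<le> ennreal C * (\<Sum>\<^sub>\<infinity>z\<in>\<Lambda>. ennreal (grid_weight b P z * (cmod (kernel_int K s z))\<^sup>2)) \<and>
                ennreal C * (\<Sum>\<^sub>\<infinity>z\<in>\<Lambda>. ennreal (grid_weight b P z * (cmod (kernel_int K s z))\<^sup>2))
                  \<le> ennreal ((1 + \<epsilon>') * phase_norm_sq s)))"
proof (cases "C > 0")
  case False
  \<comment> \<open>For C \<le> 0 the middle term of the frame inequality is 0 in the extended
    nonnegative reals, so all norms in \<open>U\<close> vanish and the constant 0 will do.\<close>
  have zero: "phase_norm_sq s = 0" if "s \<in> U" for s
  proof -
    have "ennreal ((1 - \<Delta>) * phase_norm_sq s) \<le> 0"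
      using assms(10) that False by (auto simp: ennreal_neg)
    then have "(1 - \<Delta>) * phase_norm_sq s \<le> 0"
      by (simp add: ennreal_eq_0_iff)
    then show ?thesis
      using \<open>\<Delta> < 1\<close> phase_norm_sq_nonneg[of s] by (simp add: mult_le_0_iff)
  qed
  show ?thesis
    using False zero by (intro exI[of _ 1] conjI allI impI exI[of _ "0 :: real"] ballI) (auto simp: ennreal_neg)
next
  case True
  define c where "c = \<dd> * max (1 + 2 * \<omega>) (1 + 1 / \<omega>) powr (3 * real n + 2 * \<epsilon>)"
  have inner: "nn_integral sphere_measure (\<lambda>x. ennreal ((cmod (kernel_int K s (b j, x)))\<^sup>2))
      = nn_integral sphere_measure (\<lambda>x. ennreal ((cmod (s (b j, x)))\<^sup>2))" if "s \<in> U" for s j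
  proof (rule nn_integral_cong)
    fix x :: "real^'d::_" assume "x \<in> space sphere_measure"
    then have "(b j, x) \<in> {0<..} \<times> usphere"
      using scale_sequence_pos[OF assms(7)] by simp
    then show "ennreal ((cmod (kernel_int K s (b j, x)))\<^sup>2) = ennreal ((cmod (s (b j, x)))\<^sup>2)"
      using assms(6) that unfolding reproducing_kernel_def by metis
  qed
  have series: "ennreal C * (\<Sum>j. (\<integral>\<^sup>+x. ennreal ((cmod (kernel_int K s (b j, x)))\<^sup>2) \<partial>sphere_measure)
        * ennreal (scale_weight b (b j)))
      = (\<Sum>j. ennreal (C * scale_weight b (b j)) * (\<integral>\<^sup>+x. ennreal ((cmod (s (b j, x)))\<^sup>2) \<partial>sphere_measure))"
    if "s \<in> U" for s
    unfolding inner[OF that] ennreal_suminf_cmult[symmetric]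
    using True scale_weight_nonneg[OF assms(7)] by (simp add: ennreal_mult mult_ac)
  interpret localized_frame \<Psi> U K b \<delta> C \<Delta> n c
  proof
    show "CARD('d) \<ge> 2" "CARD('d) = n + 1" using assms(1,2) by auto
    show "c > 0" using assms by (simp add: c_def)
    show "ennreal ((1 - \<Delta>) * phase_norm_sq s)
        \<le> (\<Sum>j. ennreal (C * scale_weight b (b j)) * (\<integral>\<^sup>+x. ennreal ((cmod (s (b j, x)))\<^sup>2) \<partial>sphere_measure))"
      "(\<Sum>j. ennreal (C * scale_weight b (b j)) * (\<integral>\<^sup>+x. ennreal ((cmod (s (b j, x)))\<^sup>2) \<partial>sphere_measure))
        \<le> ennreal ((1 + \<Delta>) * phase_norm_sq s)" if "s \<in> U" for s
      using assms(10) that unfolding series[OF that, symmetric] by auto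
    fix \<alpha> \<beta> and x y :: "real^'d::_"
    assume pts: "0 < \<alpha>" "\<alpha> \<le> b 0" "0 < \<beta>" "\<beta> \<le> b 0" "x \<in> usphere" "y \<in> usphere"
    then obtain g where g: "has_surface_gradient (\<lambda>z. K (\<alpha>, z) (\<beta>, y)) g x"
        "kernel_bound n \<dd> \<omega> \<epsilon> \<epsilon>t (\<alpha>, x) (\<beta>, y) ((\<alpha> + \<beta>) * norm g)"
      using assms(16) by (meson greaterThanAtMost_iff)
    have "(\<alpha> + \<beta>) * norm g \<le> c * decay_majorant n \<alpha> \<beta> x y"
      unfolding c_def by (rule kernel_bound_imp_decay_majorant[OF g(2)]) (use assms pts in auto)
    with g(1) show "\<exists>g. has_surface_gradient (\<lambda>z. K (\<alpha>, z) (\<beta>, y)) g x \<and>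
        (\<alpha> + \<beta>) * norm g \<le> c * decay_majorant n \<alpha> \<beta> x y"
      by blast
  qed (use assms True in auto)
  obtain \<rho> where \<rho>: "\<rho> > 0"
    "\<forall>p t s. mesh \<rho> p \<and> (\<forall>j. \<forall>Q\<in>p j. t j Q \<in> Q) \<and> s \<in> U \<longrightarrow>
       ennreal ((1 - (1 + \<Delta>) / 2) * phase_norm_sq s) \<le> energy p (\<lambda>j Q x. s (b j, t j Q)) \<and>
       energy p (\<lambda>j Q x. s (b j, t j Q)) \<le> ennreal ((1 + (1 + \<Delta>) / 2) * phase_norm_sq s)"
    by (rule sampled_frame)
  have "\<exists>\<epsilon>'. 0 \<le> \<epsilon>' \<and> \<epsilon>' < 1 \<and>
             (\<forall>s\<in>U.
                ennreal ((1 - \<epsilon>') * phase_norm_sq s)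
                  \<le> ennreal C * (\<Sum>\<^sub>\<infinity>z\<in>\<Lambda>. ennreal (grid_weight b P z * (cmod (kernel_int K s z))\<^sup>2)) \<and>
                ennreal C * (\<Sum>\<^sub>\<infinity>z\<in>\<Lambda>. ennreal (grid_weight b P z * (cmod (kernel_int K s z))\<^sup>2))
                  \<le> ennreal ((1 + \<epsilon>') * phase_norm_sq s))"
    if grid: "grid_of_type \<delta> \<Xi> b P \<Lambda>" and \<Xi>: "\<Xi> \<le> \<rho>" for \<Xi> P \<Lambda>
  proof -
    let ?p = "\<lambda>j. P (b j)"
    have sub: "\<Lambda> \<subseteq> range b \<times> usphere" and part: "\<And>j. partition_on usphere (?p j)"
      and fin: "\<And>j. finite (?p j)"
      and cell: "\<And>j Q. Q \<in> ?p j \<Longrightarrow> Q \<in> sets (completion sphere_measure) \<and>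
          (\<forall>x\<in>Q. \<forall>y\<in>Q. geo_dist x y \<le> \<Xi> * b j) \<and> (\<exists>!y. y \<in> Q \<and> (b j, y) \<in> \<Lambda>)"
      using grid unfolding grid_of_type_def by blast+
    have mesh: "mesh \<rho> ?p"
      unfolding mesh_def
    proof (intro allI conjI ballI fin part)
      fix j Q assume Q: "Q \<in> ?p j"
      then show "Q \<in> sets (completion sphere_measure)" using cell by blast
      fix x y assume "x \<in> Q" "y \<in> Q"
      then have "geo_dist x y \<le> \<Xi> * b j" using cell[OF Q] by blast
      also have "\<dots> \<le> \<rho> * b j" using \<Xi> b_pos[of j] by (intro mult_right_mono) auto
      finally show "geo_dist x y \<le> \<rho> * b j" .
    qed
    define t where "t j Q = (THE y. y \<in> Q \<and> (b j, y) \<in> \<Lambda>)" for j Q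
    have t: "t j Q \<in> Q" "(b j, t j Q) \<in> \<Lambda>" if "Q \<in> ?p j" for j Q
      using theI'[of "\<lambda>y. y \<in> Q \<and> (b j, y) \<in> \<Lambda>"] cell[OF that] unfolding t_def by blast+
    have t_unique: "y = t j Q" if "Q \<in> ?p j" "y \<in> Q" "(b j, y) \<in> \<Lambda>" for j Q y
      using cell[OF that(1)] t[OF that(1)] that(2,3) by blast
    have cell_unique: "Q = R" if "Q \<in> ?p j" "R \<in> ?p j" "y \<in> Q" "y \<in> R" for j Q R y
      using part[of j] that unfolding partition_on_def disjoint_def by blast
    have inj: "inj b" by (rule scale_sequence_inj[OF scales])
    \<comment> \<open>A bijection from pairs of a scale index and a cell onto the grid. It is
      injective since the scales are distinct and the cells disjoint, and surjective since the cells
      cover the sphere and hold one grid point each.\<close>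
    let ?z = "\<lambda>(j, Q). (b j, t j Q)"
    have inj_z: "inj_on ?z (Sigma UNIV ?p)"
    proof (rule inj_onI)
      fix i i' assume i: "i \<in> Sigma UNIV ?p" "i' \<in> Sigma UNIV ?p" "?z i = ?z i'"
      obtain j Q j' Q' where eq: "i = (j, Q)" "i' = (j', Q')" by (metis surj_pair)
      have j: "j = j'" using i(3) eq inj by (auto dest: injD)
      then have "Q = Q'"
        using i eq t(1)[of Q j] t(1)[of Q' j] cell_unique[of Q j Q' "t j Q"] by auto
      with j eq show "i = i'" by simp
    qed
    have range_z: "?z ` Sigma UNIV ?p = \<Lambda>"
    proof (rule equalityI)
      show "?z ` Sigma UNIV ?p \<subseteq> \<Lambda>" using t(2) by auto
      show "\<Lambda> \<subseteq> ?z ` Sigma UNIV ?p"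
      proof
        fix w assume w: "w \<in> \<Lambda>"
        then obtain j y where jy: "w = (b j, y)" "y \<in> usphere" using sub by auto
        then obtain Q where Q: "Q \<in> ?p j" "y \<in> Q"
          using part[of j] unfolding partition_on_def by blast
        then have "y = t j Q" using t_unique w jy by blast
        then have "w = ?z (j, Q)" "(j, Q) \<in> Sigma UNIV ?p" using jy Q by auto
        then show "w \<in> ?z ` Sigma UNIV ?p" by (rule image_eqI)
      qed
    qed
    have sum: "ennreal C * (\<Sum>\<^sub>\<infinity>z\<in>\<Lambda>. ennreal (grid_weight b P z * (cmod (kernel_int K s z))\<^sup>2))
        = energy ?p (\<lambda>j Q x. s (b j, t j Q))" if s: "s \<in> U" for s
    proof -
      let ?F = "\<lambda>z. ennreal (grid_weight b P z * (cmod (kernel_int K s z))\<^sup>2)"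
      \<comment> \<open>The integrand is constant on the cell, so the integral produces the factor
        \<sigma>(Q) of the grid weight.\<close>
      let ?G = "\<lambda>j Q. \<integral>\<^sup>+x. ennreal ((cmod (s (b j, t j Q)))\<^sup>2) * indicator Q x \<partial>completion sphere_measure"
      have summand: "?F (?z (j, Q)) = ennreal (scale_weight b (b j)) * ?G j Q" if Q: "Q \<in> ?p j" for j Q
      proof -
        have tS: "t j Q \<in> usphere"
          using part[of j] Q t(1)[OF Q] unfolding partition_on_def by blast
        have "(THE R. R \<in> ?p j \<and> t j Q \<in> R) = Q"
          using Q t(1)[OF Q] cell_unique by (intro the_equality) blast+
        then have w: "grid_weight b P (b j, t j Q) = measure (completion sphere_measure) Q * scale_weight b (b j)"
          by (simp add: grid_weight_def)
        have k: "kernel_int K s (b j, t j Q) = s (b j, t j Q)"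
          using tS b_pos s by (intro reproducing) auto
        have "?G j Q = ennreal ((cmod (s (b j, t j Q)))\<^sup>2) * ennreal (measure (completion sphere_measure) Q)"
          using cell[OF Q] by (subst nn_integral_cmult_indicator) (auto simp: emeasure_completion_sphere_measure)
        then show ?thesis
          using scale_weight_nonneg[OF scales, of j] by (simp add: w k ennreal_mult mult_ac)
      qed
      have "infsum ?F \<Lambda> = infsum (?F \<circ> ?z) (Sigma UNIV ?p)"
        unfolding range_z[symmetric] by (rule infsum_reindex[OF inj_z])
      also have "\<dots> = (\<Sum>j. \<Sum>Q\<in>?p j. (?F \<circ> ?z) (j, Q))"
        by (rule infsum_Sigma_finite_ennreal[OF fin])
      also have "\<dots> = (\<Sum>j. ennreal (scale_weight b (b j)) * (\<Sum>Q\<in>?p j. ?G j Q))"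
        unfolding sum_distrib_left o_def by (intro suminf_cong sum.cong refl summand)
      finally have "ennreal C * infsum ?F \<Lambda>
          = (\<Sum>j. ennreal C * (ennreal (scale_weight b (b j)) * (\<Sum>Q\<in>?p j. ?G j Q)))"
        by simp
      then show ?thesis
        using True scale_weight_nonneg[OF scales] by (simp only: ennreal_mult[OF less_imp_le] mult.assoc)
    qed
    have "\<forall>s\<in>U. ennreal ((1 - (1 + \<Delta>) / 2) * phase_norm_sq s)
                  \<le> ennreal C * (\<Sum>\<^sub>\<infinity>z\<in>\<Lambda>. ennreal (grid_weight b P z * (cmod (kernel_int K s z))\<^sup>2)) \<and>
                ennreal C * (\<Sum>\<^sub>\<infinity>z\<in>\<Lambda>. ennreal (grid_weight b P z * (cmod (kernel_int K s z))\<^sup>2))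
                  \<le> ennreal ((1 + (1 + \<Delta>) / 2) * phase_norm_sq s)"
    proof
      fix s assume s: "s \<in> U"
      show "ennreal ((1 - (1 + \<Delta>) / 2) * phase_norm_sq s)
                  \<le> ennreal C * (\<Sum>\<^sub>\<infinity>z\<in>\<Lambda>. ennreal (grid_weight b P z * (cmod (kernel_int K s z))\<^sup>2)) \<and>
                ennreal C * (\<Sum>\<^sub>\<infinity>z\<in>\<Lambda>. ennreal (grid_weight b P z * (cmod (kernel_int K s z))\<^sup>2))
                  \<le> ennreal ((1 + (1 + \<Delta>) / 2) * phase_norm_sq s)"
        unfolding sum[OF s] using t(1) by (intro \<rho>(2)[rule_format]) (simp add: mesh s)
    qed
    moreover have "0 \<le> (1 + \<Delta>) / 2" "(1 + \<Delta>) / 2 < 1" using assms(8,9) by auto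
    ultimately show ?thesis by blast
  qed
  with \<rho>(1) show ?thesis by blast
qed

end
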